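(* Let $A$ be an Artin algebra and let $m$ be a positive integer. Assume that $A\in\mathrm{add}\,\mathcal L_A^m$. Then (1) $\mathrm{gl.dim}\,A\le m+1$ and every $X\in\mathrm{ind}\,A$ satisfies $\mathrm{pd}_A X\le m$ or $\mathrm{id}_A X\le 1$; (2) if, moreover, $\mathrm{gl.dim}\,A=m+1$, then $A$ is $(m,1)$-almost hereditary.
   Context: $A$ is an Artin $k$-algebra over a commutative Artin ring $k$; modules are finitely generated left modules; $\mathrm{ind}\,A$ is a full subcategory of $\mathrm{mod}\,A$ consisting of exactly one representative of each isomorphism class of indecomposable modules; $\mathrm{pd}_A$, $\mathrm{id}_A$ denote projective and injective dimension. "Or" is inclusive. $A$ is $(m,1)$-almost hereditary if $\mathrm{gl.dim}\,A=m+1$ and every indecomposable $A$-module $X$ satisfies $\mathrm{pd}_A X\le m$ or $\mathrm{id}_A X\le 1$. For $M,N\in\mathrm{ind}\,A$, a path from $M$ to $N$ is a sequence of nonzero morphisms $M=M_0\to M_1\to\cdots\to M_t=N$ with all $M_i\in\mathrm{ind}\,A$; then $M$ is a predecessor of $N$ (every module is a predecessor of itself). $\mathcal L_A^m$ is the class of $X\in\mathrm{ind}\,A$ all of whose predecessors in $\mathrm{ind}\,A$ have projective dimension at most $m$. $\mathrm{add}\,\mathcal L_A^m$ is the class of modules isomorphic to finite direct sums of modules in $\mathcal L_A^m$; thus $A\in\mathrm{add}\,\mathcal L_A^m$ means that all indecomposable projective $A$-modules lie in $\mathcal L_A^m$ (up to isomorphism). *)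

theory Defs
  imports "HOL-Algebra.Ideal" "HOL-Algebra.Module" "HOL-Library.Extended_Nat"
begin

section \<open>Left modules over a ring that need not be commutative\<close>

text \<open>The locale \<^locale>\<open>module\<close> requires a commutative base ring; the following one has the
  same axioms over an arbitrary ring. The multiplication and unit fields of the record of a
  module carry no meaning, as usual.\<close>

locale left_module = R?: ring R + M?: abelian_group M
  for R :: "('a, 'r) ring_scheme" (structure) and M :: "('a, 'b) module" (structure) +
  assumes smult_closed [simp, intro]:
      "\<lbrakk>a \<in> carrier R; x \<in> carrier M\<rbrakk> \<Longrightarrow> a \<odot>\<^bsub>M\<^esub> x \<in> carrier M"
    and smult_l_distr:
      "\<lbrakk>a \<in> carrier R; b \<in> carrier R; x \<in> carrier M\<rbrakk> \<Longrightarrow>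
       (a \<oplus> b) \<odot>\<^bsub>M\<^esub> x = a \<odot>\<^bsub>M\<^esub> x \<oplus>\<^bsub>M\<^esub> b \<odot>\<^bsub>M\<^esub> x"
    and smult_r_distr:
      "\<lbrakk>a \<in> carrier R; x \<in> carrier M; y \<in> carrier M\<rbrakk> \<Longrightarrow>
       a \<odot>\<^bsub>M\<^esub> (x \<oplus>\<^bsub>M\<^esub> y) = a \<odot>\<^bsub>M\<^esub> x \<oplus>\<^bsub>M\<^esub> a \<odot>\<^bsub>M\<^esub> y"
    and smult_assoc1:
      "\<lbrakk>a \<in> carrier R; b \<in> carrier R; x \<in> carrier M\<rbrakk> \<Longrightarrow>
       (a \<otimes> b) \<odot>\<^bsub>M\<^esub> x = a \<odot>\<^bsub>M\<^esub> (b \<odot>\<^bsub>M\<^esub> x)"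
    and smult_one [simp]:
      "x \<in> carrier M \<Longrightarrow> \<one> \<odot>\<^bsub>M\<^esub> x = x"

definition fin_gen :: "('a, 'r) ring_scheme \<Rightarrow> ('a, 'b) module \<Rightarrow> bool" where
  "fin_gen R M \<longleftrightarrow>
     (\<exists>S. finite S \<and> S \<subseteq> carrier M \<and> (\<forall>N. submodule N R M \<and> S \<subseteq> N \<longrightarrow> N = carrier M))"

definition fg_module :: "('a, 'r) ring_scheme \<Rightarrow> ('a, 'b) module \<Rightarrow> bool" where
  "fg_module R M \<longleftrightarrow> left_module R M \<and> fin_gen R M"

text \<open>Homomorphisms are only relevant on the carrier of their domain.\<close>

definition lmod_hom ::
    "('a, 'r) ring_scheme \<Rightarrow> ('a, 'b) module \<Rightarrow> ('a, 'c) module \<Rightarrow> ('b \<Rightarrow> 'c) set" where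
  "lmod_hom R M N = {f. f \<in> carrier M \<rightarrow> carrier N \<and>
     (\<forall>x\<in>carrier M. \<forall>y\<in>carrier M. f (x \<oplus>\<^bsub>M\<^esub> y) = f x \<oplus>\<^bsub>N\<^esub> f y) \<and>
     (\<forall>a\<in>carrier R. \<forall>x\<in>carrier M. f (a \<odot>\<^bsub>M\<^esub> x) = a \<odot>\<^bsub>N\<^esub> f x)}"

definition lmod_ker :: "('a, 'b) module \<Rightarrow> ('a, 'c) module \<Rightarrow> ('b \<Rightarrow> 'c) \<Rightarrow> 'b set" where
  "lmod_ker M N f = {x \<in> carrier M. f x = \<zero>\<^bsub>N\<^esub>}"

definition lmod_iso :: "('a, 'r) ring_scheme \<Rightarrow> ('a, 'b) module \<Rightarrow> ('a, 'c) module \<Rightarrow> bool" where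
  "lmod_iso R M N \<longleftrightarrow> (\<exists>f\<in>lmod_hom R M N. bij_betw f (carrier M) (carrier N))"

definition nonzero_hom_exists ::
    "('a, 'r) ring_scheme \<Rightarrow> ('a, 'b) module \<Rightarrow> ('a, 'c) module \<Rightarrow> bool" where
  "nonzero_hom_exists R M N \<longleftrightarrow> (\<exists>f\<in>lmod_hom R M N. \<exists>x\<in>carrier M. f x \<noteq> \<zero>\<^bsub>N\<^esub>)"

definition indecomposable :: "('a, 'r) ring_scheme \<Rightarrow> ('a, 'b) module \<Rightarrow> bool" where
  "indecomposable R M \<longleftrightarrow> carrier M \<noteq> {\<zero>\<^bsub>M\<^esub>} \<and>
     (\<forall>U V. submodule U R M \<and> submodule V R M \<and>
            U \<inter> V = {\<zero>\<^bsub>M\<^esub>} \<and> U <+>\<^bsub>M\<^esub> V = carrier M \<longrightarrow>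
            U = {\<zero>\<^bsub>M\<^esub>} \<or> V = {\<zero>\<^bsub>M\<^esub>})"

text \<open>External direct sum of the modules \<open>F 0, \<dots>, F (n - 1)\<close>.\<close>

definition direct_sum :: "nat \<Rightarrow> (nat \<Rightarrow> ('a, 'b) module) \<Rightarrow> ('a, nat \<Rightarrow> 'b) module" where
  "direct_sum n F =
     \<lparr>carrier = (\<Pi>\<^sub>E i\<in>{..<n}. carrier (F i)), monoid.mult = undefined, one = undefined,
      ring.zero = (\<lambda>i\<in>{..<n}. \<zero>\<^bsub>F i\<^esub>), ring.add = (\<lambda>x y. \<lambda>i\<in>{..<n}. x i \<oplus>\<^bsub>F i\<^esub> y i),
      smult = (\<lambda>a x. \<lambda>i\<in>{..<n}. a \<odot>\<^bsub>F i\<^esub> x i)\<rparr>"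

definition in_add ::
    "('a, 'r) ring_scheme \<Rightarrow> ('a, 'b) module set \<Rightarrow> ('a, 'c) module \<Rightarrow> bool" where
  "in_add R C M \<longleftrightarrow> (\<exists>n F. (\<forall>i<n. F i \<in> C) \<and> lmod_iso R M (direct_sum n F))"


section \<open>Artin algebras\<close>

locale comm_artin_ring = cring k for k :: "('k, 's) ring_scheme" (structure) +
  assumes descending_chain:
    "\<lbrakk>\<And>n::nat. ideal (I n) k; \<And>n. I (Suc n) \<subseteq> I n\<rbrakk> \<Longrightarrow> \<exists>N. \<forall>n\<ge>N. I n = I N"

text \<open>The additive group of \<open>A\<close>, with scalars acting by left multiplication through \<open>\<phi>\<close>.\<close>

definition module_via ::
    "('k \<Rightarrow> 'a) \<Rightarrow> ('a, 'r) ring_scheme \<Rightarrow> ('k, 'a) module" where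
  "module_via \<phi> A = \<lparr>carrier = carrier A, monoid.mult = monoid.mult A, one = one A,
     ring.zero = ring.zero A, ring.add = ring.add A, smult = (\<lambda>c x. \<phi> c \<otimes>\<^bsub>A\<^esub> x)\<rparr>"

definition regular_module :: "('a, 'r) ring_scheme \<Rightarrow> ('a, 'a) module" where
  "regular_module A = module_via (\<lambda>a. a) A"

locale artin_algebra = comm_artin_ring k + A?: ring A
  for k :: "('k, 's) ring_scheme" and A :: "('a, 'r) ring_scheme" and \<phi> :: "'k \<Rightarrow> 'a" +
  assumes structure_hom: "\<phi> \<in> ring_hom k A"
    and central: "\<lbrakk>c \<in> carrier k; a \<in> carrier A\<rbrakk> \<Longrightarrow> \<phi> c \<otimes>\<^bsub>A\<^esub> a = a \<otimes>\<^bsub>A\<^esub> \<phi> c"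
    and finite_over_base: "fin_gen k (module_via \<phi> A)"


section \<open>The category of finitely generated modules\<close>

text \<open>Quantification over all finitely generated modules needs one fixed type of elements. A
  finitely generated module is a quotient of some \<open>A\<^sup>n\<close>, so that its elements can be taken to be
  sets of coefficient vectors; hence the type below suffices. See lemma \<open>fg_module_representable\<close>.\<close>

type_synonym 'a amod = "('a, (nat \<Rightarrow> 'a) set) module"

definition transport_module :: "('b \<Rightarrow> 'c) \<Rightarrow> ('a, 'b) module \<Rightarrow> ('a, 'c) module" where
  "transport_module F M =
     (let G = inv_into (carrier M) F in
      \<lparr>carrier = F ` carrier M, monoid.mult = undefined, one = undefined, ring.zero = F \<zero>\<^bsub>M\<^esub>,
       ring.add = (\<lambda>x y. F (G x \<oplus>\<^bsub>M\<^esub> G y)), smult = (\<lambda>a x. F (a \<odot>\<^bsub>M\<^esub> G x))\<rparr>)"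

lemma (in left_module) transport_module:
  assumes inj: "inj_on F (carrier M)"
  shows "left_module R (transport_module F M)"
    and "F \<in> lmod_hom R M (transport_module F M)"
    and "bij_betw F (carrier M) (carrier (transport_module F M))"
proof -
  let ?N = "transport_module F M"
  have G [simp]: "inv_into (carrier M) F (F x) = x" if "x \<in> carrier M" for x
    using inj that by simp
  have carr: "carrier ?N = F ` carrier M" and zero: "\<zero>\<^bsub>?N\<^esub> = F \<zero>\<^bsub>M\<^esub>"
    by (simp_all add: transport_module_def Let_def)
  have add: "F x \<oplus>\<^bsub>?N\<^esub> F y = F (x \<oplus>\<^bsub>M\<^esub> y)" if "x \<in> carrier M" "y \<in> carrier M" for x y
    using that by (simp add: transport_module_def Let_def)
  have smult: "a \<odot>\<^bsub>?N\<^esub> F x = F (a \<odot>\<^bsub>M\<^esub> x)" if "x \<in> carrier M" for a x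
    using that by (simp add: transport_module_def Let_def)
  have "abelian_group ?N"
  proof (rule abelian_groupI)
    fix x assume "x \<in> carrier ?N"
    then obtain u where u: "u \<in> carrier M" "x = F u" by (auto simp: carr)
    show "\<exists>y\<in>carrier ?N. y \<oplus>\<^bsub>?N\<^esub> x = \<zero>\<^bsub>?N\<^esub>"
      by (rule bexI[of _ "F (\<ominus>\<^bsub>M\<^esub> u)"]) (use u in \<open>auto simp: carr add zero M.l_neg\<close>)
  qed (auto simp: carr add zero M.a_ac)
  then interpret N: abelian_group ?N .
  show "left_module R ?N"
    by (intro left_module.intro left_module_axioms.intro R.ring_axioms N.abelian_group_axioms)
       (auto simp: carr add smult smult_l_distr smult_r_distr smult_assoc1)
  show "F \<in> lmod_hom R M ?N" by (auto simp: lmod_hom_def carr add smult)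
  show "bij_betw F (carrier M) (carrier ?N)" using inj by (auto simp: bij_betw_def carr)
qed

lemma (in left_module) l_null:
  assumes x: "x \<in> carrier M"
  shows "\<zero> \<odot>\<^bsub>M\<^esub> x = \<zero>\<^bsub>M\<^esub>"
proof -
  have "\<zero> \<odot>\<^bsub>M\<^esub> x \<oplus>\<^bsub>M\<^esub> \<zero> \<odot>\<^bsub>M\<^esub> x = \<zero> \<odot>\<^bsub>M\<^esub> x"
    by (subst smult_l_distr[symmetric]) (use x in simp_all)
  then show ?thesis using x by (simp add: M.add.l_cancel_one)
qed

lemma (in left_module) r_null:
  assumes a: "a \<in> carrier R"
  shows "a \<odot>\<^bsub>M\<^esub> \<zero>\<^bsub>M\<^esub> = \<zero>\<^bsub>M\<^esub>"
proof -
  have "a \<odot>\<^bsub>M\<^esub> \<zero>\<^bsub>M\<^esub> \<oplus>\<^bsub>M\<^esub> a \<odot>\<^bsub>M\<^esub> \<zero>\<^bsub>M\<^esub> = a \<odot>\<^bsub>M\<^esub> \<zero>\<^bsub>M\<^esub>"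
    by (subst smult_r_distr[symmetric]) (use a in simp_all)
  then show ?thesis using a by (simp add: M.add.l_cancel_one)
qed

lemma (in left_module) minus_one:
  assumes x: "x \<in> carrier M"
  shows "(\<ominus> \<one>) \<odot>\<^bsub>M\<^esub> x = \<ominus>\<^bsub>M\<^esub> x"
proof -
  have "(\<ominus> \<one>) \<odot>\<^bsub>M\<^esub> x \<oplus>\<^bsub>M\<^esub> x = \<zero>\<^bsub>M\<^esub>"
    using smult_l_distr[of "\<ominus> \<one>" \<one> x] x by (simp add: R.l_neg l_null)
  then show ?thesis using x by (intro M.minus_equality[symmetric]) simp_all
qed

lemma (in left_module) submoduleI':
  assumes "H \<subseteq> carrier M" "\<zero>\<^bsub>M\<^esub> \<in> H" "\<And>x y. x \<in> H \<Longrightarrow> y \<in> H \<Longrightarrow> x \<oplus>\<^bsub>M\<^esub> y \<in> H"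
    "\<And>a x. a \<in> carrier R \<Longrightarrow> x \<in> H \<Longrightarrow> a \<odot>\<^bsub>M\<^esub> x \<in> H"
  shows "submodule H R M"
proof (intro submodule.intro submodule_axioms.intro)
  have "\<ominus>\<^bsub>M\<^esub> x \<in> H" if "x \<in> H" for x
    using assms(1) assms(4)[of "\<ominus> \<one>" x] that by (auto simp: minus_one subset_iff)
  then show "subgroup H (add_monoid M)"
    using assms by (intro subgroup.intro) (auto simp: a_inv_def)
qed (use assms in auto)

lemma fg_module_representable:
  fixes M :: "('a, 'b) module"
  assumes "fg_module R M"
  shows "\<exists>N :: 'a amod. fg_module R N \<and> lmod_iso R M N"
proof -
  interpret left_module R M using assms by (simp add: fg_module_def)
  from assms have "fin_gen R M" by (simp add: fg_module_def)
  then obtain S where S: "finite S" "S \<subseteq> carrier M"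
      "\<And>N. submodule N R M \<Longrightarrow> S \<subseteq> N \<Longrightarrow> N = carrier M"
    unfolding fin_gen_def by (elim exE conjE) simp
  obtain s and n :: nat where s: "S = s ` {..<n}"
    using finite_imp_nat_seg_image_inj_on[OF S(1)] by (auto simp flip: lessThan_def)
  have sM [simp]: "s i \<in> carrier M" if "i < n" for i using S(2) s that by auto
  define comb where "comb c = (\<Oplus>\<^bsub>M\<^esub>i\<in>{..<n}. c i \<odot>\<^bsub>M\<^esub> s i)" for c
  define C where "C = {..<n} \<rightarrow> carrier R"
  have CD: "c i \<in> carrier R" if "c \<in> C" "i < n" for c i using that by (auto simp: C_def)
  have "submodule (comb ` C) R M"
  proof (rule submoduleI')
    show "comb ` C \<subseteq> carrier M" by (auto simp: comb_def CD intro!: M.finsum_closed)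
    have "comb (\<lambda>_. \<zero>\<^bsub>R\<^esub>) = (\<Oplus>\<^bsub>M\<^esub>i\<in>{..<n}. \<zero>\<^bsub>M\<^esub>)"
      unfolding comb_def by (rule M.finsum_cong') (auto simp: l_null)
    then have "\<zero>\<^bsub>M\<^esub> = comb (\<lambda>_. \<zero>\<^bsub>R\<^esub>)" by simp
    then show "\<zero>\<^bsub>M\<^esub> \<in> comb ` C" by (auto simp: C_def)
  next
    fix x y assume "x \<in> comb ` C" "y \<in> comb ` C"
    then obtain c d where cd: "c \<in> C" "d \<in> C" "x = comb c" "y = comb d" by blast
    have "x \<oplus>\<^bsub>M\<^esub> y = (\<Oplus>\<^bsub>M\<^esub>i\<in>{..<n}. c i \<odot>\<^bsub>M\<^esub> s i \<oplus>\<^bsub>M\<^esub> d i \<odot>\<^bsub>M\<^esub> s i)"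
      unfolding cd comb_def by (rule M.finsum_addf[symmetric]) (use cd CD in auto)
    also have "\<dots> = comb (\<lambda>i. c i \<oplus>\<^bsub>R\<^esub> d i)"
      unfolding comb_def by (rule M.finsum_cong') (use cd CD in \<open>auto simp: smult_l_distr\<close>)
    finally have "x \<oplus>\<^bsub>M\<^esub> y = comb (\<lambda>i. c i \<oplus>\<^bsub>R\<^esub> d i)" .
    moreover have "(\<lambda>i. c i \<oplus>\<^bsub>R\<^esub> d i) \<in> C" using cd by (auto simp: C_def)
    ultimately show "x \<oplus>\<^bsub>M\<^esub> y \<in> comb ` C" by blast
  next
    fix a x assume a: "a \<in> carrier R" and "x \<in> comb ` C"
    then obtain c where c: "c \<in> C" "x = comb c" by blast
    have "a \<odot>\<^bsub>M\<^esub> (\<Oplus>\<^bsub>M\<^esub>i\<in>I. g i) = (\<Oplus>\<^bsub>M\<^esub>i\<in>I. a \<odot>\<^bsub>M\<^esub> g i)"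
      if "finite I" "g \<in> I \<rightarrow> carrier M" for I :: "nat set" and g
      using that
    proof (induction I)
      case empty then show ?case by (simp add: a r_null)
    next
      case (insert i I)
      have "(\<lambda>i. a \<odot>\<^bsub>M\<^esub> g i) \<in> I \<rightarrow> carrier M" "g \<in> I \<rightarrow> carrier M"
        using insert.prems a by auto
      with insert show ?case by (simp add: a smult_r_distr)
    qed
    then have "a \<odot>\<^bsub>M\<^esub> x = (\<Oplus>\<^bsub>M\<^esub>i\<in>{..<n}. a \<odot>\<^bsub>M\<^esub> (c i \<odot>\<^bsub>M\<^esub> s i))"
      unfolding c comb_def using c CD by auto
    also have "\<dots> = comb (\<lambda>i. a \<otimes>\<^bsub>R\<^esub> c i)"
      unfolding comb_def by (rule M.finsum_cong') (use a c CD in \<open>auto simp: smult_assoc1\<close>)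
    finally have "a \<odot>\<^bsub>M\<^esub> x = comb (\<lambda>i. a \<otimes>\<^bsub>R\<^esub> c i)" .
    moreover have "(\<lambda>i. a \<otimes>\<^bsub>R\<^esub> c i) \<in> C" using a c by (auto simp: C_def)
    ultimately show "a \<odot>\<^bsub>M\<^esub> x \<in> comb ` C" by blast
  qed
  moreover have "S \<subseteq> comb ` C"
  proof
    fix x assume "x \<in> S"
    then obtain j where j: "j < n" "x = s j" using s by auto
    have "comb (\<lambda>i. if j = i then \<one>\<^bsub>R\<^esub> else \<zero>\<^bsub>R\<^esub>)
        = (\<Oplus>\<^bsub>M\<^esub>i\<in>{..<n}. if j = i then s i else \<zero>\<^bsub>M\<^esub>)"
      unfolding comb_def by (rule M.finsum_cong') (auto simp: l_null)
    also have "\<dots> = s j" using j by (intro M.finsum_singleton) auto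
    finally have "x = comb (\<lambda>i. if j = i then \<one>\<^bsub>R\<^esub> else \<zero>\<^bsub>R\<^esub>)" using j by simp
    then show "x \<in> comb ` C" by (auto simp: C_def)
  qed
  ultimately have onto: "comb ` C = carrier M" by (rule S(3))
  define F where "F x = {c \<in> C. comb c = x}" for x
  have inj: "inj_on F (carrier M)"
  proof (rule inj_onI)
    fix x y assume "x \<in> carrier M" "y \<in> carrier M" and eq: "F x = F y"
    then obtain c where "c \<in> C" "x = comb c" using onto by auto
    then have "c \<in> F y" using eq by (auto simp: F_def)
    then show "x = y" using \<open>x = comb c\<close> by (simp add: F_def)
  qed
  let ?N = "transport_module F M"
  note N = transport_module[OF inj]
  interpret N: left_module R ?N by (rule N(1))
  have F_add: "F (x \<oplus>\<^bsub>M\<^esub> y) = F x \<oplus>\<^bsub>?N\<^esub> F y" if "x \<in> carrier M" "y \<in> carrier M" for x y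
    using N(2) that by (auto simp: lmod_hom_def)
  have F_smult: "F (a \<odot>\<^bsub>M\<^esub> x) = a \<odot>\<^bsub>?N\<^esub> F x" if "a \<in> carrier R" "x \<in> carrier M" for a x
    using N(2) that by (auto simp: lmod_hom_def)
  have carrN: "carrier ?N = F ` carrier M" using N(3) by (simp add: bij_betw_def)
  have zeroN: "\<zero>\<^bsub>?N\<^esub> = F \<zero>\<^bsub>M\<^esub>" by (simp add: transport_module_def Let_def)
  have "fin_gen R ?N"
    unfolding fin_gen_def
  proof (intro exI[of _ "F ` S"] conjI allI impI)
    show "finite (F ` S)" "F ` S \<subseteq> carrier ?N" using S carrN by auto
    fix U assume U: "submodule U R ?N \<and> F ` S \<subseteq> U"
    interpret U: submodule U R ?N using U by simp
    have Usub: "U \<subseteq> carrier ?N" using U.subset by simp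
    have "submodule {x \<in> carrier M. F x \<in> U} R M"
      using U.one_closed U.m_closed U.smult_closed
      by (intro submoduleI') (simp_all add: F_add F_smult flip: zeroN)
    moreover have "S \<subseteq> {x \<in> carrier M. F x \<in> U}" using S(2) U by auto
    ultimately have "{x \<in> carrier M. F x \<in> U} = carrier M" by (rule S(3))
    then show "U = carrier ?N" using Usub carrN by auto
  qed
  then have "fg_module R ?N" using N(1) by (simp add: fg_module_def)
  moreover have "lmod_iso R M ?N" using N(2,3) by (auto simp: lmod_iso_def)
  ultimately show ?thesis by blast
qed

text \<open>Projectivity and injectivity refer to the category of finitely generated modules.\<close>

definition projective_module :: "('a, 'r) ring_scheme \<Rightarrow> 'a amod \<Rightarrow> bool" where
  "projective_module A P \<longleftrightarrow> fg_module A P \<and>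
     (\<forall>(M :: 'a amod) (N :: 'a amod) g f.
        fg_module A M \<and> fg_module A N \<and>
        g \<in> lmod_hom A M N \<and> g ` carrier M = carrier N \<and> f \<in> lmod_hom A P N \<longrightarrow>
        (\<exists>h\<in>lmod_hom A P M. \<forall>x\<in>carrier P. g (h x) = f x))"

definition injective_module :: "('a, 'r) ring_scheme \<Rightarrow> 'a amod \<Rightarrow> bool" where
  "injective_module A E \<longleftrightarrow> fg_module A E \<and>
     (\<forall>(M :: 'a amod) (N :: 'a amod) g f.
        fg_module A M \<and> fg_module A N \<and>
        g \<in> lmod_hom A M N \<and> inj_on g (carrier M) \<and> f \<in> lmod_hom A M E \<longrightarrow>
        (\<exists>h\<in>lmod_hom A N E. \<forall>x\<in>carrier M. h (g x) = f x))"

text \<open>An exact sequence \<open>0 \<rightarrow> P n \<rightarrow> \<dots> \<rightarrow> P 0 \<rightarrow> L \<rightarrow> 0\<close>, with \<open>d 0 : P 0 \<rightarrow> L\<close> and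
  \<open>d (i + 1) : P (i + 1) \<rightarrow> P i\<close>; \<open>case_nat L P\<close> is the sequence \<open>L, P 0, P 1, \<dots>\<close>.\<close>

definition has_projective_resolution ::
    "('a, 'r) ring_scheme \<Rightarrow> 'a amod \<Rightarrow> nat \<Rightarrow> bool" where
  "has_projective_resolution A L n \<longleftrightarrow>
     (\<exists>(P :: nat \<Rightarrow> 'a amod) d.
        (\<forall>i\<le>n. projective_module A (P i)) \<and>
        (\<forall>i\<le>n. d i \<in> lmod_hom A (P i) (case_nat L P i)) \<and>
        d 0 ` carrier (P 0) = carrier L \<and>
        (\<forall>i<n. d (Suc i) ` carrier (P (Suc i)) = lmod_ker (P i) (case_nat L P i) (d i)) \<and>
        inj_on (d n) (carrier (P n)))"

text \<open>An exact sequence \<open>0 \<rightarrow> L \<rightarrow> E 0 \<rightarrow> \<dots> \<rightarrow> E n \<rightarrow> 0\<close>, with \<open>d 0 : L \<rightarrow> E 0\<close> and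
  \<open>d (i + 1) : E i \<rightarrow> E (i + 1)\<close>; the indexing is dual to the one above.\<close>

definition has_injective_resolution ::
    "('a, 'r) ring_scheme \<Rightarrow> 'a amod \<Rightarrow> nat \<Rightarrow> bool" where
  "has_injective_resolution A L n \<longleftrightarrow>
     (\<exists>(E :: nat \<Rightarrow> 'a amod) d.
        (\<forall>i\<le>n. injective_module A (E i)) \<and>
        (\<forall>i\<le>n. d i \<in> lmod_hom A (case_nat L E i) (E i)) \<and>
        inj_on (d 0) (carrier L) \<and>
        (\<forall>i<n. d i ` carrier (case_nat L E i) = lmod_ker (E i) (E (Suc i)) (d (Suc i))) \<and>
        d n ` carrier (case_nat L E n) = carrier (E n))"

text \<open>The infimum of the empty set is \<open>\<infinity>\<close>; the zero module has both dimensions \<open>0\<close>.\<close>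

definition proj_dim :: "('a, 'r) ring_scheme \<Rightarrow> 'a amod \<Rightarrow> enat" where
  "proj_dim A L = Inf (enat ` {n. has_projective_resolution A L n})"

definition inj_dim :: "('a, 'r) ring_scheme \<Rightarrow> 'a amod \<Rightarrow> enat" where
  "inj_dim A L = Inf (enat ` {n. has_injective_resolution A L n})"

definition gl_dim :: "('a, 'r) ring_scheme \<Rightarrow> enat" where
  "gl_dim A = Sup (proj_dim A ` {L :: 'a amod. fg_module A L})"

definition m1_almost_hereditary :: "nat \<Rightarrow> ('a, 'r) ring_scheme \<Rightarrow> bool" where
  "m1_almost_hereditary m A \<longleftrightarrow>
     gl_dim A = enat (m + 1) \<and>
     (\<forall>L :: 'a amod. fg_module A L \<and> indecomposable A L \<longrightarrow>
        proj_dim A L \<le> enat m \<or> inj_dim A L \<le> 1)"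

text \<open>\<open>indA\<close> is the set of objects of a choice of \<open>ind A\<close>.\<close>

definition is_ind :: "('a, 'r) ring_scheme \<Rightarrow> 'a amod set \<Rightarrow> bool" where
  "is_ind A indA \<longleftrightarrow>
     (\<forall>L\<in>indA. fg_module A L \<and> indecomposable A L) \<and>
     (\<forall>L :: 'a amod. fg_module A L \<and> indecomposable A L \<longrightarrow>
        (\<exists>!Y. Y \<in> indA \<and> lmod_iso A L Y))"

definition predecessor ::
    "('a, 'r) ring_scheme \<Rightarrow> 'a amod set \<Rightarrow> 'a amod \<Rightarrow> 'a amod \<Rightarrow> bool" where
  "predecessor A indA M N \<longleftrightarrow> M \<in> indA \<and> N \<in> indA \<and>
     (\<lambda>L Y. L \<in> indA \<and> Y \<in> indA \<and> nonzero_hom_exists A L Y)\<^sup>*\<^sup>* M N"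

definition left_part :: "nat \<Rightarrow> ('a, 'r) ring_scheme \<Rightarrow> 'a amod set \<Rightarrow> 'a amod set" where
  "left_part m A indA = {L \<in> indA. \<forall>Y. predecessor A indA Y L \<longrightarrow> proj_dim A Y \<le> enat m}"

end

theory Submission
  imports Defs
begin

text \<open>
  Write \<open>C\<close> for the left part. By assumption the ring is a direct sum of members of \<open>C\<close>, so that free
  modules and their submodules are cogenerated by \<open>C\<close>: each nonzero element is detected by a
  homomorphism to some \<open>F \<in> C\<close>. An indecomposable summand of such a submodule is a predecessor of some
  \<open>F\<close> and has projective dimension at most \<open>m\<close> (lemma \<open>pd_le_cogenerated\<close>). Since the first syzygy of
  every module is a submodule of a free module, the global dimension is at most \<open>m + 1\<close>.

  Now let \<open>L\<close> be indecomposable with projective dimension greater than \<open>m\<close>. Then there is no path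
  \<open>L \<rightarrow> Y \<rightarrow> F\<close> with \<open>F \<in> C\<close>. Let \<open>K\<close> be a submodule of a free module and \<open>0 \<rightarrow> L \<rightarrow> E \<rightarrow> K \<rightarrow> 0\<close> an exact
  sequence. If it did not split, some indecomposable summand \<open>Y\<close> of \<open>E\<close> would have nonzero components
  \<open>L \<rightarrow> Y\<close> and \<open>Y \<rightarrow> K\<close>, and composing with a map that detects the latter would give a forbidden path.
  Hence all these sequences split (lemmas \<open>separating_endomorphism\<close> and \<open>extension_splits\<close>). This
  replaces the usual argument with Auslander-Reiten translates. Because every first syzygy is such a
  \<open>K\<close>, the second extension groups with values in \<open>L\<close> vanish, and the cokernel of an embedding of \<open>L\<close>
  into an injective module is injective (lemma \<open>injective_cokernel\<close>), so that \<open>L\<close> has injective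
  dimension at most one.

  The last step needs finitely generated injective modules, and this is where the base ring enters.
  Finitely generated modules have finite length over it, because a commutative Artinian ring has
  finite length (lemma \<open>finite_length\<close>). The lengths over the base ring of all essential extensions of
  a given module are bounded (lemma \<open>essential_extension_height\<close>), and an essential extension of maximal
  length is injective (lemma \<open>injective_embedding\<close>).
\<close>

section \<open>Homomorphisms, submodules and quotients\<close>

lemma (in abelian_group) diff_self: "x \<in> carrier G \<Longrightarrow> x \<ominus> x = \<zero>"
  by (simp add: a_minus_def r_neg)

lemma (in abelian_group) diff_add_diff:
  "\<lbrakk>x \<in> carrier G; y \<in> carrier G; z \<in> carrier G\<rbrakk> \<Longrightarrow> (z \<ominus> x) \<oplus> (x \<ominus> y) = z \<ominus> y"
  by (simp add: a_minus_def a_assoc r_neg1)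

lemma (in abelian_group) diff_eq_zero:
  "\<lbrakk>x \<in> carrier G; y \<in> carrier G\<rbrakk> \<Longrightarrow> x \<ominus> y = \<zero> \<longleftrightarrow> x = y"
  by (metis a_minus_def add.inv_solve_right' l_zero a_inv_closed zero_closed)

lemma (in abelian_group) diff_zero: "x \<in> carrier G \<Longrightarrow> x \<ominus> \<zero> = x"
  by (simp add: a_minus_def)

lemma (in abelian_group) minus_diff:
  "\<lbrakk>x \<in> carrier G; z \<in> carrier G\<rbrakk> \<Longrightarrow> \<ominus> (z \<ominus> x) = x \<ominus> z"
  by (simp add: a_minus_def minus_add a_comm)

lemma (in abelian_group) diff_diff_cancel:
  "\<lbrakk>x \<in> carrier G; y \<in> carrier G; z \<in> carrier G\<rbrakk> \<Longrightarrow> (z \<ominus> y) \<ominus> (z \<ominus> x) = x \<ominus> y"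
proof -
  assume h: "x \<in> carrier G" "y \<in> carrier G" "z \<in> carrier G"
  have "(z \<ominus> y) \<ominus> (z \<ominus> x) = (z \<ominus> y) \<oplus> \<ominus> (z \<ominus> x)" by (rule a_minus_def)
  also have "\<dots> = (z \<ominus> y) \<oplus> (x \<ominus> z)" using h by (simp add: minus_diff)
  also have "\<dots> = (x \<ominus> z) \<oplus> (z \<ominus> y)" using h by (simp add: a_comm)
  finally show ?thesis using h by (simp add: diff_add_diff)
qed

lemma (in abelian_group) diff_add_cancel:
  "\<lbrakk>x \<in> carrier G; y \<in> carrier G\<rbrakk> \<Longrightarrow> (x \<ominus> y) \<oplus> y = x"
  by (simp add: a_minus_def a_assoc l_neg)

lemma hom_closed: "f \<in> lmod_hom R M N \<Longrightarrow> x \<in> carrier M \<Longrightarrow> f x \<in> carrier N"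
  by (auto simp: lmod_hom_def)

lemma hom_add: "f \<in> lmod_hom R M N \<Longrightarrow> x \<in> carrier M \<Longrightarrow> y \<in> carrier M \<Longrightarrow>
    f (x \<oplus>\<^bsub>M\<^esub> y) = f x \<oplus>\<^bsub>N\<^esub> f y"
  by (auto simp: lmod_hom_def)

lemma hom_smult: "f \<in> lmod_hom R M N \<Longrightarrow> a \<in> carrier R \<Longrightarrow> x \<in> carrier M \<Longrightarrow>
    f (a \<odot>\<^bsub>M\<^esub> x) = a \<odot>\<^bsub>N\<^esub> f x"
  by (auto simp: lmod_hom_def)

lemma homI:
  assumes "\<And>x. x \<in> carrier M \<Longrightarrow> f x \<in> carrier N"
    and "\<And>x y. x \<in> carrier M \<Longrightarrow> y \<in> carrier M \<Longrightarrow> f (x \<oplus>\<^bsub>M\<^esub> y) = f x \<oplus>\<^bsub>N\<^esub> f y"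
    and "\<And>a x. a \<in> carrier R \<Longrightarrow> x \<in> carrier M \<Longrightarrow> f (a \<odot>\<^bsub>M\<^esub> x) = a \<odot>\<^bsub>N\<^esub> f x"
  shows "f \<in> lmod_hom R M N"
  using assms by (auto simp: lmod_hom_def)

lemma hom_zero:
  assumes "left_module R M" "left_module R N" "f \<in> lmod_hom R M N"
  shows "f \<zero>\<^bsub>M\<^esub> = \<zero>\<^bsub>N\<^esub>"
proof -
  interpret M: left_module R M by fact
  interpret N: left_module R N by fact
  have "f \<zero>\<^bsub>M\<^esub> \<oplus>\<^bsub>N\<^esub> f \<zero>\<^bsub>M\<^esub> = f \<zero>\<^bsub>M\<^esub>"
    using hom_add[OF assms(3), of "\<zero>\<^bsub>M\<^esub>" "\<zero>\<^bsub>M\<^esub>"] by simp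
  moreover have "f \<zero>\<^bsub>M\<^esub> \<in> carrier N" by (rule hom_closed[OF assms(3)]) simp
  ultimately show ?thesis by (simp add: N.M.add.l_cancel_one)
qed

lemma hom_minus:
  assumes "left_module R M" "left_module R N" "f \<in> lmod_hom R M N" "x \<in> carrier M"
  shows "f (\<ominus>\<^bsub>M\<^esub> x) = \<ominus>\<^bsub>N\<^esub> f x"
proof -
  interpret M: left_module R M by fact
  interpret N: left_module R N by fact
  have "f (\<ominus>\<^bsub>M\<^esub> x) = f ((\<ominus>\<^bsub>R\<^esub> \<one>\<^bsub>R\<^esub>) \<odot>\<^bsub>M\<^esub> x)" using assms(4) by (simp add: M.minus_one)
  also have "\<dots> = \<ominus>\<^bsub>N\<^esub> f x"
    using assms hom_closed[OF assms(3,4)] by (simp add: hom_smult N.minus_one)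
  finally show ?thesis .
qed

lemma hom_diff:
  assumes "left_module R M" "left_module R N" "f \<in> lmod_hom R M N" "x \<in> carrier M" "y \<in> carrier M"
  shows "f (x \<ominus>\<^bsub>M\<^esub> y) = f x \<ominus>\<^bsub>N\<^esub> f y"
proof -
  interpret M: left_module R M by fact
  show ?thesis using assms by (simp add: a_minus_def hom_add[OF assms(3)] hom_minus)
qed

lemma hom_comp: "f \<in> lmod_hom R M N \<Longrightarrow> g \<in> lmod_hom R N Q \<Longrightarrow> (\<lambda>x. g (f x)) \<in> lmod_hom R M Q"
  by (auto simp: lmod_hom_def Pi_iff)

lemma hom_id: "(\<lambda>x. x) \<in> lmod_hom R M M"
  by (auto simp: lmod_hom_def)

lemma hom_null: "left_module R N \<Longrightarrow> (\<lambda>x. \<zero>\<^bsub>N\<^esub>) \<in> lmod_hom R M N"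
proof -
  assume "left_module R N"
  then interpret N: left_module R N .
  show ?thesis by (rule homI) (auto simp: N.r_null)
qed

lemma hom_plus:
  assumes "left_module R N" "f \<in> lmod_hom R M N" "g \<in> lmod_hom R M N"
  shows "(\<lambda>x. f x \<oplus>\<^bsub>N\<^esub> g x) \<in> lmod_hom R M N"
proof -
  interpret N: left_module R N by fact
  note cl = hom_closed[OF assms(2)] hom_closed[OF assms(3)]
  show ?thesis
    by (rule homI) (auto simp: cl hom_add[OF assms(2)] hom_add[OF assms(3)] hom_smult[OF assms(2)]
        hom_smult[OF assms(3)] N.smult_r_distr N.M.a_ac)
qed

lemma hom_neg:
  assumes "left_module R N" "f \<in> lmod_hom R M N"
  shows "(\<lambda>x. \<ominus>\<^bsub>N\<^esub> f x) \<in> lmod_hom R M N"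
proof -
  interpret N: left_module R N by fact
  have neg: "(\<lambda>x. \<ominus>\<^bsub>N\<^esub> x) \<in> lmod_hom R N N"
  proof (rule homI)
    fix a x assume ax: "a \<in> carrier R" "x \<in> carrier N"
    have "a \<odot>\<^bsub>N\<^esub> x \<oplus>\<^bsub>N\<^esub> a \<odot>\<^bsub>N\<^esub> (\<ominus>\<^bsub>N\<^esub> x) = \<zero>\<^bsub>N\<^esub>"
      using ax by (simp add: N.smult_r_distr[symmetric] N.M.r_neg N.r_null)
    then have "a \<odot>\<^bsub>N\<^esub> (\<ominus>\<^bsub>N\<^esub> x) \<oplus>\<^bsub>N\<^esub> a \<odot>\<^bsub>N\<^esub> x = \<zero>\<^bsub>N\<^esub>"
      using ax by (simp add: N.M.a_comm)
    then show "\<ominus>\<^bsub>N\<^esub> (a \<odot>\<^bsub>N\<^esub> x) = a \<odot>\<^bsub>N\<^esub> (\<ominus>\<^bsub>N\<^esub> x)"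
      using ax by (intro N.M.minus_equality) auto
  qed (auto simp: N.M.minus_add)
  show ?thesis by (rule hom_comp[OF assms(2) neg])
qed

text \<open>Additive submonoids of \<open>M\<close> that are stable under a set \<open>K\<close> of scalars. For the whole ring
  these are the submodules; for the image of the base ring of an algebra they are the submodules
  over the base ring. In both cases \<open>K\<close> contains \<open>-1\<close>, so they are subgroups.\<close>

definition stable_subs :: "'a set \<Rightarrow> ('a, 'b) module \<Rightarrow> 'b set set" where
  "stable_subs K M = {U. U \<subseteq> carrier M \<and> \<zero>\<^bsub>M\<^esub> \<in> U \<and> (\<forall>x\<in>U. \<forall>y\<in>U. x \<oplus>\<^bsub>M\<^esub> y \<in> U) \<and>
     (\<forall>c\<in>K. \<forall>x\<in>U. c \<odot>\<^bsub>M\<^esub> x \<in> U)}"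

abbreviation submods :: "('a, 'r) ring_scheme \<Rightarrow> ('a, 'b) module \<Rightarrow> 'b set set" where
  "submods R M \<equiv> stable_subs (carrier R) M"

lemma stable_subsI:
  assumes "U \<subseteq> carrier M" "\<zero>\<^bsub>M\<^esub> \<in> U" "\<And>x y. x \<in> U \<Longrightarrow> y \<in> U \<Longrightarrow> x \<oplus>\<^bsub>M\<^esub> y \<in> U"
    "\<And>c x. c \<in> K \<Longrightarrow> x \<in> U \<Longrightarrow> c \<odot>\<^bsub>M\<^esub> x \<in> U"
  shows "U \<in> stable_subs K M"
  using assms by (auto simp: stable_subs_def)

lemma stable_subsD:
  assumes "U \<in> stable_subs K M"
  shows "U \<subseteq> carrier M" "x \<in> U \<Longrightarrow> x \<in> carrier M" "\<zero>\<^bsub>M\<^esub> \<in> U"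
    "x \<in> U \<Longrightarrow> y \<in> U \<Longrightarrow> x \<oplus>\<^bsub>M\<^esub> y \<in> U" "c \<in> K \<Longrightarrow> x \<in> U \<Longrightarrow> c \<odot>\<^bsub>M\<^esub> x \<in> U"
  using assms by (auto simp: stable_subs_def)

lemma (in left_module) submodule_iff: "submodule U R M \<longleftrightarrow> U \<in> submods R M"
proof
  assume "submodule U R M"
  then interpret U: submodule U R M .
  show "U \<in> submods R M"
    using U.subset U.one_closed U.m_closed U.smult_closed by (intro stable_subsI) auto
next
  assume "U \<in> submods R M"
  then show "submodule U R M" by (intro submoduleI') (auto dest: stable_subsD)
qed

lemma (in left_module) stable_subs_minus:
  assumes "U \<in> stable_subs K M" "\<ominus> \<one> \<in> K" "x \<in> U"
  shows "\<ominus>\<^bsub>M\<^esub> x \<in> U"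
  using stable_subsD(5)[OF assms] stable_subsD(2)[OF assms(1,3)] by (simp add: minus_one)

lemma (in left_module) stable_subs_diff:
  assumes "U \<in> stable_subs K M" "\<ominus> \<one> \<in> K" "x \<in> U" "y \<in> U"
  shows "x \<ominus>\<^bsub>M\<^esub> y \<in> U"
  using stable_subsD(4)[OF assms(1)] stable_subs_minus[OF assms(1,2)] assms
  by (simp add: a_minus_def)

lemma (in left_module) sub_left_module:
  assumes U: "U \<in> submods R M"
  shows "left_module R (M\<lparr>carrier := U\<rparr>)"
proof -
  note D = stable_subsD[OF U]
  have "abelian_group (M\<lparr>carrier := U\<rparr>)"
  proof (rule abelian_groupI)
    fix x assume "x \<in> carrier (M\<lparr>carrier := U\<rparr>)"
    then show "\<exists>y\<in>carrier (M\<lparr>carrier := U\<rparr>). y \<oplus>\<^bsub>M\<lparr>carrier := U\<rparr>\<^esub> x = \<zero>\<^bsub>M\<lparr>carrier := U\<rparr>\<^esub>"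
      using D stable_subs_minus[OF U] by (auto intro!: bexI[of _ "\<ominus>\<^bsub>M\<^esub> x"] simp: M.l_neg)
  qed (use D in \<open>auto simp: M.a_ac\<close>)
  then interpret N: abelian_group "M\<lparr>carrier := U\<rparr>" .
  show ?thesis
    by (intro left_module.intro left_module_axioms.intro R.ring_axioms N.abelian_group_axioms)
       (use D in \<open>auto simp: smult_l_distr smult_r_distr smult_assoc1\<close>)
qed

lemma stable_subs_sub_iff:
  assumes "U \<subseteq> carrier M"
  shows "V \<in> stable_subs K (M\<lparr>carrier := U\<rparr>) \<longleftrightarrow> V \<in> stable_subs K M \<and> V \<subseteq> U"
  using assms by (auto simp: stable_subs_def)

lemma hom_incl: "U \<subseteq> carrier M \<Longrightarrow> (\<lambda>x. x) \<in> lmod_hom R (M\<lparr>carrier := U\<rparr>) M"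
  by (auto simp: lmod_hom_def)

lemma hom_restrict: "f \<in> lmod_hom R M N \<Longrightarrow> U \<subseteq> carrier M \<Longrightarrow> f \<in> lmod_hom R (M\<lparr>carrier := U\<rparr>) N"
  by (auto simp: lmod_hom_def Pi_iff subset_iff)

lemma hom_corestrict: "f \<in> lmod_hom R M N \<Longrightarrow> f ` carrier M \<subseteq> U \<Longrightarrow> f \<in> lmod_hom R M (N\<lparr>carrier := U\<rparr>)"
  by (auto simp: lmod_hom_def Pi_iff)

lemma stable_subs_vimage:
  assumes "left_module R M" "left_module R N" "f \<in> lmod_hom R M N" "V \<in> stable_subs K N"
    "K \<subseteq> carrier R"
  shows "{x \<in> carrier M. f x \<in> V} \<in> stable_subs K M"
proof -
  interpret M: left_module R M by fact
  note D = stable_subsD[OF assms(4)]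
  show ?thesis
    by (rule stable_subsI)
       (use assms(5) D in \<open>auto simp: hom_zero[OF assms(1-3)] hom_add[OF assms(3)]
         hom_smult[OF assms(3)] subset_iff\<close>)
qed

lemma stable_subs_image:
  assumes "left_module R M" "left_module R N" "f \<in> lmod_hom R M N" "V \<in> stable_subs K M"
    "K \<subseteq> carrier R"
  shows "f ` V \<in> stable_subs K N"
proof -
  interpret M: left_module R M by fact
  note D = stable_subsD[OF assms(4)]
  show ?thesis
  proof (rule stable_subsI)
    show "f ` V \<subseteq> carrier N" using D hom_closed[OF assms(3)] by auto
    show "\<zero>\<^bsub>N\<^esub> \<in> f ` V" using D(3) hom_zero[OF assms(1-3)] by (metis imageI)
  next
    fix x y assume "x \<in> f ` V" "y \<in> f ` V"
    then obtain u v where "u \<in> V" "v \<in> V" "x = f u" "y = f v" by blast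
    then have "x \<oplus>\<^bsub>N\<^esub> y = f (u \<oplus>\<^bsub>M\<^esub> v)" "u \<oplus>\<^bsub>M\<^esub> v \<in> V" using D hom_add[OF assms(3)] by auto
    then show "x \<oplus>\<^bsub>N\<^esub> y \<in> f ` V" by blast
  next
    fix c x assume "c \<in> K" "x \<in> f ` V"
    then obtain u where "u \<in> V" "x = f u" "c \<in> K" "c \<in> carrier R" using assms(5) by blast
    then have "c \<odot>\<^bsub>N\<^esub> x = f (c \<odot>\<^bsub>M\<^esub> u)" "c \<odot>\<^bsub>M\<^esub> u \<in> V" using D hom_smult[OF assms(3)] by auto
    then show "c \<odot>\<^bsub>N\<^esub> x \<in> f ` V" by blast
  qed
qed

lemma stable_subs_Int: "U \<in> stable_subs K M \<Longrightarrow> V \<in> stable_subs K M \<Longrightarrow> U \<inter> V \<in> stable_subs K M"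
  by (auto simp: stable_subs_def)

lemma (in left_module) stable_subs_carrier: "K \<subseteq> carrier R \<Longrightarrow> carrier M \<in> stable_subs K M"
  by (rule stable_subsI) auto

lemma (in left_module) stable_subs_zero: "K \<subseteq> carrier R \<Longrightarrow> {\<zero>\<^bsub>M\<^esub>} \<in> stable_subs K M"
  by (rule stable_subsI) (auto simp: r_null)

lemma (in left_module) stable_subs_plus:
  assumes "U \<in> stable_subs K M" "V \<in> stable_subs K M" "K \<subseteq> carrier R"
  shows "U <+>\<^bsub>M\<^esub> V \<in> stable_subs K M"
proof -
  note U = stable_subsD[OF assms(1)] and V = stable_subsD[OF assms(2)]
  show ?thesis
  proof (rule stable_subsI)
    show "U <+>\<^bsub>M\<^esub> V \<subseteq> carrier M" using U V by (auto simp: set_add_def' subset_iff)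
    have "\<zero>\<^bsub>M\<^esub> = \<zero>\<^bsub>M\<^esub> \<oplus>\<^bsub>M\<^esub> \<zero>\<^bsub>M\<^esub>" by simp
    then show "\<zero>\<^bsub>M\<^esub> \<in> U <+>\<^bsub>M\<^esub> V" using U(3) V(3) unfolding set_add_def' by blast
  next
    fix x y assume "x \<in> U <+>\<^bsub>M\<^esub> V" "y \<in> U <+>\<^bsub>M\<^esub> V"
    then obtain u v u' v' where h: "u \<in> U" "v \<in> V" "u' \<in> U" "v' \<in> V" "x = u \<oplus>\<^bsub>M\<^esub> v" "y = u' \<oplus>\<^bsub>M\<^esub> v'"
      by (auto simp: set_add_def')
    have "x \<oplus>\<^bsub>M\<^esub> y = (u \<oplus>\<^bsub>M\<^esub> u') \<oplus>\<^bsub>M\<^esub> (v \<oplus>\<^bsub>M\<^esub> v')" using h U V by (simp add: M.a_ac)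
    moreover have "u \<oplus>\<^bsub>M\<^esub> u' \<in> U" "v \<oplus>\<^bsub>M\<^esub> v' \<in> V" using h U V by simp_all
    ultimately show "x \<oplus>\<^bsub>M\<^esub> y \<in> U <+>\<^bsub>M\<^esub> V" unfolding set_add_def' by blast
  next
    fix c x assume "c \<in> K" "x \<in> U <+>\<^bsub>M\<^esub> V"
    then obtain u v where h: "u \<in> U" "v \<in> V" "x = u \<oplus>\<^bsub>M\<^esub> v" "c \<in> carrier R" "c \<in> K"
      using assms(3) by (auto simp: set_add_def')
    have "c \<odot>\<^bsub>M\<^esub> x = c \<odot>\<^bsub>M\<^esub> u \<oplus>\<^bsub>M\<^esub> c \<odot>\<^bsub>M\<^esub> v" using h U V by (simp add: smult_r_distr)
    moreover have "c \<odot>\<^bsub>M\<^esub> u \<in> U" "c \<odot>\<^bsub>M\<^esub> v \<in> V" using h U V by simp_all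
    ultimately show "c \<odot>\<^bsub>M\<^esub> x \<in> U <+>\<^bsub>M\<^esub> V" unfolding set_add_def' by blast
  qed
qed

lemma (in left_module) subset_plus:
  assumes "U \<in> stable_subs K M" "V \<in> stable_subs K M"
  shows "U \<subseteq> U <+>\<^bsub>M\<^esub> V" "V \<subseteq> U <+>\<^bsub>M\<^esub> V"
proof -
  note U = stable_subsD[OF assms(1)] and V = stable_subsD[OF assms(2)]
  show "U \<subseteq> U <+>\<^bsub>M\<^esub> V"
  proof
    fix x assume "x \<in> U"
    moreover have "x = x \<oplus>\<^bsub>M\<^esub> \<zero>\<^bsub>M\<^esub>" using \<open>x \<in> U\<close> U by simp
    ultimately show "x \<in> U <+>\<^bsub>M\<^esub> V" using V(3) unfolding set_add_def' by blast
  qed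
  show "V \<subseteq> U <+>\<^bsub>M\<^esub> V"
  proof
    fix x assume "x \<in> V"
    moreover have "x = \<zero>\<^bsub>M\<^esub> \<oplus>\<^bsub>M\<^esub> x" using \<open>x \<in> V\<close> V by simp
    ultimately show "x \<in> U <+>\<^bsub>M\<^esub> V" using U(3) unfolding set_add_def' by blast
  qed
qed

lemma (in left_module) plus_least:
  assumes "W \<in> stable_subs K M" "U \<subseteq> W" "V \<subseteq> W"
  shows "U <+>\<^bsub>M\<^esub> V \<subseteq> W"
  using stable_subsD(4)[OF assms(1)] assms(2,3) by (auto simp: set_add_def')

text \<open>The cyclic submodule \<open>R x\<close>.\<close>

definition cyc :: "('a, 'r) ring_scheme \<Rightarrow> ('a, 'b) module \<Rightarrow> 'b \<Rightarrow> 'b set" where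
  "cyc R M x = (\<lambda>a. a \<odot>\<^bsub>M\<^esub> x) ` carrier R"

lemma (in left_module) cyc_submods: "x \<in> carrier M \<Longrightarrow> cyc R M x \<in> submods R M"
proof (rule stable_subsI)
  assume x: "x \<in> carrier M"
  show "cyc R M x \<subseteq> carrier M" using x by (auto simp: cyc_def)
  show "\<zero>\<^bsub>M\<^esub> \<in> cyc R M x" using l_null[OF x] R.zero_closed unfolding cyc_def by (intro image_eqI[of _ _ "\<zero>"]) simp_all
  show "u \<oplus>\<^bsub>M\<^esub> v \<in> cyc R M x" if "u \<in> cyc R M x" "v \<in> cyc R M x" for u v
    using that x by (auto simp: cyc_def smult_l_distr[symmetric])
  show "c \<odot>\<^bsub>M\<^esub> u \<in> cyc R M x" if "c \<in> carrier R" "u \<in> cyc R M x" for c u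
    using that x by (auto simp: cyc_def smult_assoc1[symmetric])
qed

lemma (in left_module) cyc_self: "x \<in> carrier M \<Longrightarrow> x \<in> cyc R M x"
  unfolding cyc_def by (intro image_eqI[of _ _ \<one>]) simp_all

lemma (in left_module) cyc_least: "V \<in> submods R M \<Longrightarrow> x \<in> V \<Longrightarrow> cyc R M x \<subseteq> V"
  by (auto simp: cyc_def dest: stable_subsD)

lemma hom_ker_submods:
  assumes "left_module R M" "left_module R N" "f \<in> lmod_hom R M N"
  shows "lmod_ker M N f \<in> submods R M"
proof -
  interpret N: left_module R N by fact
  show ?thesis
    using stable_subs_vimage[OF assms N.stable_subs_zero[OF subset_refl]] by (simp add: lmod_ker_def)
qed

lemma hom_inj_iff:
  assumes "left_module R M" "left_module R N" "f \<in> lmod_hom R M N"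
  shows "inj_on f (carrier M) \<longleftrightarrow> (\<forall>x\<in>carrier M. f x = \<zero>\<^bsub>N\<^esub> \<longrightarrow> x = \<zero>\<^bsub>M\<^esub>)"
proof
  interpret M: left_module R M by fact
  interpret N: left_module R N by fact
  show "\<forall>x\<in>carrier M. f x = \<zero>\<^bsub>N\<^esub> \<longrightarrow> x = \<zero>\<^bsub>M\<^esub>" if "inj_on f (carrier M)"
    using that hom_zero[OF assms] by (metis M.M.zero_closed inj_onD)
  assume *: "\<forall>x\<in>carrier M. f x = \<zero>\<^bsub>N\<^esub> \<longrightarrow> x = \<zero>\<^bsub>M\<^esub>"
  show "inj_on f (carrier M)"
  proof (rule inj_onI)
    fix x y assume xy: "x \<in> carrier M" "y \<in> carrier M" "f x = f y"
    have "f (x \<ominus>\<^bsub>M\<^esub> y) = \<zero>\<^bsub>N\<^esub>"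
      using xy hom_closed[OF assms(3)] by (simp add: hom_diff[OF assms] N.M.diff_self)
    then have "x \<ominus>\<^bsub>M\<^esub> y = \<zero>\<^bsub>M\<^esub>" using * xy by auto
    then show "x = y" using xy by (simp add: M.M.diff_eq_zero)
  qed
qed

text \<open>Factorization through an epimorphism and through a monomorphism.\<close>

lemma hom_factor_epi:
  assumes "left_module R M" "left_module R N" "left_module R Q"
    and f: "f \<in> lmod_hom R M N" "f ` carrier M = carrier N" and g: "g \<in> lmod_hom R M Q"
    and ker: "\<And>x. x \<in> carrier M \<Longrightarrow> f x = \<zero>\<^bsub>N\<^esub> \<Longrightarrow> g x = \<zero>\<^bsub>Q\<^esub>"
  shows "\<exists>h\<in>lmod_hom R N Q. \<forall>x\<in>carrier M. h (f x) = g x"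
proof -
  interpret M: left_module R M by fact
  interpret N: left_module R N by fact
  interpret Q: left_module R Q by fact
  define h where "h y = g (SOME x. x \<in> carrier M \<and> f x = y)" for y
  have h: "h (f x) = g x" if x: "x \<in> carrier M" for x
  proof -
    define z where "z = (SOME z. z \<in> carrier M \<and> f z = f x)"
    have z: "z \<in> carrier M" "f z = f x"
      using someI[of "\<lambda>z. z \<in> carrier M \<and> f z = f x" x] x by (auto simp: z_def)
    have "f (z \<ominus>\<^bsub>M\<^esub> x) = \<zero>\<^bsub>N\<^esub>"
      using x z hom_closed[OF f(1)] by (simp add: hom_diff[OF assms(1,2) f(1)] N.M.diff_self)
    then have "g (z \<ominus>\<^bsub>M\<^esub> x) = \<zero>\<^bsub>Q\<^esub>" using x z by (intro ker) auto
    then have "g z = g x"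
      using x z hom_closed[OF g] by (simp add: hom_diff[OF assms(1,3) g] Q.M.diff_eq_zero)
    then show ?thesis by (simp add: h_def z_def)
  qed
  have "h \<in> lmod_hom R N Q"
  proof (rule homI)
    fix y assume "y \<in> carrier N"
    then obtain u where "u \<in> carrier M" "y = f u" using f(2) by blast
    then show "h y \<in> carrier Q" using hom_closed[OF g] by (simp add: h)
  next
    fix y z assume "y \<in> carrier N" "z \<in> carrier N"
    then obtain u v where "u \<in> carrier M" "v \<in> carrier M" "y = f u" "z = f v"
      using f(2) by blast
    then show "h (y \<oplus>\<^bsub>N\<^esub> z) = h y \<oplus>\<^bsub>Q\<^esub> h z"
      by (simp add: h hom_add[OF g] flip: hom_add[OF f(1)])
  next
    fix a y assume a: "a \<in> carrier R" "y \<in> carrier N"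
    then obtain u where "u \<in> carrier M" "y = f u" using f(2) by blast
    then show "h (a \<odot>\<^bsub>N\<^esub> y) = a \<odot>\<^bsub>Q\<^esub> h y"
      using a by (simp add: h hom_smult[OF g] flip: hom_smult[OF f(1)])
  qed
  then show ?thesis using h by blast
qed

lemma hom_factor_mono:
  assumes "left_module R M" "left_module R N" "left_module R Q"
    and f: "f \<in> lmod_hom R M N" "inj_on f (carrier M)" and g: "g \<in> lmod_hom R Q N"
    and im: "g ` carrier Q \<subseteq> f ` carrier M"
  shows "\<exists>h\<in>lmod_hom R Q M. \<forall>x\<in>carrier Q. f (h x) = g x"
proof -
  interpret M: left_module R M by fact
  interpret Q: left_module R Q by fact
  define h where "h x = inv_into (carrier M) f (g x)" for x
  have hM: "h x \<in> carrier M" and fh: "f (h x) = g x" if "x \<in> carrier Q" for x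
    using that im inv_into_into[of "g x" f "carrier M"] f_inv_into_f[of "g x" f "carrier M"]
    by (auto simp: h_def)
  have "h \<in> lmod_hom R Q M"
  proof (rule homI)
    fix x y assume "x \<in> carrier Q" "y \<in> carrier Q"
    then show "h (x \<oplus>\<^bsub>Q\<^esub> y) = h x \<oplus>\<^bsub>M\<^esub> h y"
      by (intro inj_onD[OF f(2)]) (auto simp: hM fh hom_add[OF g] hom_add[OF f(1)])
  next
    fix a x assume "a \<in> carrier R" "x \<in> carrier Q"
    then show "h (a \<odot>\<^bsub>Q\<^esub> x) = a \<odot>\<^bsub>M\<^esub> h x"
      by (intro inj_onD[OF f(2)]) (auto simp: hM fh hom_smult[OF g] hom_smult[OF f(1)])
  qed (rule hM)
  then show ?thesis using fh by blast
qed

lemma fg_moduleD: "fg_module R M \<Longrightarrow> left_module R M"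
  by (simp add: fg_module_def)

lemma fg_generators:
  assumes "fg_module R M"
  obtains S where "finite S" "S \<subseteq> carrier M" "\<And>U. U \<in> submods R M \<Longrightarrow> S \<subseteq> U \<Longrightarrow> U = carrier M"
proof -
  interpret M: left_module R M using assms by (rule fg_moduleD)
  show thesis
    using assms that unfolding fg_module_def fin_gen_def M.submodule_iff by (elim conjE exE) simp
qed

lemma fg_image:
  assumes "fg_module R M" "left_module R N" "f \<in> lmod_hom R M N" "f ` carrier M = carrier N"
  shows "fg_module R N"
proof -
  interpret M: left_module R M using assms(1) by (rule fg_moduleD)
  interpret N: left_module R N by fact
  obtain S where S: "finite S" "S \<subseteq> carrier M" "\<And>U. U \<in> submods R M \<Longrightarrow> S \<subseteq> U \<Longrightarrow> U = carrier M"
    by (rule fg_generators[OF assms(1)]) blast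
  have "V = carrier N" if V: "V \<in> submods R N" "f ` S \<subseteq> V" for V
  proof -
    have "{x \<in> carrier M. f x \<in> V} = carrier M"
    proof (rule S(3))
      show "{x \<in> carrier M. f x \<in> V} \<in> submods R M"
        by (rule stable_subs_vimage[OF M.left_module_axioms assms(2,3) V(1) subset_refl])
      show "S \<subseteq> {x \<in> carrier M. f x \<in> V}" using S(2) V(2) by blast
    qed
    then have "f ` carrier M \<subseteq> V" by auto
    then show ?thesis using assms(4) stable_subsD(1)[OF V(1)] by simp
  qed
  moreover have "finite (f ` S)" "f ` S \<subseteq> carrier N" using S hom_closed[OF assms(3)] by auto
  ultimately have "fin_gen R N" unfolding fin_gen_def N.submodule_iff
    by (intro exI[of _ "f ` S"]) simp
  then show ?thesis by (simp add: fg_module_def N.left_module_axioms)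
qed

text \<open>The quotient is realized on representatives of the cosets, so that it has the same type of
  elements as the module.\<close>

lemma quotient_exists:
  fixes M :: "('a, 'b) module"
  assumes "left_module R M" "U \<in> submods R M"
  shows "\<exists>(Q :: ('a, 'b) module) p. left_module R Q \<and> p \<in> lmod_hom R M Q \<and>
     p ` carrier M = carrier Q \<and> lmod_ker M Q p = U"
proof -
  interpret M: left_module R M by fact
  note D = stable_subsD[OF assms(2)]
  have mone: "\<ominus>\<^bsub>R\<^esub> \<one>\<^bsub>R\<^esub> \<in> carrier R" by simp
  note dU = M.stable_subs_diff[OF assms(2) mone]
  define p where "p x = (SOME y. y \<in> carrier M \<and> y \<ominus>\<^bsub>M\<^esub> x \<in> U)" for x
  have p: "p x \<in> carrier M" "p x \<ominus>\<^bsub>M\<^esub> x \<in> U" if x: "x \<in> carrier M" for x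
  proof -
    have "x \<ominus>\<^bsub>M\<^esub> x \<in> U" using x D(3) by (simp add: a_minus_def M.M.r_neg)
    then show "p x \<in> carrier M" "p x \<ominus>\<^bsub>M\<^esub> x \<in> U"
      using someI[of "\<lambda>y. y \<in> carrier M \<and> y \<ominus>\<^bsub>M\<^esub> x \<in> U" x] x by (auto simp: p_def)
  qed
  have cong: "z \<ominus>\<^bsub>M\<^esub> x \<in> U \<longleftrightarrow> z \<ominus>\<^bsub>M\<^esub> y \<in> U"
    if "x \<in> carrier M" "y \<in> carrier M" "z \<in> carrier M" "x \<ominus>\<^bsub>M\<^esub> y \<in> U" for x y z
  proof -
    have "(z \<ominus>\<^bsub>M\<^esub> x) \<oplus>\<^bsub>M\<^esub> (x \<ominus>\<^bsub>M\<^esub> y) = z \<ominus>\<^bsub>M\<^esub> y"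
      using that by (simp add: M.M.diff_add_diff)
    moreover have "(z \<ominus>\<^bsub>M\<^esub> y) \<ominus>\<^bsub>M\<^esub> (x \<ominus>\<^bsub>M\<^esub> y) = z \<ominus>\<^bsub>M\<^esub> x"
      using that M.M.diff_add_diff[of y x z] M.M.minus_diff[of y x]
        a_minus_def[of M "z \<ominus>\<^bsub>M\<^esub> y" "x \<ominus>\<^bsub>M\<^esub> y"] by simp
    ultimately show ?thesis using D(4) dU that(4) by metis
  qed
  have peq: "p x = p y \<longleftrightarrow> x \<ominus>\<^bsub>M\<^esub> y \<in> U" if xy: "x \<in> carrier M" "y \<in> carrier M" for x y
  proof
    assume "x \<ominus>\<^bsub>M\<^esub> y \<in> U"
    then have "(\<lambda>z. z \<in> carrier M \<and> z \<ominus>\<^bsub>M\<^esub> x \<in> U) = (\<lambda>z. z \<in> carrier M \<and> z \<ominus>\<^bsub>M\<^esub> y \<in> U)"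
      using cong xy by blast
    then show "p x = p y" by (simp add: p_def)
  next
    assume eq: "p x = p y"
    have "(p x \<ominus>\<^bsub>M\<^esub> y) \<ominus>\<^bsub>M\<^esub> (p x \<ominus>\<^bsub>M\<^esub> x) \<in> U" using p[OF xy(1)] p[OF xy(2)] eq dU by metis
    moreover have "(z \<ominus>\<^bsub>M\<^esub> y) \<ominus>\<^bsub>M\<^esub> (z \<ominus>\<^bsub>M\<^esub> x) = x \<ominus>\<^bsub>M\<^esub> y" if "z \<in> carrier M" for z
      using xy that by (simp add: M.M.diff_diff_cancel)
    ultimately show "x \<ominus>\<^bsub>M\<^esub> y \<in> U" using p xy by metis
  qed
  have ppadd: "p (p x \<oplus>\<^bsub>M\<^esub> p y) = p (x \<oplus>\<^bsub>M\<^esub> y)" if xy: "x \<in> carrier M" "y \<in> carrier M" for x y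
  proof -
    have "(u \<oplus>\<^bsub>M\<^esub> v) \<ominus>\<^bsub>M\<^esub> (x \<oplus>\<^bsub>M\<^esub> y) = (u \<ominus>\<^bsub>M\<^esub> x) \<oplus>\<^bsub>M\<^esub> (v \<ominus>\<^bsub>M\<^esub> y)"
      if "u \<in> carrier M" "v \<in> carrier M" for u v
      using xy that by (simp add: a_minus_def M.M.minus_add M.M.a_ac)
    then show ?thesis using p xy D(4) by (subst peq) simp_all
  qed
  have psmult: "p (a \<odot>\<^bsub>M\<^esub> p x) = p (a \<odot>\<^bsub>M\<^esub> x)" if ax: "a \<in> carrier R" "x \<in> carrier M" for a x
  proof -
    have h: "(\<lambda>x. a \<odot>\<^bsub>M\<^esub> x) z \<oplus>\<^bsub>M\<^esub> (a \<odot>\<^bsub>M\<^esub> (\<ominus>\<^bsub>M\<^esub> x)) = a \<odot>\<^bsub>M\<^esub> (z \<ominus>\<^bsub>M\<^esub> x)"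
      if "z \<in> carrier M" for z using ax that by (simp add: a_minus_def M.smult_r_distr)
    have "a \<odot>\<^bsub>M\<^esub> (\<ominus>\<^bsub>M\<^esub> x) = \<ominus>\<^bsub>M\<^esub> (a \<odot>\<^bsub>M\<^esub> x)"
    proof -
      have "a \<odot>\<^bsub>M\<^esub> (\<ominus>\<^bsub>M\<^esub> x) \<oplus>\<^bsub>M\<^esub> a \<odot>\<^bsub>M\<^esub> x = \<zero>\<^bsub>M\<^esub>"
        using ax by (simp add: M.smult_r_distr[symmetric] M.M.l_neg M.r_null)
      then show ?thesis using ax by (intro M.M.minus_equality[symmetric]) auto
    qed
    then have "(a \<odot>\<^bsub>M\<^esub> p x) \<ominus>\<^bsub>M\<^esub> (a \<odot>\<^bsub>M\<^esub> x) = a \<odot>\<^bsub>M\<^esub> (p x \<ominus>\<^bsub>M\<^esub> x)"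
      using h[of "p x"] p ax by (simp add: a_minus_def)
    then show ?thesis using p ax D(5) by (subst peq) simp_all
  qed
  define Q :: "('a, 'b) module" where "Q = \<lparr>carrier = p ` carrier M, monoid.mult = undefined,
     one = undefined, ring.zero = p \<zero>\<^bsub>M\<^esub>, ring.add = (\<lambda>x y. p (x \<oplus>\<^bsub>M\<^esub> y)),
     smult = (\<lambda>a x. p (a \<odot>\<^bsub>M\<^esub> x))\<rparr>"
  have Q: "carrier Q = p ` carrier M" "\<zero>\<^bsub>Q\<^esub> = p \<zero>\<^bsub>M\<^esub>" by (simp_all add: Q_def)
  have Qa: "p x \<oplus>\<^bsub>Q\<^esub> p y = p (x \<oplus>\<^bsub>M\<^esub> y)" if "x \<in> carrier M" "y \<in> carrier M" for x y
    using that by (simp add: Q_def ppadd)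
  have Qs: "a \<odot>\<^bsub>Q\<^esub> p x = p (a \<odot>\<^bsub>M\<^esub> x)" if "a \<in> carrier R" "x \<in> carrier M" for a x
    using that by (simp add: Q_def psmult)
  have "abelian_group Q"
  proof (rule abelian_groupI)
    fix x assume "x \<in> carrier Q"
    then obtain u where u: "u \<in> carrier M" "x = p u" by (auto simp: Q)
    show "\<exists>y\<in>carrier Q. y \<oplus>\<^bsub>Q\<^esub> x = \<zero>\<^bsub>Q\<^esub>"
      by (rule bexI[of _ "p (\<ominus>\<^bsub>M\<^esub> u)"]) (use u in \<open>auto simp: Q Qa M.M.l_neg\<close>)
  qed (auto simp: Q Qa M.M.a_ac)
  then interpret Q: abelian_group Q .
  have "left_module R Q"
    by (intro left_module.intro left_module_axioms.intro M.R.ring_axioms Q.abelian_group_axioms)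
       (auto simp: Q Qa Qs M.smult_l_distr M.smult_r_distr M.smult_assoc1)
  moreover have "p \<in> lmod_hom R M Q" by (rule homI) (auto simp: Q Qa Qs)
  moreover have "lmod_ker M Q p = U"
    using D by (auto simp: lmod_ker_def Q peq M.M.diff_zero)
  ultimately show ?thesis using Q(1) by blast
qed

section \<open>Families of sets of finite height\<close>

text \<open>A family of sets has height at most \<open>n\<close> if it has a strictly monotone rank function with
  values at most \<open>n\<close>; equivalently, chains in it have at most \<open>n\<close> strict inclusions. For the
  submodules of a module this bounds the length of the module.\<close>

definition height_le :: "'b set set \<Rightarrow> nat \<Rightarrow> bool" where
  "height_le F n \<longleftrightarrow> (\<exists>d :: 'b set \<Rightarrow> nat. (\<forall>V\<in>F. d V \<le> n) \<and> (\<forall>V\<in>F. \<forall>W\<in>F. V \<subset> W \<longrightarrow> d V < d W))"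

lemma height_leE:
  assumes "height_le F n"
  obtains d :: "'b set \<Rightarrow> nat" where "\<And>V. V \<in> F \<Longrightarrow> d V \<le> n"
    "\<And>V W. V \<in> F \<Longrightarrow> W \<in> F \<Longrightarrow> V \<subset> W \<Longrightarrow> d V < d W"
proof -
  from assms obtain d :: "'b set \<Rightarrow> nat" where
    d: "(\<forall>V\<in>F. d V \<le> n) \<and> (\<forall>V\<in>F. \<forall>W\<in>F. V \<subset> W \<longrightarrow> d V < d W)"
    unfolding height_le_def by (elim exE)
  show thesis by (rule that[of d]) (use d in simp_all)
qed

lemma height_leI:
  fixes d :: "'b set \<Rightarrow> nat"
  assumes "\<And>V. V \<in> F \<Longrightarrow> d V \<le> n" "\<And>V W. V \<in> F \<Longrightarrow> W \<in> F \<Longrightarrow> V \<subset> W \<Longrightarrow> d V < d W"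
  shows "height_le F n"
  unfolding height_le_def by (rule exI[of _ d]) (use assms in simp)

lemma height_le_mono: "height_le G n \<Longrightarrow> F \<subseteq> G \<Longrightarrow> n \<le> n' \<Longrightarrow> height_le F n'"
proof (elim height_leE)
  fix d :: "'a set \<Rightarrow> nat"
  assume "F \<subseteq> G" "n \<le> n'" "\<And>V. V \<in> G \<Longrightarrow> d V \<le> n"
    "\<And>V W. V \<in> G \<Longrightarrow> W \<in> G \<Longrightarrow> V \<subset> W \<Longrightarrow> d V < d W"
  then show "height_le F n'" by (intro height_leI[of F d]) (meson subsetD order_trans)+
qed

lemma height_le_singleton: "F \<subseteq> {X} \<Longrightarrow> height_le F 0"
  by (rule height_leI[of _ "\<lambda>_. 0"]) auto

text \<open>Additivity of length in abstract form: for the maps that send \<open>V\<close> to \<open>V \<inter> U\<close> and to \<open>f V\<close>, where \<open>U\<close>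
  is the kernel of \<open>f\<close>, it bounds the length of a module by those of \<open>U\<close> and of the image of \<open>f\<close>.\<close>

lemma height_le_combine:
  assumes "height_le G a" "height_le H b"
    and "\<And>V. V \<in> F \<Longrightarrow> \<alpha> V \<in> G" "\<And>V. V \<in> F \<Longrightarrow> \<beta> V \<in> H"
    and "\<And>V W. V \<in> F \<Longrightarrow> W \<in> F \<Longrightarrow> V \<subseteq> W \<Longrightarrow> \<alpha> V \<subseteq> \<alpha> W"
    and "\<And>V W. V \<in> F \<Longrightarrow> W \<in> F \<Longrightarrow> V \<subseteq> W \<Longrightarrow> \<beta> V \<subseteq> \<beta> W"
    and "\<And>V W. V \<in> F \<Longrightarrow> W \<in> F \<Longrightarrow> V \<subseteq> W \<Longrightarrow> \<alpha> V = \<alpha> W \<Longrightarrow> \<beta> V = \<beta> W \<Longrightarrow> W \<subseteq> V"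
  shows "height_le F (a + b)"
proof -
  obtain d where d: "\<And>V. V \<in> G \<Longrightarrow> d V \<le> a" "\<And>V W. V \<in> G \<Longrightarrow> W \<in> G \<Longrightarrow> V \<subset> W \<Longrightarrow> d V < d W"
    by (rule height_leE[OF assms(1)]) blast
  obtain e where e: "\<And>V. V \<in> H \<Longrightarrow> e V \<le> b" "\<And>V W. V \<in> H \<Longrightarrow> W \<in> H \<Longrightarrow> V \<subset> W \<Longrightarrow> e V < e W"
    by (rule height_leE[OF assms(2)]) blast
  have "d (\<alpha> V) + e (\<beta> V) < d (\<alpha> W) + e (\<beta> W)" if VW: "V \<in> F" "W \<in> F" "V \<subset> W" for V W
  proof -
    have sub: "\<alpha> V \<subseteq> \<alpha> W" "\<beta> V \<subseteq> \<beta> W" using assms(5,6) VW by auto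
    have "\<alpha> V \<noteq> \<alpha> W \<or> \<beta> V \<noteq> \<beta> W" using assms(7)[OF VW(1,2)] VW(3) by auto
    moreover have "d (\<alpha> V) \<le> d (\<alpha> W)" using d(2)[OF assms(3)[OF VW(1)] assms(3)[OF VW(2)]] sub
      by (cases "\<alpha> V = \<alpha> W") (simp_all add: psubset_eq)
    moreover have "e (\<beta> V) \<le> e (\<beta> W)" using e(2)[OF assms(4)[OF VW(1)] assms(4)[OF VW(2)]] sub
      by (cases "\<beta> V = \<beta> W") (simp_all add: psubset_eq)
    moreover have "d (\<alpha> V) < d (\<alpha> W)" if "\<alpha> V \<noteq> \<alpha> W"
      using d(2)[OF assms(3)[OF VW(1)] assms(3)[OF VW(2)]] sub that by (simp add: psubset_eq)
    moreover have "e (\<beta> V) < e (\<beta> W)" if "\<beta> V \<noteq> \<beta> W"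
      using e(2)[OF assms(4)[OF VW(1)] assms(4)[OF VW(2)]] sub that by (simp add: psubset_eq)
    ultimately show ?thesis by linarith
  qed
  moreover have "d (\<alpha> V) + e (\<beta> V) \<le> a + b" if "V \<in> F" for V
    using d(1)[OF assms(3)[OF that]] e(1)[OF assms(4)[OF that]] by simp
  ultimately show ?thesis by (intro height_leI[of _ "\<lambda>V. d (\<alpha> V) + e (\<beta> V)"])
qed

lemma height_le_max:
  assumes "height_le F n" "V\<^sub>0 \<in> F" "P V\<^sub>0"
  shows "\<exists>V\<in>F. P V \<and> (\<forall>W\<in>F. P W \<longrightarrow> V \<subseteq> W \<longrightarrow> W = V)"
proof -
  obtain d where d: "\<And>V. V \<in> F \<Longrightarrow> d V \<le> n" "\<And>V W. V \<in> F \<Longrightarrow> W \<in> F \<Longrightarrow> V \<subset> W \<Longrightarrow> d V < d W"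
    by (rule height_leE[OF assms(1)]) blast
  obtain V where V: "V \<in> F \<and> P V" "\<And>W. W \<in> F \<and> P W \<Longrightarrow> d W \<le> d V"
    using ex_has_greatest_nat[of "\<lambda>V. V \<in> F \<and> P V" V\<^sub>0 d "Suc n"] assms(2,3) d(1)
    by (auto simp: less_Suc_eq_le)
  show ?thesis
  proof (intro bexI conjI ballI impI)
    fix W assume W: "W \<in> F" "P W" "V \<subseteq> W"
    show "W = V"
    proof (rule ccontr)
      assume "W \<noteq> V"
      then have "d V < d W" using W V(1) d(2) by blast
      then show False using V(2)[of W] W by simp
    qed
  qed (use V in auto)
qed

lemma height_le_min:
  assumes "height_le F n" "V\<^sub>0 \<in> F" "P V\<^sub>0"
  shows "\<exists>V\<in>F. P V \<and> (\<forall>W\<in>F. P W \<longrightarrow> W \<subseteq> V \<longrightarrow> W = V)"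
proof -
  obtain d where d: "\<And>V. V \<in> F \<Longrightarrow> d V \<le> n" "\<And>V W. V \<in> F \<Longrightarrow> W \<in> F \<Longrightarrow> V \<subset> W \<Longrightarrow> d V < d W"
    by (rule height_leE[OF assms(1)]) blast
  obtain V where V: "V \<in> F \<and> P V" "\<And>W. W \<in> F \<and> P W \<Longrightarrow> d V \<le> d W"
    using ex_has_least_nat[of "\<lambda>V. V \<in> F \<and> P V" V\<^sub>0 d] assms(2,3) by auto
  show ?thesis
  proof (intro bexI conjI ballI impI)
    fix W assume W: "W \<in> F" "P W" "W \<subseteq> V"
    show "W = V"
    proof (rule ccontr)
      assume "W \<noteq> V"
      then have "d W < d V" using W V(1) d(2) by blast
      then show False using V(2)[of W] W by simp
    qed
  qed (use V in auto)
qed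

section \<open>Finite length over an Artinian ring\<close>

lemma regular_simps [simp]:
  "carrier (regular_module R) = carrier R" "\<zero>\<^bsub>regular_module R\<^esub> = \<zero>\<^bsub>R\<^esub>"
  "x \<oplus>\<^bsub>regular_module R\<^esub> y = x \<oplus>\<^bsub>R\<^esub> y" "a \<odot>\<^bsub>regular_module R\<^esub> x = a \<otimes>\<^bsub>R\<^esub> x"
  by (simp_all add: regular_module_def module_via_def)

lemma (in ring) module_via_left_module:
  assumes "ring k" "\<phi> \<in> ring_hom k R"
  shows "left_module k (module_via \<phi> R)"
proof -
  interpret k: ring k by fact
  have sm: "carrier (module_via \<phi> R) = carrier R" "\<zero>\<^bsub>module_via \<phi> R\<^esub> = \<zero>"
    "\<And>x y. x \<oplus>\<^bsub>module_via \<phi> R\<^esub> y = x \<oplus> y" "\<And>a x. a \<odot>\<^bsub>module_via \<phi> R\<^esub> x = \<phi> a \<otimes> x"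
    by (simp_all add: module_via_def)
  have "abelian_group (module_via \<phi> R)"
  proof (rule abelian_groupI)
    fix x assume "x \<in> carrier (module_via \<phi> R)"
    then show "\<exists>y\<in>carrier (module_via \<phi> R). y \<oplus>\<^bsub>module_via \<phi> R\<^esub> x = \<zero>\<^bsub>module_via \<phi> R\<^esub>"
      by (intro bexI[of _ "\<ominus> x"]) (auto simp: sm l_neg)
  qed (auto simp: sm a_ac)
  then interpret M: abelian_group "module_via \<phi> R" .
  show ?thesis
    by (intro left_module.intro left_module_axioms.intro k.ring_axioms M.abelian_group_axioms)
       (use assms(2) ring_hom_closed[OF assms(2)] in
         \<open>auto simp: sm ring_hom_add ring_hom_mult ring_hom_one l_distr r_distr m_assoc\<close>)
qed

lemma (in ring) regular_left_module: "left_module R (regular_module R)"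
  unfolding regular_module_def
  by (rule module_via_left_module) (auto intro: ring_axioms ring_hom_memI)

text \<open>A finitely generated module has finite length over a subring \<open>K\<close> over which the ring
  has finite length: enlarging a submodule \<open>U\<close> by a generator \<open>s\<close> adds a quotient of the ring.\<close>

lemma fg_height:
  assumes fg: "fg_module R M" and K: "K \<subseteq> carrier R" "\<ominus>\<^bsub>R\<^esub> \<one>\<^bsub>R\<^esub> \<in> K"
    and n: "height_le (stable_subs K (regular_module R)) n"
  shows "\<exists>m. height_le (stable_subs K M) m"
proof -
  interpret M: left_module R M using fg by (rule fg_moduleD)
  have step: "\<exists>U\<in>submods R M. S \<subseteq> U \<and> (\<exists>m. height_le (stable_subs K M \<inter> Pow U) m)"
    if "finite S" "S \<subseteq> carrier M" for S
    using that
  proof (induction S)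
    case empty
    have "stable_subs K M \<inter> Pow {\<zero>\<^bsub>M\<^esub>} \<subseteq> {{\<zero>\<^bsub>M\<^esub>}}" by (auto dest: stable_subsD(3))
    then show ?case using M.stable_subs_zero[OF subset_refl] height_le_singleton by blast
  next
    case (insert s S)
    then obtain U m where U: "U \<in> submods R M" "S \<subseteq> U" "height_le (stable_subs K M \<inter> Pow U) m"
      by auto
    have s: "s \<in> carrier M" using insert.prems by auto
    note cs = M.cyc_submods[OF s]
    let ?U' = "U <+>\<^bsub>M\<^esub> cyc R M s"
    have U': "?U' \<in> submods R M" by (rule M.stable_subs_plus[OF U(1) cs subset_refl])
    have UK: "U \<in> stable_subs K M" using U(1) K by (auto simp: stable_subs_def)
    note DU = stable_subsD[OF U(1)]
    have "height_le (stable_subs K M \<inter> Pow ?U') (m + n)"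
    proof (rule height_le_combine[OF U(3) n, where \<alpha> = "\<lambda>V. V \<inter> U"
          and \<beta> = "\<lambda>V. {a \<in> carrier R. a \<odot>\<^bsub>M\<^esub> s \<in> U <+>\<^bsub>M\<^esub> V}"])
      show "V \<inter> U \<in> stable_subs K M \<inter> Pow U" if "V \<in> stable_subs K M \<inter> Pow ?U'" for V
        using that UK stable_subs_Int by auto
      let ?\<beta> = "\<lambda>V. {a \<in> carrier R. a \<odot>\<^bsub>M\<^esub> s \<in> U <+>\<^bsub>M\<^esub> V}"
      show "?\<beta> V \<in> stable_subs K (regular_module R)" if "V \<in> stable_subs K M \<inter> Pow ?U'" for V
      proof -
        have "U <+>\<^bsub>M\<^esub> V \<in> stable_subs K M" using M.stable_subs_plus[OF UK _ K(1)] that by auto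
        note D = stable_subsD[OF this]
        show ?thesis
          by (rule stable_subsI)
             (use K D s in \<open>auto simp: M.l_null M.smult_l_distr M.smult_assoc1\<close>)
      qed
      show "?\<beta> V \<subseteq> ?\<beta> W" if "V \<subseteq> W" for V W using that by (auto simp: set_add_def')
      show "W \<subseteq> V" if V: "V \<in> stable_subs K M \<inter> Pow ?U'" and W: "W \<in> stable_subs K M \<inter> Pow ?U'"
        and VW: "V \<subseteq> W" "V \<inter> U = W \<inter> U" "?\<beta> V = ?\<beta> W" for V W
      proof
        have DV: "V \<in> stable_subs K M" and DW: "W \<in> stable_subs K M" using V W by auto
        note cV = stable_subsD[OF DV] and cW = stable_subsD[OF DW]
        fix w assume w: "w \<in> W"
        then obtain u a where ua: "u \<in> U" "a \<in> carrier R" "w = u \<oplus>\<^bsub>M\<^esub> a \<odot>\<^bsub>M\<^esub> s"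
          using W by (force simp: set_add_def' cyc_def)
        have "a \<odot>\<^bsub>M\<^esub> s = (\<ominus>\<^bsub>M\<^esub> u) \<oplus>\<^bsub>M\<^esub> w" using ua s DU by (simp add: M.M.r_neg1)
        moreover have "\<ominus>\<^bsub>M\<^esub> u \<in> U" by (rule M.stable_subs_minus[OF UK K(2) ua(1)])
        ultimately have "a \<in> ?\<beta> W" using w ua(2) by (auto simp: set_add_def')
        then have "a \<in> ?\<beta> V" using VW(3) by simp
        then obtain u' v where u': "u' \<in> U" "v \<in> V" "a \<odot>\<^bsub>M\<^esub> s = u' \<oplus>\<^bsub>M\<^esub> v" by (auto simp: set_add_def')
        have c: "u \<in> carrier M" "u' \<in> carrier M" "v \<in> carrier M" "w \<in> carrier M"
          using ua u' w DU cV cW by auto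
        have weq: "w = (u \<oplus>\<^bsub>M\<^esub> u') \<oplus>\<^bsub>M\<^esub> v" using c ua(3) u'(3) by (simp add: M.M.a_assoc)
        then have "w \<ominus>\<^bsub>M\<^esub> v = u \<oplus>\<^bsub>M\<^esub> u'" using c by (simp add: a_minus_def M.M.a_assoc M.M.r_neg)
        moreover have "w \<ominus>\<^bsub>M\<^esub> v \<in> W" by (rule M.stable_subs_diff[OF DW K(2) w]) (use u' VW in auto)
        ultimately have "u \<oplus>\<^bsub>M\<^esub> u' \<in> W \<inter> U" using DU ua u' by auto
        then have "u \<oplus>\<^bsub>M\<^esub> u' \<in> V" using VW(2) by blast
        then show "w \<in> V" unfolding weq using cV(4) u'(2) by simp
      qed
    qed auto
    moreover have "insert s S \<subseteq> ?U'"
      using M.subset_plus[OF U(1) cs] U(2) M.cyc_self[OF s] by auto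
    ultimately show ?case using U' by blast
  qed
  obtain S where S: "finite S" "S \<subseteq> carrier M" "\<And>U. U \<in> submods R M \<Longrightarrow> S \<subseteq> U \<Longrightarrow> U = carrier M"
    by (rule fg_generators[OF fg]) blast
  obtain U m where "U \<in> submods R M" "S \<subseteq> U" "height_le (stable_subs K M \<inter> Pow U) m"
    using step[OF S(1,2)] by blast
  moreover from this have "U = carrier M" using S(3) by simp
  ultimately show ?thesis
    by (metis Int_absorb2 PowI stable_subsD(1) subsetI)
qed

text \<open>Modules of finite length are Noetherian.\<close>

lemma fg_submodule:
  assumes fg: "fg_module R M" and h: "height_le (submods R M) n" and U: "U \<in> submods R M"
  shows "fg_module R (M\<lparr>carrier := U\<rparr>)"
proof -
  interpret M: left_module R M using fg by (rule fg_moduleD)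
  define P where "P = (\<lambda>V. V \<subseteq> U \<and> (\<exists>S. finite S \<and> S \<subseteq> V \<and> (\<forall>N\<in>submods R M. S \<subseteq> N \<longrightarrow> V \<subseteq> N)))"
  note DU = stable_subsD[OF U]
  have "P {\<zero>\<^bsub>M\<^esub>}" unfolding P_def using DU(3) by (auto intro!: exI[of _ "{}"] dest: stable_subsD(3))
  from height_le_max[where P = P, OF h M.stable_subs_zero[OF subset_refl] this]
  obtain V where V: "V \<in> submods R M" "P V" "\<forall>W\<in>submods R M. P W \<longrightarrow> V \<subseteq> W \<longrightarrow> W = V"
    by (elim bexE conjE)
  obtain S where S: "finite S" "S \<subseteq> V" "\<forall>N\<in>submods R M. S \<subseteq> N \<longrightarrow> V \<subseteq> N" "V \<subseteq> U"
    using V(2) unfolding P_def by (elim exE conjE)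
  have "U \<subseteq> V"
  proof
    fix x assume x: "x \<in> U"
    then have xM: "x \<in> carrier M" using DU by auto
    note cx = M.cyc_submods[OF xM]
    let ?W = "V <+>\<^bsub>M\<^esub> cyc R M x"
    have W: "?W \<in> submods R M" by (rule M.stable_subs_plus[OF V(1) cx subset_refl])
    have sub: "V \<subseteq> ?W" "cyc R M x \<subseteq> ?W" by (rule M.subset_plus[OF V(1) cx])+
    have "?W \<subseteq> U" by (rule M.plus_least[OF U]) (use S(4) M.cyc_least[OF U x] in auto)
    moreover have "?W \<subseteq> N" if "N \<in> submods R M" "insert x S \<subseteq> N" for N
      by (rule M.plus_least[OF that(1)]) (use S that M.cyc_least in auto)
    ultimately have "P ?W"
      unfolding P_def using S sub M.cyc_self[OF xM] by (intro conjI exI[of _ "insert x S"]) auto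
    then have "?W = V" using V(3) W sub(1) by simp
    then show "x \<in> V" using sub M.cyc_self[OF xM] by auto
  qed
  then have UV: "U = V" using S(4) by auto
  interpret N: left_module R "M\<lparr>carrier := U\<rparr>" by (rule M.sub_left_module[OF U])
  have "fin_gen R (M\<lparr>carrier := U\<rparr>)"
    unfolding fin_gen_def N.submodule_iff stable_subs_sub_iff[OF DU(1)]
    using S UV by (intro exI[of _ S]) auto
  then show ?thesis by (simp add: fg_module_def N.left_module_axioms)
qed

lemma (in cring) submods_ideal:
  assumes "I \<in> submods R (regular_module R)"
  shows "ideal I R"
proof (rule idealI)
  note D = stable_subsD[OF assms, simplified]
  have "\<ominus> x \<in> I" if "x \<in> I" for x
    using D(5)[of "\<ominus> \<one>" x] that D(2) by (simp add: l_minus)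
  then show "subgroup I (add_monoid R)"
    using D by (intro subgroup.intro) (auto simp: a_inv_def)
  show *: "x \<otimes> a \<in> I" if "a \<in> I" "x \<in> carrier R" for a x
    using stable_subsD(5)[OF assms that(2,1)] by simp
  show "a \<otimes> x \<in> I" if "a \<in> I" "x \<in> carrier R" for a x
    using *[OF that] stable_subsD(2)[OF assms that(1)] that(2) by (simp add: m_comm)
qed (rule ring_axioms)

lemma (in comm_artin_ring) minimal_ideal:
  assumes "I\<^sub>0 \<in> submods k (regular_module k)" "P I\<^sub>0"
  shows "\<exists>I\<in>submods k (regular_module k). P I \<and>
    (\<forall>J\<in>submods k (regular_module k). P J \<longrightarrow> \<not> J \<subset> I)"
proof (rule ccontr)
  let ?S = "submods k (regular_module k)"
  assume "\<not> ?thesis"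
  then have next_ideal: "\<exists>J. (J \<in> ?S \<and> P J) \<and> J \<subset> I" if "I \<in> ?S \<and> P I" for I
    using that by blast
  have "\<exists>f :: nat \<Rightarrow> 'k set. \<forall>n. (f n \<in> ?S \<and> P (f n)) \<and> f (Suc n) \<subset> f n"
    by (rule dependent_nat_choice) (use assms next_ideal in auto)
  then obtain f :: "nat \<Rightarrow> 'k set" where f: "\<forall>n. (f n \<in> ?S \<and> P (f n)) \<and> f (Suc n) \<subset> f n" ..
  then have fS: "f n \<in> ?S" and dec: "f (Suc n) \<subset> f n" for n by simp_all
  have "\<exists>N. \<forall>n\<ge>N. f n = f N"
    by (rule descending_chain) (use submods_ideal[OF fS] dec in auto)
  then obtain N where N: "\<forall>n\<ge>N. f n = f N" ..
  have "f (Suc N) = f N" by (rule N[rule_format]) simp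
  then show False using dec[of N] by simp
qed

text \<open>A commutative Artinian ring has finite length. Otherwise let \<open>N\<close> be minimal among the ideals
  of infinite length. For each scalar \<open>a\<close>, either \<open>aN = N\<close> or \<open>aN = 0\<close>, because the kernel and the
  image of the multiplication by \<open>a\<close> on \<open>N\<close> cannot both be proper. If \<open>aN = N\<close>, the chain of
  ideals generated by the powers of \<open>a\<close> shows that \<open>a\<close> acts on \<open>N\<close> invertibly. Thus \<open>N\<close> is in
  effect a vector space. A subspace that is maximal without a given vector \<open>x \<noteq> 0\<close> is a
  hyperplane; its length is finite, and so is that of \<open>N\<close>.\<close>

lemma (in comm_artin_ring) finite_length: "\<exists>n. height_le (submods k (regular_module k)) n"
proof (rule ccontr)
  let ?M = "regular_module k"
  let ?S = "submods k ?M"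
  interpret M: left_module k ?M by (rule regular_left_module)
  define fl where "fl U \<longleftrightarrow> (\<exists>n. height_le (?S \<inter> Pow U) n)" for U
  assume neg: "\<not> ?thesis"
  have "\<not> fl (carrier k)"
  proof
    assume "fl (carrier k)"
    moreover have "?S \<inter> Pow (carrier k) = ?S" using stable_subsD(1)[of _ _ ?M] by auto
    ultimately show False using neg by (simp add: fl_def)
  qed
  moreover have "carrier k \<in> ?S" using M.stable_subs_carrier[OF subset_refl] by simp
  ultimately have "\<exists>I\<in>?S. \<not> fl I \<and> (\<forall>J\<in>?S. \<not> fl J \<longrightarrow> \<not> J \<subset> I)"
    by (intro minimal_ideal)
  then obtain N where N': "N \<in> ?S" "\<not> fl N" "\<forall>J\<in>?S. \<not> fl J \<longrightarrow> \<not> J \<subset> N"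
    by (elim bexE conjE)
  have N: "N \<in> ?S" "\<not> fl N" "\<And>J. J \<in> ?S \<Longrightarrow> J \<subset> N \<Longrightarrow> fl J" using N' by auto
  note DN = stable_subsD[OF N(1), simplified]
  have m1: "\<ominus> \<one> \<in> carrier k" by simp
  have zeroS: "{\<zero>} \<in> ?S" using M.stable_subs_zero[OF subset_refl] by simp
  have "fl {\<zero>}"
  proof -
    have "?S \<inter> Pow {\<zero>} \<subseteq> {{\<zero>}}" using stable_subsD(3)[of _ _ ?M] by auto
    then show ?thesis unfolding fl_def by (intro exI[of _ 0] height_le_singleton)
  qed
  then have "N \<noteq> {\<zero>}" using N(2) by auto
  then obtain x where x: "x \<in> N" "x \<noteq> \<zero>" using DN(3) by auto
  have mult_hom: "(\<lambda>y. a \<otimes> y) \<in> lmod_hom k ?M ?M" if "a \<in> carrier k" for a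
    using that by (intro homI) (auto simp: r_distr m_lcomm)
  have surj: "(\<lambda>y. a \<otimes> y) ` N = N" if a: "a \<in> carrier k" "y\<^sub>0 \<in> N" "a \<otimes> y\<^sub>0 \<noteq> \<zero>" for a y\<^sub>0
  proof (rule ccontr)
    assume ne: "(\<lambda>y. a \<otimes> y) ` N \<noteq> N"
    let ?f = "\<lambda>y. a \<otimes> y"
    have im: "?f ` N \<in> ?S"
      by (rule stable_subs_image[OF M.left_module_axioms M.left_module_axioms mult_hom[OF a(1)] N(1) subset_refl])
    moreover have "?f ` N \<subset> N" using ne DN a by auto
    ultimately have "fl (?f ` N)" by (rule N(3))
    then obtain n where n: "height_le (?S \<inter> Pow (?f ` N)) n" unfolding fl_def ..
    let ?K = "lmod_ker ?M ?M ?f \<inter> N"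
    have K: "?K \<in> ?S"
      using hom_ker_submods[OF M.left_module_axioms M.left_module_axioms mult_hom[OF a(1)]] N(1)
      by (rule stable_subs_Int)
    moreover have "?K \<subset> N" using a by (auto simp: lmod_ker_def)
    ultimately have "fl ?K" by (rule N(3))
    then obtain l where l: "height_le (?S \<inter> Pow ?K) l" unfolding fl_def ..
    have "height_le (?S \<inter> Pow N) (l + n)"
    proof (rule height_le_combine[OF l n, where \<alpha> = "\<lambda>V. V \<inter> ?K" and \<beta> = "\<lambda>V. ?f ` V"])
      show "V \<inter> ?K \<in> ?S \<inter> Pow ?K" if "V \<in> ?S \<inter> Pow N" for V using that K stable_subs_Int by auto
      show "?f ` V \<in> ?S \<inter> Pow (?f ` N)" if "V \<in> ?S \<inter> Pow N" for V
        using that stable_subs_image[OF M.left_module_axioms M.left_module_axioms mult_hom[OF a(1)] _ subset_refl]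
        by auto
      show "W \<subseteq> V" if V: "V \<in> ?S \<inter> Pow N" and W: "W \<in> ?S \<inter> Pow N"
        and eq: "V \<subseteq> W" "V \<inter> ?K = W \<inter> ?K" "?f ` V = ?f ` W" for V W
      proof
        have VS: "V \<in> ?S" and WS: "W \<in> ?S" using V W by auto
        fix w assume w: "w \<in> W"
        then have "a \<otimes> w \<in> ?f ` V" unfolding eq(3) by (rule imageI)
        then obtain v where v: "v \<in> V" "a \<otimes> w = a \<otimes> v" by blast
        have c: "w \<in> carrier k" "v \<in> carrier k"
          using stable_subsD(2)[OF WS w] stable_subsD(2)[OF VS v(1)] by auto
        have d: "w \<ominus>\<^bsub>?M\<^esub> v \<in> W" by (rule M.stable_subs_diff[OF WS m1 w]) (use v eq in auto)
        have "a \<otimes> (w \<ominus>\<^bsub>?M\<^esub> v) = \<zero>"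
          using hom_diff[OF M.left_module_axioms M.left_module_axioms mult_hom[OF a(1)], of w v] c v a(1)
            M.M.diff_self[of "a \<otimes> v"] by simp
        then have "w \<ominus>\<^bsub>?M\<^esub> v \<in> W \<inter> ?K" using d W stable_subsD(2)[OF WS d] by (auto simp: lmod_ker_def)
        then have "w \<ominus>\<^bsub>?M\<^esub> v \<in> V" using eq(2) by blast
        then have "(w \<ominus>\<^bsub>?M\<^esub> v) \<oplus>\<^bsub>?M\<^esub> v \<in> V" using stable_subsD(4)[OF VS _ v(1)] by blast
        then show "w \<in> V" using M.M.diff_add_cancel[of w v] c by simp
      qed
    qed auto
    then show False using N(2) unfolding fl_def by auto
  qed
  have inv: "\<exists>b\<in>carrier k. \<forall>y\<in>N. b \<otimes> (a \<otimes> y) = y"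
    if a: "a \<in> carrier k" "y\<^sub>0 \<in> N" "a \<otimes> y\<^sub>0 \<noteq> \<zero>" for a y\<^sub>0
  proof -
    have aN: "(\<lambda>y. a \<otimes> y) ` N = N" by (rule surj[OF a])
    have "\<exists>K::nat. \<forall>n\<ge>K. (\<lambda>r. (a [^] n) \<otimes> r) ` carrier k = (\<lambda>r. (a [^] K) \<otimes> r) ` carrier k"
    proof (rule descending_chain[where I = "\<lambda>n::nat. (\<lambda>r. (a [^] n) \<otimes> r) ` carrier k"])
      fix n :: nat
      have an: "a [^] n \<in> carrier k" using a(1) by simp
      have "(\<lambda>r. (a [^] n) \<otimes> r) ` carrier k \<in> ?S"
        using stable_subs_image[OF M.left_module_axioms M.left_module_axioms mult_hom[OF an]
            M.stable_subs_carrier[OF subset_refl] subset_refl] by simp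
      then show "ideal ((\<lambda>r. (a [^] n) \<otimes> r) ` carrier k) k" by (rule submods_ideal)
      show "(\<lambda>r. (a [^] Suc n) \<otimes> r) ` carrier k \<subseteq> (\<lambda>r. (a [^] n) \<otimes> r) ` carrier k"
        using a(1) by (auto simp: m_assoc)
    qed
    then obtain K :: nat where K': "\<forall>n\<ge>K. (\<lambda>r. (a [^] n) \<otimes> r) ` carrier k = (\<lambda>r. (a [^] K) \<otimes> r) ` carrier k" ..
    have K: "(\<lambda>r. (a [^] Suc K) \<otimes> r) ` carrier k = (\<lambda>r. (a [^] K) \<otimes> r) ` carrier k"
      by (rule K'[rule_format]) simp
    have aK: "a [^] K \<in> carrier k" using a(1) by simp
    have "a [^] K \<in> (\<lambda>r. (a [^] K) \<otimes> r) ` carrier k"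
      using aK by (intro image_eqI[of _ _ \<one>]) simp_all
    then obtain b where b: "b \<in> carrier k" "a [^] K = a [^] Suc K \<otimes> b" unfolding K[symmetric] by blast
    have pow: "(\<lambda>y. (a [^] n) \<otimes> y) ` N = N" for n :: nat
    proof (induction n)
      case 0 then show ?case using DN by force
    next
      case (Suc n)
      have "(\<lambda>y. (a [^] Suc n) \<otimes> y) ` N = (\<lambda>y. (a [^] n) \<otimes> y) ` ((\<lambda>y. a \<otimes> y) ` N)"
        using a(1) DN(2) by (auto simp: image_image m_assoc)
      then show ?case using Suc aN by simp
    qed
    have "b \<otimes> (a \<otimes> y) = y" if "y \<in> N" for y
    proof -
      have "y \<in> (\<lambda>y. (a [^] K) \<otimes> y) ` N" unfolding pow by fact
      then obtain z where z: "z \<in> N" "y = a [^] K \<otimes> z" by blast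
      have zc: "z \<in> carrier k" using z DN by auto
      have "b \<otimes> (a \<otimes> y) = (a [^] Suc K \<otimes> b) \<otimes> z"
        using z(2) zc b(1) a(1) aK by (simp add: m_ac)
      then show ?thesis by (simp only: b(2)[symmetric] z(2)[symmetric])
    qed
    then show ?thesis using b(1) by blast
  qed
  \<comment> \<open>A hyperplane of \<open>N\<close> that misses \<open>x\<close>.\<close>
  have "\<exists>H\<in>{H \<in> ?S. H \<subseteq> N \<and> x \<notin> H}. \<forall>X\<in>{H \<in> ?S. H \<subseteq> N \<and> x \<notin> H}. H \<subseteq> X \<longrightarrow> X = H"
  proof (rule subset_Zorn_nonempty)
    show "{H \<in> ?S. H \<subseteq> N \<and> x \<notin> H} \<noteq> {}" using zeroS DN(3) x by auto
    fix C assume C: "C \<noteq> {}" "subset.chain {H \<in> ?S. H \<subseteq> N \<and> x \<notin> H} C"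
    have CS: "H \<in> ?S" "H \<subseteq> N" "x \<notin> H" if "H \<in> C" for H using C(2) that by (auto simp: subset.chain_def)
    have "\<Union> C \<in> ?S"
    proof (rule stable_subsI)
      show "\<Union> C \<subseteq> carrier ?M" using stable_subsD(1)[OF CS(1)] by (rule Union_least)
      obtain H where "H \<in> C" using C(1) by auto
      then show "\<zero>\<^bsub>?M\<^esub> \<in> \<Union> C" using stable_subsD(3)[OF CS(1)[OF \<open>H \<in> C\<close>]] by (rule UnionI)
      show "u \<oplus>\<^bsub>?M\<^esub> v \<in> \<Union> C" if "u \<in> \<Union> C" "v \<in> \<Union> C" for u v
      proof -
        obtain H G where HG: "H \<in> C" "G \<in> C" "u \<in> H" "v \<in> G" using \<open>u \<in> \<Union> C\<close> \<open>v \<in> \<Union> C\<close> by blast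
        then consider "H \<subseteq> G" | "G \<subseteq> H" using C(2) unfolding subset.chain_def by blast
        then show ?thesis
        proof cases
          case 1 then show ?thesis using HG stable_subsD(4)[OF CS(1)[OF HG(2)], of u v] by auto
        next
          case 2 then show ?thesis using HG stable_subsD(4)[OF CS(1)[OF HG(1)], of u v] by auto
        qed
      qed
      show "c \<odot>\<^bsub>?M\<^esub> u \<in> \<Union> C" if "c \<in> carrier k" "u \<in> \<Union> C" for c u
        using that by (auto intro: stable_subsD(5)[OF CS(1), simplified])
    qed
    then show "\<Union> C \<in> {H \<in> ?S. H \<subseteq> N \<and> x \<notin> H}" using CS(2,3) by auto
  qed
  then obtain H where H: "H \<in> ?S" "H \<subseteq> N" "x \<notin> H"
    and Hmax: "\<And>X. X \<in> ?S \<Longrightarrow> X \<subseteq> N \<Longrightarrow> x \<notin> X \<Longrightarrow> H \<subseteq> X \<Longrightarrow> X = H" by auto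
  note DH = stable_subsD[OF H(1), simplified]
  have xc: "x \<in> carrier k" using x DN by auto
  have decomp: "\<exists>h\<in>H. \<exists>c\<in>carrier k. x = h \<oplus> c \<otimes> y" if y: "y \<in> N" "y \<notin> H" for y
  proof -
    have yc: "y \<in> carrier ?M" using y DN by auto
    note cy = M.cyc_submods[OF yc]
    let ?X = "H <+>\<^bsub>?M\<^esub> cyc k ?M y"
    have X: "?X \<in> ?S" by (rule M.stable_subs_plus[OF H(1) cy subset_refl])
    have "?X \<subseteq> N" by (rule M.plus_least[OF N(1) H(2) M.cyc_least[OF N(1) y(1)]])
    moreover have "?X \<noteq> H" using M.subset_plus[OF H(1) cy] M.cyc_self[OF yc] y(2) by auto
    ultimately have "x \<in> ?X" using Hmax[OF X] M.subset_plus(1)[OF H(1) cy] by auto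
    then show ?thesis by (auto simp: set_add_def' cyc_def)
  qed
  have "height_le (?S \<inter> Pow N) (n + 1)" if n: "height_le (?S \<inter> Pow H) n" for n
  proof (rule height_le_combine[OF n, where \<alpha> = "\<lambda>V. V \<inter> H"
        and \<beta> = "\<lambda>V. if V \<subseteq> H then {} else UNIV" and H = "{{}, UNIV}"])
    show "height_le {{}, UNIV :: 'k set} 1"
      by (rule height_leI[of _ "\<lambda>V. if V = {} then 0 else 1"]) auto
    show "V \<inter> H \<in> ?S \<inter> Pow H" if "V \<in> ?S \<inter> Pow N" for V using that H(1) stable_subs_Int by auto
    show "W \<subseteq> V" if V: "V \<in> ?S \<inter> Pow N" and W: "W \<in> ?S \<inter> Pow N" and eq: "V \<subseteq> W" "V \<inter> H = W \<inter> H"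
      "(if V \<subseteq> H then {} else UNIV) = (if W \<subseteq> H then {} else (UNIV :: 'k set))" for V W
    proof (cases "W \<subseteq> H")
      case True
      then show ?thesis using eq by auto
    next
      case False
      then have "\<not> V \<subseteq> H" using eq(3) by (auto split: if_splits)
      then obtain y where y: "y \<in> V" "y \<notin> H" by auto
      have VS: "V \<in> ?S" and WS: "W \<in> ?S" using V W by auto
      note DV = stable_subsD[OF VS, simplified] and DW = stable_subsD[OF WS, simplified]
      obtain h c where hc: "h \<in> H" "c \<in> carrier k" "x = h \<oplus> c \<otimes> y" using decomp[of y] y V by auto
      show ?thesis
      proof
        fix w assume w: "w \<in> W"
        show "w \<in> V"
        proof (cases "w \<in> H")
          case True then show ?thesis using eq(2) w by blast
        next
          case False
          have wN: "w \<in> N" and wc: "w \<in> carrier k" using w W DW by auto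
          obtain g e where ge: "g \<in> H" "e \<in> carrier k" "x = g \<oplus> e \<otimes> w" using decomp[OF wN False] by auto
          \<comment> \<open>\<open>e\<close> acts invertibly, since otherwise \<open>x \<in> H\<close>.\<close>
          have "e \<otimes> w \<noteq> \<zero>" using ge H(3) DH(2) by auto
          then obtain b where b: "b \<in> carrier k" "b \<otimes> (e \<otimes> w) = w" using inv[OF ge(2) wN] wN by auto
          have cc: "h \<in> carrier k" "g \<in> carrier k" "y \<in> carrier k" using hc ge DH y DV by auto
          have "e \<otimes> w = (h \<ominus> g) \<oplus> c \<otimes> y"
          proof -
            have "e \<otimes> w = (\<ominus> g) \<oplus> x" unfolding ge(3) using cc ge(2) wc by (simp add: r_neg1)
            then show ?thesis unfolding hc(3) using cc hc(2) by (simp add: a_minus_def a_ac)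
          qed
          then have "w = b \<otimes> (h \<ominus> g) \<oplus> (b \<otimes> c) \<otimes> y"
            using b cc hc(2) by (metis r_distr m_assoc minus_closed m_closed)
          moreover have "h \<ominus> g \<in> H"
            using M.stable_subs_diff[OF H(1) m1 hc(1) ge(1)] M.stable_subs_minus[OF H(1) m1 ge(1)]
              DH(4)[OF hc(1)] M.minus_one[of g] minus_eq[of h g] cc l_minus[of \<one> g] by simp
          ultimately obtain h' v where h': "h' \<in> H" "v \<in> V" "w = h' \<oplus> v"
            using DH(5)[OF b(1)] DV(5)[of "b \<otimes> c" y] b hc y by auto
          have hc': "h' \<in> carrier k" "v \<in> carrier k" using h' DH DV by auto
          have d: "w \<ominus>\<^bsub>?M\<^esub> v \<in> W" by (rule M.stable_subs_diff[OF WS m1 w]) (use h' eq in auto)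
          have "w \<ominus>\<^bsub>?M\<^esub> v = h'"
            unfolding h'(3) a_minus_def
            using hc' M.M.a_assoc[of h' v "\<ominus>\<^bsub>?M\<^esub> v"] M.M.r_neg[of v] M.M.a_inv_closed[of v] by simp
          then have "h' \<in> V" using d h'(1) eq(2) by blast
          then show "w \<in> V" using h' DV(4) by simp
        qed
      qed
    qed
  qed (auto split: if_splits)
  moreover have "fl H" using N(3)[OF H(1)] H x(1) by auto
  ultimately have "fl N" unfolding fl_def by (elim exE) (rule exI)
  then show False using N(2) by simp
qed

lemma artin_algebra_minus_one:
  assumes "artin_algebra k A \<phi>"
  shows "\<ominus>\<^bsub>A\<^esub> \<one>\<^bsub>A\<^esub> \<in> \<phi> ` carrier k"
proof -
  interpret k: comm_artin_ring k using assms(1) by (rule artin_algebra.axioms)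
  interpret artin_algebra k A \<phi> by fact
  have closed: "\<phi> c \<in> carrier A" if "c \<in> carrier k" for c
    using ring_hom_closed[OF structure_hom that] .
  have "\<phi> (\<ominus>\<^bsub>k\<^esub> \<one>\<^bsub>k\<^esub>) \<oplus>\<^bsub>A\<^esub> \<one>\<^bsub>A\<^esub> = \<phi> (\<ominus>\<^bsub>k\<^esub> \<one>\<^bsub>k\<^esub> \<oplus>\<^bsub>k\<^esub> \<one>\<^bsub>k\<^esub>)"
    using structure_hom by (simp add: ring_hom_add ring_hom_one)
  also have "\<dots> = \<zero>\<^bsub>A\<^esub>"
    using ring_hom_zero[OF structure_hom k.ring_axioms A.ring_axioms] by (simp add: k.l_neg)
  finally have "\<ominus>\<^bsub>A\<^esub> \<one>\<^bsub>A\<^esub> = \<phi> (\<ominus>\<^bsub>k\<^esub> \<one>\<^bsub>k\<^esub>)"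
    using closed by (intro A.minus_equality) auto
  then show ?thesis by (metis k.a_inv_closed imageI k.one_closed)
qed

text \<open>Over an Artin algebra, modules have finite length even over the base ring, which acts through
  the image of \<open>\<phi>\<close>.\<close>

lemma artin_algebra_height:
  assumes "artin_algebra k A \<phi>" "fg_module A M"
  shows "\<exists>n. height_le (stable_subs (\<phi> ` carrier k) M) n"
proof -
  interpret k: comm_artin_ring k using assms(1) by (rule artin_algebra.axioms)
  interpret artin_algebra k A \<phi> by fact
  obtain n where n: "height_le (submods k (regular_module k)) n" using k.finite_length ..
  interpret V: left_module k "module_via \<phi> A"
    by (rule A.module_via_left_module[OF _ structure_hom]) (rule k.ring_axioms)
  have "fg_module k (module_via \<phi> A)"
    using finite_over_base by (simp add: fg_module_def V.left_module_axioms)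
  from fg_height[OF this subset_refl _ n] obtain m where "height_le (submods k (module_via \<phi> A)) m" by auto
  moreover have "submods k (module_via \<phi> A) = stable_subs (\<phi> ` carrier k) (regular_module A)"
    by (simp add: stable_subs_def module_via_def regular_module_def)
  ultimately have m: "height_le (stable_subs (\<phi> ` carrier k) (regular_module A)) m" by simp
  have "\<phi> ` carrier k \<subseteq> carrier A" using ring_hom_closed[OF structure_hom] by auto
  then show ?thesis by (rule fg_height[OF assms(2) _ artin_algebra_minus_one[OF assms(1)] m])
qed

section \<open>Biproducts and decompositions\<close>

text \<open>Mutually inverse homomorphisms. In contrast to \<^const>\<open>lmod_iso\<close>, both are named.\<close>

definition inverse_homs ::
    "('a, 'r) ring_scheme \<Rightarrow> ('a, 'b) module \<Rightarrow> ('a, 'c) module \<Rightarrow> ('b \<Rightarrow> 'c) \<Rightarrow> ('c \<Rightarrow> 'b) \<Rightarrow> bool" where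
  "inverse_homs R M N f g \<longleftrightarrow> f \<in> lmod_hom R M N \<and> g \<in> lmod_hom R N M \<and>
     (\<forall>x\<in>carrier M. g (f x) = x) \<and> (\<forall>y\<in>carrier N. f (g y) = y)"

lemma inverse_homsD:
  assumes "inverse_homs R M N f g"
  shows "f \<in> lmod_hom R M N" "g \<in> lmod_hom R N M"
    "x \<in> carrier M \<Longrightarrow> g (f x) = x" "y \<in> carrier N \<Longrightarrow> f (g y) = y"
  using assms by (simp_all add: inverse_homs_def)

lemma inverse_homs_sym: "inverse_homs R M N f g \<Longrightarrow> inverse_homs R N M g f"
  by (auto simp: inverse_homs_def)

lemma inverse_homs_onto: "inverse_homs R M N f g \<Longrightarrow> f ` carrier M = carrier N"
  using hom_closed[of f R M N] hom_closed[of g R N M]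
  by (force simp: inverse_homs_def image_iff intro!: bexI[of _ "g _"])

lemma inverse_homs_inj: "inverse_homs R M N f g \<Longrightarrow> inj_on f (carrier M)"
  by (rule inj_on_inverseI[of _ g]) (simp add: inverse_homsD)

lemma bij_hom_inverse:
  assumes "left_module R M" "left_module R N" "f \<in> lmod_hom R M N" "bij_betw f (carrier M) (carrier N)"
  shows "\<exists>g. inverse_homs R M N f g"
proof -
  have f: "inj_on f (carrier M)" "f ` carrier M = carrier N" using assms(4) by (auto simp: bij_betw_def)
  have "\<exists>g\<in>lmod_hom R N M. \<forall>y\<in>carrier N. f (g y) = y"
    by (rule hom_factor_mono[OF assms(1,2,2,3) f(1) hom_id]) (use f in simp)
  then obtain g where g: "g \<in> lmod_hom R N M" "\<And>y. y \<in> carrier N \<Longrightarrow> f (g y) = y" by auto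
  have "g (f x) = x" if "x \<in> carrier M" for x
    by (rule inj_onD[OF f(1)]) (use g that hom_closed[OF assms(3)] hom_closed[OF g(1)] in auto)
  then show ?thesis using assms(3) g by (auto simp: inverse_homs_def)
qed

lemma lmod_iso_inverse:
  assumes "left_module R M" "left_module R N" "lmod_iso R M N"
  shows "\<exists>f g. inverse_homs R M N f g"
proof -
  obtain f where "f \<in> lmod_hom R M N" "bij_betw f (carrier M) (carrier N)"
    using assms(3) unfolding lmod_iso_def by auto
  from bij_hom_inverse[OF assms(1,2) this] show ?thesis by auto
qed

lemma amod_representation:
  assumes "fg_module R M"
  shows "\<exists>(N :: 'a amod) f g. fg_module (R :: ('a, 'r) ring_scheme) N \<and> inverse_homs R M N f g"
proof -
  obtain N :: "'a amod" where N: "fg_module R N" "lmod_iso R M N"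
    using fg_module_representable[OF assms] by auto
  have "\<exists>f g. inverse_homs R M N f g"
    by (rule lmod_iso_inverse[OF assms[THEN fg_moduleD] N(1)[THEN fg_moduleD] N(2)])
  then show ?thesis using N(1) by auto
qed

text \<open>\<open>S\<close> is the direct sum of \<open>M\<close> and \<open>N\<close>, with injections \<open>i\<close>, \<open>j\<close> and projections \<open>p\<close>, \<open>q\<close>. The
  description by maps covers internal direct sums and those in the fixed type of modules alike.\<close>

definition biproduct ::
    "('a, 'r) ring_scheme \<Rightarrow> ('a, 'd) module \<Rightarrow> ('a, 'b) module \<Rightarrow> ('a, 'c) module \<Rightarrow>
     ('b \<Rightarrow> 'd) \<Rightarrow> ('c \<Rightarrow> 'd) \<Rightarrow> ('d \<Rightarrow> 'b) \<Rightarrow> ('d \<Rightarrow> 'c) \<Rightarrow> bool" where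
  "biproduct R S M N i j p q \<longleftrightarrow>
     left_module R S \<and> left_module R M \<and> left_module R N \<and>
     i \<in> lmod_hom R M S \<and> j \<in> lmod_hom R N S \<and> p \<in> lmod_hom R S M \<and> q \<in> lmod_hom R S N \<and>
     (\<forall>x\<in>carrier M. p (i x) = x \<and> q (i x) = \<zero>\<^bsub>N\<^esub>) \<and>
     (\<forall>y\<in>carrier N. q (j y) = y \<and> p (j y) = \<zero>\<^bsub>M\<^esub>) \<and>
     (\<forall>z\<in>carrier S. i (p z) \<oplus>\<^bsub>S\<^esub> j (q z) = z)"

lemma biproductD:
  assumes "biproduct R S M N i j p q"
  shows "left_module R S" "left_module R M" "left_module R N"
    "i \<in> lmod_hom R M S" "j \<in> lmod_hom R N S" "p \<in> lmod_hom R S M" "q \<in> lmod_hom R S N"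
    "x \<in> carrier M \<Longrightarrow> p (i x) = x" "x \<in> carrier M \<Longrightarrow> q (i x) = \<zero>\<^bsub>N\<^esub>"
    "y \<in> carrier N \<Longrightarrow> q (j y) = y" "y \<in> carrier N \<Longrightarrow> p (j y) = \<zero>\<^bsub>M\<^esub>"
    "z \<in> carrier S \<Longrightarrow> i (p z) \<oplus>\<^bsub>S\<^esub> j (q z) = z"
  using assms by (simp_all add: biproduct_def)

lemma biproduct_fg:
  assumes b: "biproduct R S M N i j p q" and fg: "fg_module R M" "fg_module R N"
  shows "fg_module R S"
proof -
  note B = biproductD[OF b]
  interpret S: left_module R S by (rule B(1))
  interpret M: left_module R M by (rule B(2))
  interpret N: left_module R N by (rule B(3))
  obtain X where X: "finite X" "X \<subseteq> carrier M" "\<And>U. U \<in> submods R M \<Longrightarrow> X \<subseteq> U \<Longrightarrow> U = carrier M"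
    by (rule fg_generators[OF fg(1)]) blast
  obtain Y where Y: "finite Y" "Y \<subseteq> carrier N" "\<And>U. U \<in> submods R N \<Longrightarrow> Y \<subseteq> U \<Longrightarrow> U = carrier N"
    by (rule fg_generators[OF fg(2)]) blast
  have gen: "V = carrier S" if V: "V \<in> submods R S" "i ` X \<union> j ` Y \<subseteq> V" for V
  proof -
    have "{x \<in> carrier M. i x \<in> V} = carrier M"
    proof (rule X(3))
      show "{x \<in> carrier M. i x \<in> V} \<in> submods R M"
        by (rule stable_subs_vimage[OF B(2,1,4) V(1) subset_refl])
      show "X \<subseteq> {x \<in> carrier M. i x \<in> V}" using X(2) V(2) by auto
    qed
    moreover have "{x \<in> carrier N. j x \<in> V} = carrier N"
    proof (rule Y(3))
      show "{x \<in> carrier N. j x \<in> V} \<in> submods R N"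
        by (rule stable_subs_vimage[OF B(3,1,5) V(1) subset_refl])
      show "Y \<subseteq> {x \<in> carrier N. j x \<in> V}" using Y(2) V(2) by auto
    qed
    ultimately have "i x \<in> V" "j y \<in> V" if "x \<in> carrier M" "y \<in> carrier N" for x y using that by auto
    then have "z \<in> V" if "z \<in> carrier S" for z
      using stable_subsD(4)[OF V(1)] B(12)[OF that] hom_closed[OF B(6) that] hom_closed[OF B(7) that]
      by metis
    then show ?thesis using stable_subsD(1)[OF V(1)] by auto
  qed
  have "finite (i ` X \<union> j ` Y)" "i ` X \<union> j ` Y \<subseteq> carrier S"
    using X Y hom_closed[OF B(4)] hom_closed[OF B(5)] by auto
  then have "fin_gen R S" unfolding fin_gen_def S.submodule_iff
    using gen by (intro exI[of _ "i ` X \<union> j ` Y"]) simp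
  then show ?thesis using B(1) by (simp add: fg_module_def)
qed

text \<open>The external direct sum. The ring operations of the record carry no meaning.\<close>

definition prod_module :: "('a, 'b) module \<Rightarrow> ('a, 'c) module \<Rightarrow> ('a, 'b \<times> 'c) module" where
  "prod_module M N = \<lparr>carrier = carrier M \<times> carrier N, monoid.mult = undefined, one = undefined,
     ring.zero = (\<zero>\<^bsub>M\<^esub>, \<zero>\<^bsub>N\<^esub>), ring.add = (\<lambda>x y. (fst x \<oplus>\<^bsub>M\<^esub> fst y, snd x \<oplus>\<^bsub>N\<^esub> snd y)),
     smult = (\<lambda>a x. (a \<odot>\<^bsub>M\<^esub> fst x, a \<odot>\<^bsub>N\<^esub> snd x))\<rparr>"

lemma prod_module_biproduct:
  assumes "left_module R M" "left_module R N"
  shows "biproduct R (prod_module M N) M N (\<lambda>x. (x, \<zero>\<^bsub>N\<^esub>)) (\<lambda>y. (\<zero>\<^bsub>M\<^esub>, y)) fst snd"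
proof -
  interpret M: left_module R M by fact
  interpret N: left_module R N by fact
  let ?S = "prod_module M N"
  have sm: "carrier ?S = carrier M \<times> carrier N" "\<zero>\<^bsub>?S\<^esub> = (\<zero>\<^bsub>M\<^esub>, \<zero>\<^bsub>N\<^esub>)"
    "x \<oplus>\<^bsub>?S\<^esub> y = (fst x \<oplus>\<^bsub>M\<^esub> fst y, snd x \<oplus>\<^bsub>N\<^esub> snd y)"
    "a \<odot>\<^bsub>?S\<^esub> x = (a \<odot>\<^bsub>M\<^esub> fst x, a \<odot>\<^bsub>N\<^esub> snd x)" for x y a
    by (simp_all add: prod_module_def)
  have "abelian_group ?S"
  proof (rule abelian_groupI)
    fix x assume "x \<in> carrier ?S"
    then show "\<exists>y\<in>carrier ?S. y \<oplus>\<^bsub>?S\<^esub> x = \<zero>\<^bsub>?S\<^esub>"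
      by (intro bexI[of _ "(\<ominus>\<^bsub>M\<^esub> fst x, \<ominus>\<^bsub>N\<^esub> snd x)"]) (auto simp: sm M.M.l_neg N.M.l_neg)
  qed (auto simp: sm M.M.a_ac N.M.a_ac)
  then interpret S: abelian_group ?S .
  have "left_module R ?S"
    by (intro left_module.intro left_module_axioms.intro M.R.ring_axioms S.abelian_group_axioms)
       (auto simp: sm M.smult_l_distr M.smult_r_distr M.smult_assoc1
          N.smult_l_distr N.smult_r_distr N.smult_assoc1)
  then show ?thesis
    unfolding biproduct_def using assms
    by (auto simp: sm M.r_null N.r_null intro!: homI)
qed

lemma biproduct_transport:
  assumes b: "biproduct R S M N i j p q" and T: "left_module R T" and f: "inverse_homs R S T f g"
  shows "biproduct R T M N (\<lambda>x. f (i x)) (\<lambda>y. f (j y)) (\<lambda>z. p (g z)) (\<lambda>z. q (g z))"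
proof -
  note B = biproductD[OF b] and F = inverse_homsD[OF f]
  have cl: "i x \<in> carrier S" "j y \<in> carrier S" "g z \<in> carrier S"
    if "x \<in> carrier M" "y \<in> carrier N" "z \<in> carrier T" for x y z
    using that hom_closed[OF B(4)] hom_closed[OF B(5)] hom_closed[OF F(2)] by auto
  have "f (i (p (g z))) \<oplus>\<^bsub>T\<^esub> f (j (q (g z))) = z" if "z \<in> carrier T" for z
  proof -
    have gz: "g z \<in> carrier S" using hom_closed[OF F(2) that] .
    have "f (i (p (g z))) \<oplus>\<^bsub>T\<^esub> f (j (q (g z))) = f (i (p (g z)) \<oplus>\<^bsub>S\<^esub> j (q (g z)))"
      using hom_closed[OF B(6) gz] hom_closed[OF B(7) gz] hom_closed[OF B(4)] hom_closed[OF B(5)]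
      by (simp add: hom_add[OF F(1)])
    then show ?thesis using B(12)[OF gz] F(4)[OF that] by simp
  qed
  moreover have "p (g (f (i x))) = x" "q (g (f (i x))) = \<zero>\<^bsub>N\<^esub>" if "x \<in> carrier M" for x
    using that B(8,9)[OF that] F(3) hom_closed[OF B(4)] by simp_all
  moreover have "q (g (f (j y))) = y" "p (g (f (j y))) = \<zero>\<^bsub>M\<^esub>" if "y \<in> carrier N" for y
    using that B(10,11)[OF that] F(3) hom_closed[OF B(5)] by simp_all
  ultimately show ?thesis
    unfolding biproduct_def
    using B(2,3) T hom_comp[OF B(4) F(1)] hom_comp[OF B(5) F(1)] hom_comp[OF F(2) B(6)] hom_comp[OF F(2) B(7)]
    by simp
qed

lemma biproduct_exists:
  fixes R :: "('a, 'r) ring_scheme"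
  assumes "fg_module R M" "fg_module R N"
  shows "\<exists>(S :: 'a amod) i j p q. fg_module R S \<and> biproduct R S M N i j p q"
proof -
  note b = prod_module_biproduct[OF assms[THEN fg_moduleD]]
  obtain S :: "'a amod" and f g where S: "fg_module R S" "inverse_homs R (prod_module M N) S f g"
    using amod_representation[OF biproduct_fg[OF b assms]] by auto
  show ?thesis
    by (intro exI conjI) (rule S(1), rule biproduct_transport[OF b fg_moduleD[OF S(1)] S(2)])
qed

lemma internal_biproduct:
  assumes "left_module R M" "U \<in> submods R M" "V \<in> submods R M"
    and disj: "U \<inter> V = {\<zero>\<^bsub>M\<^esub>}" and gen: "U <+>\<^bsub>M\<^esub> V = carrier M"
  shows "\<exists>p q. biproduct R M (M\<lparr>carrier := U\<rparr>) (M\<lparr>carrier := V\<rparr>) (\<lambda>x. x) (\<lambda>x. x) p q"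
proof -
  interpret M: left_module R M by fact
  note DU = stable_subsD[OF assms(2)] and DV = stable_subsD[OF assms(3)]
  have m1: "\<ominus>\<^bsub>R\<^esub> \<one>\<^bsub>R\<^esub> \<in> carrier R" by simp
  have uniq: "u = u' \<and> v = v'"
    if h: "u \<in> U" "u' \<in> U" "v \<in> V" "v' \<in> V" "u \<oplus>\<^bsub>M\<^esub> v = u' \<oplus>\<^bsub>M\<^esub> v'" for u v u' v'
  proof -
    have c: "u \<in> carrier M" "u' \<in> carrier M" "v \<in> carrier M" "v' \<in> carrier M" using h DU DV by auto
    have "v' = (\<ominus>\<^bsub>M\<^esub> u') \<oplus>\<^bsub>M\<^esub> (u \<oplus>\<^bsub>M\<^esub> v)" unfolding h(5) using c by (simp add: M.M.r_neg1)
    also have "\<dots> = (u \<ominus>\<^bsub>M\<^esub> u') \<oplus>\<^bsub>M\<^esub> v" using c by (simp add: a_minus_def M.M.a_ac)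
    finally have "v' = (u \<ominus>\<^bsub>M\<^esub> u') \<oplus>\<^bsub>M\<^esub> v" .
    then have "u \<ominus>\<^bsub>M\<^esub> u' = v' \<ominus>\<^bsub>M\<^esub> v"
      using c by (simp add: a_minus_def M.M.a_assoc M.M.r_neg)
    moreover have "u \<ominus>\<^bsub>M\<^esub> u' \<in> U" "v' \<ominus>\<^bsub>M\<^esub> v \<in> V"
      using M.stable_subs_diff[OF assms(2) m1 h(1,2)] M.stable_subs_diff[OF assms(3) m1 h(4,3)] by auto
    ultimately have "u \<ominus>\<^bsub>M\<^esub> u' = \<zero>\<^bsub>M\<^esub>" "v' \<ominus>\<^bsub>M\<^esub> v = \<zero>\<^bsub>M\<^esub>" using disj by auto
    then show ?thesis using c by (simp add: M.M.diff_eq_zero)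
  qed
  define p where "p x = (SOME u. u \<in> U \<and> (\<exists>v\<in>V. x = u \<oplus>\<^bsub>M\<^esub> v))" for x
  define q where "q x = (SOME v. v \<in> V \<and> x = p x \<oplus>\<^bsub>M\<^esub> v)" for x
  have pq: "p x \<in> U" "q x \<in> V" "x = p x \<oplus>\<^bsub>M\<^esub> q x" if x: "x \<in> carrier M" for x
  proof -
    have "\<exists>u. u \<in> U \<and> (\<exists>v\<in>V. x = u \<oplus>\<^bsub>M\<^esub> v)" using x gen[symmetric] by (auto simp: set_add_def')
    from someI_ex[OF this] have p: "p x \<in> U" "\<exists>v. v \<in> V \<and> x = p x \<oplus>\<^bsub>M\<^esub> v" by (auto simp: p_def)
    from someI_ex[OF p(2)] p(1) show "p x \<in> U" "q x \<in> V" "x = p x \<oplus>\<^bsub>M\<^esub> q x" by (auto simp: q_def)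
  qed
  have eqI: "p x = u \<and> q x = v" if "x \<in> carrier M" "u \<in> U" "v \<in> V" "x = u \<oplus>\<^bsub>M\<^esub> v" for x u v
    using uniq[of "p x" u "q x" v] pq[OF that(1)] that by simp
  have padd: "p (x \<oplus>\<^bsub>M\<^esub> y) = p x \<oplus>\<^bsub>M\<^esub> p y \<and> q (x \<oplus>\<^bsub>M\<^esub> y) = q x \<oplus>\<^bsub>M\<^esub> q y"
    if xy: "x \<in> carrier M" "y \<in> carrier M" for x y
  proof (rule eqI)
    note X = pq[OF xy(1)] pq[OF xy(2)]
    have c: "p x \<in> carrier M" "q x \<in> carrier M" "p y \<in> carrier M" "q y \<in> carrier M"
      using X DU(2) DV(2) by auto
    have "x \<oplus>\<^bsub>M\<^esub> y = (p x \<oplus>\<^bsub>M\<^esub> q x) \<oplus>\<^bsub>M\<^esub> (p y \<oplus>\<^bsub>M\<^esub> q y)" using X(3,6) by simp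
    also have "\<dots> = (p x \<oplus>\<^bsub>M\<^esub> p y) \<oplus>\<^bsub>M\<^esub> (q x \<oplus>\<^bsub>M\<^esub> q y)" using c by (simp add: M.M.a_ac)
    finally show "x \<oplus>\<^bsub>M\<^esub> y = (p x \<oplus>\<^bsub>M\<^esub> p y) \<oplus>\<^bsub>M\<^esub> (q x \<oplus>\<^bsub>M\<^esub> q y)" .
  qed (use pq xy DU DV in auto)
  have psmult: "p (a \<odot>\<^bsub>M\<^esub> x) = a \<odot>\<^bsub>M\<^esub> p x \<and> q (a \<odot>\<^bsub>M\<^esub> x) = a \<odot>\<^bsub>M\<^esub> q x"
    if ax: "a \<in> carrier R" "x \<in> carrier M" for a x
  proof (rule eqI)
    note X = pq[OF ax(2)]
    have "a \<odot>\<^bsub>M\<^esub> x = a \<odot>\<^bsub>M\<^esub> (p x \<oplus>\<^bsub>M\<^esub> q x)" using X(3) by simp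
    also have "\<dots> = a \<odot>\<^bsub>M\<^esub> p x \<oplus>\<^bsub>M\<^esub> a \<odot>\<^bsub>M\<^esub> q x"
      by (rule M.smult_r_distr) (use X ax DU(2) DV(2) in auto)
    finally show "a \<odot>\<^bsub>M\<^esub> x = a \<odot>\<^bsub>M\<^esub> p x \<oplus>\<^bsub>M\<^esub> a \<odot>\<^bsub>M\<^esub> q x" .
  qed (use pq ax DU DV in auto)
  have "p x = x \<and> q x = \<zero>\<^bsub>M\<^esub>" if "x \<in> U" for x by (rule eqI) (use that DU DV in auto)
  moreover have "p x = \<zero>\<^bsub>M\<^esub> \<and> q x = x" if "x \<in> V" for x by (rule eqI) (use that DU DV in auto)
  moreover have "p \<in> lmod_hom R M (M\<lparr>carrier := U\<rparr>)" "q \<in> lmod_hom R M (M\<lparr>carrier := V\<rparr>)"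
    by (rule homI; simp add: pq padd psmult)+
  ultimately have "biproduct R M (M\<lparr>carrier := U\<rparr>) (M\<lparr>carrier := V\<rparr>) (\<lambda>x. x) (\<lambda>x. x) p q"
    unfolding biproduct_def using pq(3) DU(1) DV(1)
    by (simp add: hom_incl M.left_module_axioms M.sub_left_module assms(2,3))
  then show ?thesis by blast
qed

text \<open>Decompositions into indecomposable modules are only used in the form of this induction. Their
  uniqueness plays no role.\<close>

lemma decomposition_induct:
  fixes M :: "('a, 'b) module"
  assumes fg: "fg_module R M" and h: "height_le (submods R M) n"
    and zero: "\<And>N :: ('a, 'b) module. fg_module R N \<Longrightarrow> carrier N = {\<zero>\<^bsub>N\<^esub>} \<Longrightarrow> Q N"
    and indec: "\<And>N :: ('a, 'b) module. fg_module R N \<Longrightarrow> indecomposable R N \<Longrightarrow> Q N"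
    and sum: "\<And>(N :: ('a, 'b) module) U V p q. fg_module R N \<Longrightarrow>
      biproduct R N (N\<lparr>carrier := U\<rparr>) (N\<lparr>carrier := V\<rparr>) (\<lambda>x. x) (\<lambda>x. x) p q \<Longrightarrow>
      fg_module R (N\<lparr>carrier := U\<rparr>) \<Longrightarrow> fg_module R (N\<lparr>carrier := V\<rparr>) \<Longrightarrow>
      Q (N\<lparr>carrier := U\<rparr>) \<Longrightarrow> Q (N\<lparr>carrier := V\<rparr>) \<Longrightarrow> Q N"
  shows "Q M"
proof -
  interpret M: left_module R M using fg by (rule fg_moduleD)
  obtain d :: "'b set \<Rightarrow> nat" where
    d: "\<And>V. V \<in> submods R M \<Longrightarrow> d V \<le> n"
       "\<And>V W. V \<in> submods R M \<Longrightarrow> W \<in> submods R M \<Longrightarrow> V \<subset> W \<Longrightarrow> d V < d W"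
    by (rule height_leE[OF h]) blast
  have "Q (M\<lparr>carrier := W\<rparr>)" if "W \<in> submods R M" for W
    using that
  proof (induction "d W" arbitrary: W rule: less_induct)
    case (less W)
    let ?N = "M\<lparr>carrier := W\<rparr>"
    note DW = stable_subsD[OF less.prems]
    interpret N: left_module R ?N by (rule M.sub_left_module[OF less.prems])
    have fgN: "fg_module R ?N" by (rule fg_submodule[OF fg h less.prems])
    consider "carrier ?N = {\<zero>\<^bsub>?N\<^esub>}" | "indecomposable R ?N"
      | U V where "U \<in> submods R ?N" "V \<in> submods R ?N" "U \<inter> V = {\<zero>\<^bsub>?N\<^esub>}" "U <+>\<^bsub>?N\<^esub> V = carrier ?N"
        "U \<noteq> {\<zero>\<^bsub>?N\<^esub>}" "V \<noteq> {\<zero>\<^bsub>?N\<^esub>}"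
      unfolding indecomposable_def N.submodule_iff by blast
    then show ?case
    proof cases
      case 1 then show ?thesis by (rule zero[OF fgN])
    next
      case 2 then show ?thesis by (rule indec[OF fgN])
    next
      case (3 U V)
      have UV: "U \<in> submods R M" "U \<subseteq> W" "V \<in> submods R M" "V \<subseteq> W"
        using 3(1,2) stable_subs_sub_iff[OF DW(1)] by auto
      have "U \<noteq> W" using 3(3,6) UV by auto
      moreover have "V \<noteq> W" using 3(3,5) UV by auto
      ultimately have "d U < d W" "d V < d W" using d(2) UV less.prems by auto
      then have Q: "Q (M\<lparr>carrier := U\<rparr>)" "Q (M\<lparr>carrier := V\<rparr>)" using less.hyps UV by auto
      obtain p q where pq: "biproduct R ?N (?N\<lparr>carrier := U\<rparr>) (?N\<lparr>carrier := V\<rparr>) (\<lambda>x. x) (\<lambda>x. x) p q"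
        using internal_biproduct[OF N.left_module_axioms 3(1-4)] by auto
      show ?thesis
        by (rule sum[OF fgN pq]) (use Q fg_submodule[OF fg h] UV in simp_all)
    qed
  qed
  from this[OF M.stable_subs_carrier[OF subset_refl]] show ?thesis by simp
qed

section \<open>Projective modules and projective dimension\<close>

lemma projective_fg: "projective_module A P \<Longrightarrow> fg_module A P"
  by (simp add: projective_module_def)

lemma projective_lift:
  fixes P M N :: "'a amod"
  assumes "projective_module A P" "fg_module A M" "fg_module A N"
    "g \<in> lmod_hom A M N" "g ` carrier M = carrier N" "f \<in> lmod_hom A P N"
  shows "\<exists>h\<in>lmod_hom A P M. \<forall>x\<in>carrier P. g (h x) = f x"
  using assms(1)[unfolded projective_module_def, THEN conjunct2, rule_format, of M N g f] assms(2-) by simp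

lemma projectiveI:
  fixes P :: "'a amod"
  assumes "fg_module A P"
    and "\<And>(M :: 'a amod) (N :: 'a amod) g f. fg_module A M \<Longrightarrow> fg_module A N \<Longrightarrow> g \<in> lmod_hom A M N \<Longrightarrow>
      g ` carrier M = carrier N \<Longrightarrow> f \<in> lmod_hom A P N \<Longrightarrow>
      \<exists>h\<in>lmod_hom A P M. \<forall>x\<in>carrier P. g (h x) = f x"
  shows "projective_module A P"
  unfolding projective_module_def using assms(1) by (intro conjI allI impI; (elim conjE)?) (assumption, rule assms(2))

lemma projective_retract:
  fixes P Q :: "'a amod"
  assumes P: "projective_module A P" and Q: "fg_module A Q"
    and i: "i \<in> lmod_hom A Q P" and r: "r \<in> lmod_hom A P Q" "\<And>x. x \<in> carrier Q \<Longrightarrow> r (i x) = x"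
  shows "projective_module A Q"
proof (rule projectiveI[OF Q])
  fix M N :: "'a amod" and g f
  assume h: "fg_module A M" "fg_module A N" "g \<in> lmod_hom A M N" "g ` carrier M = carrier N"
    and f: "f \<in> lmod_hom A Q N"
  obtain u where u: "u \<in> lmod_hom A P M" "\<forall>x\<in>carrier P. g (u x) = f (r x)"
    using projective_lift[OF P h hom_comp[OF r(1) f]] by auto
  show "\<exists>h\<in>lmod_hom A Q M. \<forall>x\<in>carrier Q. g (h x) = f x"
    by (rule bexI[OF _ hom_comp[OF i u(1)]]) (use u(2) r(2) hom_closed[OF i] in simp)
qed

lemma hom_copair:
  assumes "biproduct R S M N i j p q" "left_module R X" "f \<in> lmod_hom R M X" "g \<in> lmod_hom R N X"
  shows "(\<lambda>z. f (p z) \<oplus>\<^bsub>X\<^esub> g (q z)) \<in> lmod_hom R S X"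
  by (rule hom_plus[OF assms(2) hom_comp[OF biproductD(6)[OF assms(1)] assms(3)]
        hom_comp[OF biproductD(7)[OF assms(1)] assms(4)]])

lemma hom_copair_inj:
  assumes b: "biproduct R S M N i j p q" "left_module R X" "f \<in> lmod_hom R M X" "g \<in> lmod_hom R N X"
  shows "x \<in> carrier M \<Longrightarrow> f (p (i x)) \<oplus>\<^bsub>X\<^esub> g (q (i x)) = f x"
    "y \<in> carrier N \<Longrightarrow> f (p (j y)) \<oplus>\<^bsub>X\<^esub> g (q (j y)) = g y"
proof -
  note B = biproductD[OF b(1)]
  interpret X: left_module R X by fact
  show "x \<in> carrier M \<Longrightarrow> f (p (i x)) \<oplus>\<^bsub>X\<^esub> g (q (i x)) = f x"
    using hom_closed[OF b(3)] by (simp add: B(8,9) hom_zero[OF B(3) b(2,4)])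
  show "y \<in> carrier N \<Longrightarrow> f (p (j y)) \<oplus>\<^bsub>X\<^esub> g (q (j y)) = g y"
    using hom_closed[OF b(4)] by (simp add: B(10,11) hom_zero[OF B(2) b(2,3)])
qed

lemma projective_biproduct:
  fixes S P P' :: "'a amod"
  assumes b: "biproduct A S P P' i j p q" and P: "projective_module A P" "projective_module A P'"
  shows "projective_module A S"
proof (rule projectiveI)
  note B = biproductD[OF b]
  show "fg_module A S" by (rule biproduct_fg[OF b]) (use P projective_fg in auto)
  fix M N :: "'a amod" and g f
  assume h: "fg_module A M" "fg_module A N" "g \<in> lmod_hom A M N" "g ` carrier M = carrier N"
    and f: "f \<in> lmod_hom A S N"
  obtain u where u: "u \<in> lmod_hom A P M" "\<forall>x\<in>carrier P. g (u x) = f (i x)"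
    using projective_lift[OF P(1) h hom_comp[OF B(4) f]] by auto
  obtain v where v: "v \<in> lmod_hom A P' M" "\<forall>x\<in>carrier P'. g (v x) = f (j x)"
    using projective_lift[OF P(2) h hom_comp[OF B(5) f]] by auto
  show "\<exists>h\<in>lmod_hom A S M. \<forall>x\<in>carrier S. g (h x) = f x"
  proof (rule bexI[OF _ hom_copair[OF b fg_moduleD[OF h(1)] u(1) v(1)]], rule ballI)
    fix z assume z: "z \<in> carrier S"
    note c = hom_closed[OF B(6) z] hom_closed[OF B(7) z]
    have "g (u (p z) \<oplus>\<^bsub>M\<^esub> v (q z)) = f (i (p z)) \<oplus>\<^bsub>N\<^esub> f (j (q z))"
      using hom_closed[OF u(1) c(1)] hom_closed[OF v(1) c(2)] u(2) v(2) c by (simp add: hom_add[OF h(3)])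
    also have "\<dots> = f (i (p z) \<oplus>\<^bsub>S\<^esub> j (q z))"
      using hom_closed[OF B(4) c(1)] hom_closed[OF B(5) c(2)] by (simp add: hom_add[OF f])
    finally show "g (u (p z) \<oplus>\<^bsub>M\<^esub> v (q z)) = f z" using B(12)[OF z] by simp
  qed
qed

lemma (in ring) regular_fg: "fg_module R (regular_module R)"
proof -
  interpret M: left_module R "regular_module R" by (rule regular_left_module)
  have "V = carrier R" if V: "V \<in> submods R (regular_module R)" "{\<one>} \<subseteq> V" for V
  proof -
    note D = stable_subsD[OF V(1), simplified]
    have "x \<in> V" if "x \<in> carrier R" for x using D(5)[OF that, of \<one>] V(2) that by simp
    then show ?thesis using D(1) by auto
  qed
  then have "fin_gen R (regular_module R)"
    unfolding fin_gen_def M.submodule_iff by (intro exI[of _ "{\<one>}"]) simp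
  then show ?thesis by (simp add: fg_module_def M.left_module_axioms)
qed

lemma (in left_module) hom_from_regular:
  "x \<in> carrier M \<Longrightarrow> (\<lambda>a. a \<odot>\<^bsub>M\<^esub> x) \<in> lmod_hom R (regular_module R) M"
  by (rule homI) (auto simp: smult_l_distr smult_assoc1)

lemma projective_regular:
  fixes P :: "'a amod"
  assumes P: "fg_module A P" and f: "inverse_homs A (regular_module A) P f g"
  shows "projective_module A P"
proof (rule projectiveI[OF P])
  interpret P: left_module A P using P by (rule fg_moduleD)
  note F = inverse_homsD[OF f]
  have f1: "f \<one>\<^bsub>A\<^esub> \<in> carrier P" using hom_closed[OF F(1)] by simp
  fix M N :: "'a amod" and e u
  assume h: "fg_module A M" "fg_module A N" "e \<in> lmod_hom A M N" "e ` carrier M = carrier N"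
    and u: "u \<in> lmod_hom A P N"
  interpret M: left_module A M using h(1) by (rule fg_moduleD)
  have "u (f \<one>\<^bsub>A\<^esub>) \<in> e ` carrier M" using hom_closed[OF u f1] h(4) by simp
  then obtain m where m: "m \<in> carrier M" "e m = u (f \<one>\<^bsub>A\<^esub>)" by auto
  show "\<exists>h\<in>lmod_hom A P M. \<forall>x\<in>carrier P. e (h x) = u x"
  proof (rule bexI[OF _ hom_comp[OF F(2) M.hom_from_regular[OF m(1)]]], rule ballI)
    fix x assume x: "x \<in> carrier P"
    have gx: "g x \<in> carrier A" using hom_closed[OF F(2) x] by simp
    have "e (g x \<odot>\<^bsub>M\<^esub> m) = g x \<odot>\<^bsub>N\<^esub> u (f \<one>\<^bsub>A\<^esub>)" using gx m by (simp add: hom_smult[OF h(3)])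
    also have "\<dots> = u (f (g x \<otimes>\<^bsub>A\<^esub> \<one>\<^bsub>A\<^esub>))"
      using gx f1 hom_smult[OF u gx f1] hom_smult[OF F(1) gx, of "\<one>\<^bsub>A\<^esub>"] by simp
    finally show "e (g x \<odot>\<^bsub>M\<^esub> m) = u x" using gx F(4)[OF x] by simp
  qed
qed

text \<open>The homomorphisms from \<open>M\<close> to members of \<open>C\<close> separate the elements of \<open>M\<close> from \<open>0\<close>.\<close>

definition cogenerated :: "('a, 'r) ring_scheme \<Rightarrow> ('a, 'c) module set \<Rightarrow> ('a, 'b) module \<Rightarrow> bool" where
  "cogenerated A C M \<longleftrightarrow>
     (\<forall>x\<in>carrier M. x \<noteq> \<zero>\<^bsub>M\<^esub> \<longrightarrow> (\<exists>F\<in>C. \<exists>h\<in>lmod_hom A M F. h x \<noteq> \<zero>\<^bsub>F\<^esub>))"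

lemma cogeneratedD:
  "cogenerated A C M \<Longrightarrow> x \<in> carrier M \<Longrightarrow> x \<noteq> \<zero>\<^bsub>M\<^esub> \<Longrightarrow>
     \<exists>F\<in>C. \<exists>h\<in>lmod_hom A M F. h x \<noteq> \<zero>\<^bsub>F\<^esub>"
  by (simp add: cogenerated_def)

lemma cogenerated_inj:
  assumes "left_module A M" "left_module A N" "f \<in> lmod_hom A M N" "inj_on f (carrier M)" "cogenerated A C N"
  shows "cogenerated A C M"
  unfolding cogenerated_def
proof (intro ballI impI)
  fix x assume x: "x \<in> carrier M" "x \<noteq> \<zero>\<^bsub>M\<^esub>"
  have "f x \<noteq> \<zero>\<^bsub>N\<^esub>" using assms(4) x hom_inj_iff[OF assms(1-3)] by auto
  then obtain F h where h: "F \<in> C" "h \<in> lmod_hom A N F" "h (f x) \<noteq> \<zero>\<^bsub>F\<^esub>"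
    using assms(5) hom_closed[OF assms(3) x(1)] unfolding cogenerated_def by auto
  show "\<exists>F\<in>C. \<exists>h\<in>lmod_hom A M F. h x \<noteq> \<zero>\<^bsub>F\<^esub>"
    using h hom_comp[OF assms(3) h(2)] by (intro bexI[of _ F] bexI[of _ "\<lambda>x. h (f x)"])
qed

lemma cogenerated_biproduct:
  assumes b: "biproduct A S M N i j p q" and C: "cogenerated A C M" "cogenerated A C N"
  shows "cogenerated A C S"
  unfolding cogenerated_def
proof (intro ballI impI)
  note B = biproductD[OF b]
  interpret S: left_module A S by (rule B(1))
  fix z assume z: "z \<in> carrier S" "z \<noteq> \<zero>\<^bsub>S\<^esub>"
  note c = hom_closed[OF B(6) z(1)] hom_closed[OF B(7) z(1)]
  consider "p z \<noteq> \<zero>\<^bsub>M\<^esub>" | "q z \<noteq> \<zero>\<^bsub>N\<^esub>"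
    using B(12)[OF z(1)] z(2) hom_zero[OF B(2,1,4)] hom_zero[OF B(3,1,5)] by force
  then show "\<exists>F\<in>C. \<exists>h\<in>lmod_hom A S F. h z \<noteq> \<zero>\<^bsub>F\<^esub>"
  proof cases
    case 1
    then obtain F h where h: "F \<in> C" "h \<in> lmod_hom A M F" "h (p z) \<noteq> \<zero>\<^bsub>F\<^esub>"
      using C(1) c unfolding cogenerated_def by auto
    show ?thesis using h hom_comp[OF B(6) h(2)] by (intro bexI[of _ F] bexI[of _ "\<lambda>x. h (p x)"])
  next
    case 2
    then obtain F h where h: "F \<in> C" "h \<in> lmod_hom A N F" "h (q z) \<noteq> \<zero>\<^bsub>F\<^esub>"
      using C(2) c unfolding cogenerated_def by auto
    show ?thesis using h hom_comp[OF B(7) h(2)] by (intro bexI[of _ F] bexI[of _ "\<lambda>x. h (q x)"])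
  qed
qed

text \<open>A nonzero element of the ring has a nonzero component in one of the summands.\<close>

lemma in_add_cogenerated:
  assumes "ring A" and C: "\<And>F. F \<in> C \<Longrightarrow> left_module A F" and add: "in_add A C (regular_module A)"
  shows "cogenerated A C (regular_module A)"
  unfolding cogenerated_def
proof (intro ballI impI)
  interpret ring A by fact
  let ?M = "regular_module A"
  note M = regular_left_module
  interpret M: left_module A ?M by (rule M)
  fix x assume x: "x \<in> carrier ?M" "x \<noteq> \<zero>\<^bsub>?M\<^esub>"
  obtain n F f where F: "\<forall>i<n. F i \<in> C" and f: "f \<in> lmod_hom A ?M (direct_sum n F)"
    "bij_betw f (carrier ?M) (carrier (direct_sum n F))"
    using add unfolding in_add_def lmod_iso_def by (elim exE conjE bexE)
  have comp: "(\<lambda>x. f x i) \<in> lmod_hom A ?M (F i)" if "i < n" for i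
  proof (rule homI)
    show "f x i \<in> carrier (F i)" if "x \<in> carrier ?M" for x
      using hom_closed[OF f(1) that] \<open>i < n\<close> by (auto simp: direct_sum_def)
    show "f (x \<oplus>\<^bsub>?M\<^esub> y) i = f x i \<oplus>\<^bsub>F i\<^esub> f y i" if "x \<in> carrier ?M" "y \<in> carrier ?M" for x y
      using hom_add[OF f(1) that] \<open>i < n\<close> by (simp add: direct_sum_def)
    show "f (a \<odot>\<^bsub>?M\<^esub> x) i = a \<odot>\<^bsub>F i\<^esub> f x i" if "a \<in> carrier A" "x \<in> carrier ?M" for a x
      using hom_smult[OF f(1) that] \<open>i < n\<close> by (simp add: direct_sum_def)
  qed
  have zero: "f \<zero>\<^bsub>?M\<^esub> i = \<zero>\<^bsub>F i\<^esub>" if "i < n" for i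
    using hom_zero[OF M C comp[OF that]] F that by simp
  have "\<exists>i<n. f x i \<noteq> \<zero>\<^bsub>F i\<^esub>"
  proof (rule ccontr)
    assume "\<not> ?thesis"
    then have "f x i = f \<zero>\<^bsub>?M\<^esub> i" if "i < n" for i using zero that by auto
    moreover have "f x \<in> (\<Pi>\<^sub>E i\<in>{..<n}. carrier (F i))" "f \<zero>\<^bsub>?M\<^esub> \<in> (\<Pi>\<^sub>E i\<in>{..<n}. carrier (F i))"
      using hom_closed[OF f(1) x(1)] hom_closed[OF f(1) M.M.zero_closed] by (simp_all add: direct_sum_def)
    ultimately have "f x = f \<zero>\<^bsub>?M\<^esub>" by (intro PiE_ext) auto
    then show False using f(2) x M.M.zero_closed unfolding bij_betw_def inj_on_def by blast
  qed
  then show "\<exists>F\<in>C. \<exists>h\<in>lmod_hom A ?M F. h x \<noteq> \<zero>\<^bsub>F\<^esub>"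
    using F comp by (elim exE conjE) (intro bexI, auto)
qed

text \<open>Besides being an image of a projective module, it matters that the projective module is a direct
  sum of copies of the ring and hence cogenerated by whatever cogenerates the ring.\<close>

lemma enough_projectives:
  fixes A :: "('a, 'r) ring_scheme" and L :: "'a amod"
  assumes A: "cogenerated A C (regular_module A)" and L: "fg_module A L"
  shows "\<exists>(P :: 'a amod) f. projective_module A P \<and> cogenerated A C P \<and>
    f \<in> lmod_hom A P L \<and> f ` carrier P = carrier L"
proof -
  interpret L: left_module A L using L by (rule fg_moduleD)
  obtain A' :: "'a amod" and e e' where A': "fg_module A A'" "inverse_homs A (regular_module A) A' e e'"
    using amod_representation[OF L.R.regular_fg] by auto
  note E = inverse_homsD[OF A'(2)]
  have pA': "projective_module A A'" by (rule projective_regular[OF A'])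
  have cA': "cogenerated A C A'"
    by (rule cogenerated_inj[OF fg_moduleD[OF A'(1)] L.R.regular_left_module E(2)
          inverse_homs_inj[OF inverse_homs_sym[OF A'(2)]] A])
  have "\<exists>(P :: 'a amod) f. projective_module A P \<and> cogenerated A C P \<and> f \<in> lmod_hom A P L \<and> S \<subseteq> f ` carrier P"
    if "finite S" "S \<subseteq> carrier L" for S
    using that
  proof (induction S)
    case empty
    show ?case using pA' cA' hom_null[OF L.left_module_axioms] by auto
  next
    case (insert s S)
    then obtain P :: "'a amod" and f where P: "projective_module A P" "cogenerated A C P"
        "f \<in> lmod_hom A P L" "S \<subseteq> f ` carrier P" by auto
    have s: "s \<in> carrier L" using insert.prems by simp
    obtain Q :: "'a amod" and i j p q where Q: "fg_module A Q" "biproduct A Q P A' i j p q"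
      using biproduct_exists[OF projective_fg[OF P(1)] A'(1)] by auto
    note B = biproductD[OF Q(2)]
    have g: "(\<lambda>x. e' x \<odot>\<^bsub>L\<^esub> s) \<in> lmod_hom A A' L" by (rule hom_comp[OF E(2) L.hom_from_regular[OF s]])
    let ?h = "\<lambda>z. f (p z) \<oplus>\<^bsub>L\<^esub> e' (q z) \<odot>\<^bsub>L\<^esub> s"
    have h: "?h \<in> lmod_hom A Q L" by (rule hom_copair[OF Q(2) L.left_module_axioms P(3) g])
    note hi = hom_copair_inj[OF Q(2) L.left_module_axioms P(3) g]
    have "S \<subseteq> ?h ` carrier Q"
    proof
      fix y assume "y \<in> S"
      then obtain x where x: "x \<in> carrier P" "y = f x" using P(4) by auto
      then show "y \<in> ?h ` carrier Q"
        using hi(1)[OF x(1)] hom_closed[OF B(4) x(1)] by (intro image_eqI[of _ _ "i x"]) simp_all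
    qed
    moreover have "s \<in> ?h ` carrier Q"
    proof (rule image_eqI[of _ _ "j (e \<one>\<^bsub>A\<^esub>)"])
      have e1: "e \<one>\<^bsub>A\<^esub> \<in> carrier A'" using hom_closed[OF E(1)] by simp
      then show "j (e \<one>\<^bsub>A\<^esub>) \<in> carrier Q" by (rule hom_closed[OF B(5)])
      show "s = ?h (j (e \<one>\<^bsub>A\<^esub>))" using hi(2)[OF e1] E(3)[of "\<one>\<^bsub>A\<^esub>"] s by simp
    qed
    ultimately have "insert s S \<subseteq> ?h ` carrier Q" by simp
    then show ?case
      using projective_biproduct[OF Q(2) P(1) pA'] cogenerated_biproduct[OF Q(2) P(2) cA'] h by blast
  qed
  moreover obtain S where S: "finite S" "S \<subseteq> carrier L" "\<And>U. U \<in> submods A L \<Longrightarrow> S \<subseteq> U \<Longrightarrow> U = carrier L"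
    by (rule fg_generators[OF L]) blast
  ultimately obtain P :: "'a amod" and f where P: "projective_module A P" "cogenerated A C P"
      "f \<in> lmod_hom A P L" "S \<subseteq> f ` carrier P" by metis
  interpret P: left_module A P using P(1) by (intro fg_moduleD projective_fg)
  have "f ` carrier P \<in> submods A L"
    by (rule stable_subs_image[OF P.left_module_axioms L.left_module_axioms P(3)
          P.stable_subs_carrier[OF subset_refl] subset_refl])
  then have "f ` carrier P = carrier L" using S(3) P(4) by simp
  then show ?thesis using P by auto
qed

text \<open>\<open>pd_le A n L\<close> states that \<open>L\<close> has projective dimension at most \<open>n\<close>; the resolution is cut into its
  first step and a resolution of the syzygy, so that inductions on \<open>n\<close> go through.\<close>

primrec pd_le :: "('a, 'r) ring_scheme \<Rightarrow> nat \<Rightarrow> 'a amod \<Rightarrow> bool" where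
  "pd_le A 0 L = projective_module A L"
| "pd_le A (Suc n) L = (\<exists>(P :: 'a amod) f. projective_module A P \<and> f \<in> lmod_hom A P L \<and>
     f ` carrier P = carrier L \<and> pd_le A n (P\<lparr>carrier := lmod_ker P L f\<rparr>))"

lemma pd_le_SucI:
  fixes P L :: "'a amod"
  assumes "projective_module A P" "f \<in> lmod_hom A P L" "f ` carrier P = carrier L"
    "pd_le A n (P\<lparr>carrier := lmod_ker P L f\<rparr>)"
  shows "pd_le A (Suc n) L"
  unfolding pd_le.simps by (intro exI[of _ P] exI[of _ f] conjI assms)

lemma pd_le_iso:
  fixes L L' :: "'a amod"
  assumes pd: "pd_le A n L" and L: "left_module A L" "left_module A L'" and f: "inverse_homs A L L' f g"
  shows "pd_le A n L'"
proof (cases n)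
  case 0
  then have P: "projective_module A L" using pd by simp
  note F = inverse_homsD[OF f]
  have "fg_module A L'"
    by (rule fg_image[OF projective_fg[OF P] L(2) F(1) inverse_homs_onto[OF f]])
  then show ?thesis using projective_retract[OF P _ F(2,1)] F(4) 0 by simp
next
  case (Suc k)
  note F = inverse_homsD[OF f]
  obtain P :: "'a amod" and h where P: "projective_module A P" "h \<in> lmod_hom A P L"
    "h ` carrier P = carrier L" "pd_le A k (P\<lparr>carrier := lmod_ker P L h\<rparr>)"
    using pd Suc by auto
  have "lmod_ker P L' (\<lambda>x. f (h x)) = lmod_ker P L h"
  proof -
    have "f y = \<zero>\<^bsub>L'\<^esub> \<longleftrightarrow> y = \<zero>\<^bsub>L\<^esub>" if "y \<in> carrier L" for y
      using hom_inj_iff[OF L F(1)] inverse_homs_inj[OF f] hom_zero[OF L F(1)] that by auto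
    then show ?thesis using hom_closed[OF P(2)] by (auto simp: lmod_ker_def)
  qed
  moreover have "(\<lambda>x. f (h x)) ` carrier P = carrier L'"
    using P(3) inverse_homs_onto[OF f] by (metis image_image)
  ultimately show ?thesis
    unfolding Suc using P(1,4) hom_comp[OF P(2) F(1)] by (intro pd_le_SucI[of _ P "\<lambda>x. f (h x)"]) simp_all
qed

lemma pd_le_Suc:
  assumes "pd_le A n L"
  shows "pd_le A (Suc n) L"
  using assms
proof (induction n arbitrary: L)
  case 0
  then have P: "projective_module A L" by simp
  interpret L: left_module A L using P by (intro fg_moduleD projective_fg)
  have Z: "{\<zero>\<^bsub>L\<^esub>} \<in> submods A L" by (rule L.stable_subs_zero[OF subset_refl])
  let ?Z = "L\<lparr>carrier := {\<zero>\<^bsub>L\<^esub>}\<rparr>"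
  interpret Z: left_module A ?Z by (rule L.sub_left_module[OF Z])
  have r: "(\<lambda>x. \<zero>\<^bsub>?Z\<^esub>) \<in> lmod_hom A L ?Z" by (rule hom_null[OF Z.left_module_axioms])
  have "fg_module A ?Z"
    by (rule fg_image[OF projective_fg[OF P] Z.left_module_axioms r]) (use L.M.zero_closed in auto)
  then have "projective_module A ?Z"
    by (rule projective_retract[OF P _ hom_incl r]) simp_all
  moreover have "lmod_ker L L (\<lambda>x. x) = {\<zero>\<^bsub>L\<^esub>}" by (auto simp: lmod_ker_def)
  ultimately show ?case using P hom_id[of A L] by (intro pd_le_SucI[of _ L "\<lambda>x. x"]) simp_all
next
  case (Suc n)
  then obtain P :: "'a amod" and h where P: "projective_module A P" "h \<in> lmod_hom A P L"
    "h ` carrier P = carrier L" "pd_le A n (P\<lparr>carrier := lmod_ker P L h\<rparr>)" by auto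
  show ?case by (rule pd_le_SucI[OF P(1-3) Suc.IH[OF P(4)]])
qed

lemma pd_le_mono: "pd_le A n L \<Longrightarrow> n \<le> n' \<Longrightarrow> pd_le A n' L"
  by (induction n') (auto simp del: pd_le.simps simp: le_Suc_eq intro: pd_le_Suc)

lemma pd_le_biproduct:
  fixes S M N :: "'a amod"
  assumes "biproduct A S M N i j p q" "pd_le A n M" "pd_le A n N"
  shows "pd_le A n S"
  using assms
proof (induction n arbitrary: S M N i j p q)
  case 0
  then show ?case using projective_biproduct by auto
next
  case (Suc n)
  note B = biproductD[OF Suc.prems(1)]
  obtain P :: "'a amod" and f where P: "projective_module A P" "f \<in> lmod_hom A P M"
    "f ` carrier P = carrier M" "pd_le A n (P\<lparr>carrier := lmod_ker P M f\<rparr>)" using Suc.prems(2) by auto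
  obtain Q :: "'a amod" and g where Q: "projective_module A Q" "g \<in> lmod_hom A Q N"
    "g ` carrier Q = carrier N" "pd_le A n (Q\<lparr>carrier := lmod_ker Q N g\<rparr>)" using Suc.prems(3) by auto
  obtain T :: "'a amod" and a b c d where T: "fg_module A T" "biproduct A T P Q a b c d"
    using biproduct_exists[OF P(1)[THEN projective_fg] Q(1)[THEN projective_fg]] by auto
  note D = biproductD[OF T(2)]
  interpret S: left_module A S by (rule B(1))
  interpret T: left_module A T by (rule D(1))
  interpret P: left_module A P by (rule D(2))
  interpret Q: left_module A Q by (rule D(3))
  have fi: "(\<lambda>x. i (f x)) \<in> lmod_hom A P S" by (rule hom_comp[OF P(2) B(4)])
  have gj: "(\<lambda>x. j (g x)) \<in> lmod_hom A Q S" by (rule hom_comp[OF Q(2) B(5)])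
  let ?h = "\<lambda>z. i (f (c z)) \<oplus>\<^bsub>S\<^esub> j (g (d z))"
  have h: "?h \<in> lmod_hom A T S" by (rule hom_copair[OF T(2) B(1) fi gj])
  note hi = hom_copair_inj[OF T(2) B(1) fi gj]
  have onto: "?h ` carrier T = carrier S"
  proof (intro equalityI subsetI)
    fix z assume z: "z \<in> carrier S"
    have "p z \<in> f ` carrier P" "q z \<in> g ` carrier Q"
      unfolding P(3) Q(3) using hom_closed[OF B(6) z] hom_closed[OF B(7) z] by simp_all
    then obtain x y where xy: "x \<in> carrier P" "f x = p z" "y \<in> carrier Q" "g y = q z"
      by (elim imageE) simp
    have ab: "a x \<in> carrier T" "b y \<in> carrier T" using xy hom_closed[OF D(4)] hom_closed[OF D(5)] by auto
    have "?h (a x \<oplus>\<^bsub>T\<^esub> b y) = z" using hom_add[OF h ab] hi(1)[OF xy(1)] hi(2)[OF xy(3)] xy B(12)[OF z] by simp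
    then show "z \<in> ?h ` carrier T" using ab by (intro image_eqI[of _ _ "a x \<oplus>\<^bsub>T\<^esub> b y"]) simp_all
  qed (use hom_closed[OF h] in auto)
  have ker: "?h z = \<zero>\<^bsub>S\<^esub> \<longleftrightarrow> f (c z) = \<zero>\<^bsub>M\<^esub> \<and> g (d z) = \<zero>\<^bsub>N\<^esub>" if z: "z \<in> carrier T" for z
  proof
    have cl: "f (c z) \<in> carrier M" "g (d z) \<in> carrier N"
      using hom_closed[OF P(2) hom_closed[OF D(6) z]] hom_closed[OF Q(2) hom_closed[OF D(7) z]] by auto
    assume *: "?h z = \<zero>\<^bsub>S\<^esub>"
    have "p (?h z) = f (c z)" "q (?h z) = g (d z)"
      using cl hom_closed[OF B(4) cl(1)] hom_closed[OF B(5) cl(2)] B(8-11)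
        hom_closed[OF P(2) hom_closed[OF D(6) z]] left_module.axioms(2)[OF B(2)] left_module.axioms(2)[OF B(3)]
      by (simp_all add: hom_add[OF B(6)] hom_add[OF B(7)] abelian_group.r_neg abelian_monoid.r_zero
          abelian_monoid.l_zero abelian_group_def)
    then show "f (c z) = \<zero>\<^bsub>M\<^esub> \<and> g (d z) = \<zero>\<^bsub>N\<^esub>"
      using * hom_zero[OF B(1,2,6)] hom_zero[OF B(1,3,7)] by simp
  next
    assume "f (c z) = \<zero>\<^bsub>M\<^esub> \<and> g (d z) = \<zero>\<^bsub>N\<^esub>"
    then show "?h z = \<zero>\<^bsub>S\<^esub>" by (simp add: hom_zero[OF B(2,1,4)] hom_zero[OF B(3,1,5)])
  qed
  let ?K = "lmod_ker T S ?h" and ?KP = "lmod_ker P M f" and ?KQ = "lmod_ker Q N g"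
  have K: "?K \<in> submods A T" "?KP \<in> submods A P" "?KQ \<in> submods A Q"
    using hom_ker_submods[OF D(1) B(1) h] hom_ker_submods[OF D(2) B(2) P(2)] hom_ker_submods[OF D(3) B(3) Q(2)] .
  have "biproduct A (T\<lparr>carrier := ?K\<rparr>) (P\<lparr>carrier := ?KP\<rparr>) (Q\<lparr>carrier := ?KQ\<rparr>) a b c d"
    unfolding biproduct_def
  proof (intro conjI ballI)
    show "left_module A (T\<lparr>carrier := ?K\<rparr>)" "left_module A (P\<lparr>carrier := ?KP\<rparr>)" "left_module A (Q\<lparr>carrier := ?KQ\<rparr>)"
      using T.sub_left_module[OF K(1)] P.sub_left_module[OF K(2)] Q.sub_left_module[OF K(3)] .
    have z: "f \<zero>\<^bsub>P\<^esub> = \<zero>\<^bsub>M\<^esub>" "g \<zero>\<^bsub>Q\<^esub> = \<zero>\<^bsub>N\<^esub>" using hom_zero[OF D(2) B(2) P(2)] hom_zero[OF D(3) B(3) Q(2)] .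
    have "a x \<in> ?K" if "x \<in> ?KP" for x
      using that ker[of "a x"] hom_closed[OF D(4)] D(8,9)[of x] z by (simp add: lmod_ker_def)
    then show "a \<in> lmod_hom A (P\<lparr>carrier := ?KP\<rparr>) (T\<lparr>carrier := ?K\<rparr>)"
      by (intro hom_corestrict hom_restrict[OF D(4)]) (auto simp: lmod_ker_def)
    have "b x \<in> ?K" if "x \<in> ?KQ" for x
      using that ker[of "b x"] hom_closed[OF D(5)] D(10,11)[of x] z by (simp add: lmod_ker_def)
    then show "b \<in> lmod_hom A (Q\<lparr>carrier := ?KQ\<rparr>) (T\<lparr>carrier := ?K\<rparr>)"
      by (intro hom_corestrict hom_restrict[OF D(5)]) (auto simp: lmod_ker_def)
    have "c z \<in> ?KP \<and> d z \<in> ?KQ" if "z \<in> ?K" for z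
      using that ker[of z] hom_closed[OF D(6)] hom_closed[OF D(7)] by (simp add: lmod_ker_def)
    then show "c \<in> lmod_hom A (T\<lparr>carrier := ?K\<rparr>) (P\<lparr>carrier := ?KP\<rparr>)"
      "d \<in> lmod_hom A (T\<lparr>carrier := ?K\<rparr>) (Q\<lparr>carrier := ?KQ\<rparr>)"
      by (intro hom_corestrict hom_restrict[OF D(6)] hom_restrict[OF D(7)]; auto simp: lmod_ker_def)+
  qed (use D(8-12) in \<open>simp_all add: lmod_ker_def\<close>)
  then have "pd_le A n (T\<lparr>carrier := ?K\<rparr>)" by (rule Suc.IH[OF _ P(4) Q(4)])
  moreover have "projective_module A T" by (rule projective_biproduct[OF T(2) P(1) Q(1)])
  ultimately show ?case using h onto by (intro pd_le_SucI[of _ T ?h])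
qed

lemma pd_le_resolution: "pd_le A n L \<Longrightarrow> has_projective_resolution A L n"
proof (induction n arbitrary: L)
  case 0
  then show ?case unfolding has_projective_resolution_def
    by (intro exI[of _ "\<lambda>_. L"] exI[of _ "\<lambda>_ x. x"]) (simp add: hom_id)
next
  case (Suc n)
  then obtain P :: "'a amod" and f where P: "projective_module A P" "f \<in> lmod_hom A P L"
    "f ` carrier P = carrier L" "pd_le A n (P\<lparr>carrier := lmod_ker P L f\<rparr>)" by auto
  let ?K = "P\<lparr>carrier := lmod_ker P L f\<rparr>"
  obtain Q :: "nat \<Rightarrow> 'a amod" and d where Q: "\<forall>i\<le>n. projective_module A (Q i)"
    "\<forall>i\<le>n. d i \<in> lmod_hom A (Q i) (case_nat ?K Q i)" "d 0 ` carrier (Q 0) = carrier ?K"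
    "\<forall>i<n. d (Suc i) ` carrier (Q (Suc i)) = lmod_ker (Q i) (case_nat ?K Q i) (d i)"
    "inj_on (d n) (carrier (Q n))"
    using Suc.IH[OF P(4)] unfolding has_projective_resolution_def by (elim exE conjE)
  let ?Q = "case_nat P Q" and ?d = "case_nat f d"
  have sub: "lmod_ker P L f \<subseteq> carrier P" by (auto simp: lmod_ker_def)
  show ?case unfolding has_projective_resolution_def
  proof (intro exI[of _ ?Q] exI[of _ ?d] conjI allI impI)
    show "projective_module A (?Q i)" if "i \<le> Suc n" for i using that P(1) Q(1) by (cases i) auto
    show "?d i \<in> lmod_hom A (?Q i) (case_nat L ?Q i)" if "i \<le> Suc n" for i
    proof (cases i)
      case 0 then show ?thesis using P(2) by simp
    next
      case (Suc j)
      have dj: "d j \<in> lmod_hom A (Q j) (case_nat ?K Q j)" using Q(2) Suc that by simp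
      show ?thesis
      proof (cases j)
        case 0
        then have "(\<lambda>x. d 0 x) \<in> lmod_hom A (Q 0) P" using hom_comp[OF _ hom_incl[OF sub], of "d 0" A "Q 0"] dj by simp
        then show ?thesis using Suc 0 by simp
      qed (use dj Suc in simp)
    qed
    show "?d 0 ` carrier (?Q 0) = carrier L" using P(3) by simp
    show "?d (Suc i) ` carrier (?Q (Suc i)) = lmod_ker (?Q i) (case_nat L ?Q i) (?d i)" if "i < Suc n" for i
    proof (cases i)
      case 0 then show ?thesis using Q(3) by simp
    next
      case (Suc j)
      then have "d (Suc j) ` carrier (Q (Suc j)) = lmod_ker (Q j) (case_nat ?K Q j) (d j)"
        using Q(4) that by simp
      then show ?thesis using Suc by (cases j) (simp_all add: lmod_ker_def)
    qed
    show "inj_on (?d (Suc n)) (carrier (?Q (Suc n)))" using Q(5) by simp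
  qed
qed

lemma resolution_pd_le:
  fixes L :: "'a amod"
  assumes "left_module A L" "has_projective_resolution A L n"
  shows "pd_le A n L"
  using assms
proof (induction n arbitrary: L)
  case 0
  then obtain P :: "nat \<Rightarrow> 'a amod" and d where P: "projective_module A (P 0)"
    "d 0 \<in> lmod_hom A (P 0) L" "d 0 ` carrier (P 0) = carrier L" "inj_on (d 0) (carrier (P 0))"
    unfolding has_projective_resolution_def by auto
  have PL: "left_module A (P 0)" using P(1) by (intro fg_moduleD projective_fg)
  obtain g where "inverse_homs A (P 0) L (d 0) g"
    using bij_hom_inverse[OF PL 0(1) P(2)] P(3,4) by (auto simp: bij_betw_def)
  then show ?case using pd_le_iso[of A 0 "P 0" L "d 0" g] P(1) PL 0(1) by simp
next
  case (Suc n)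
  obtain P :: "nat \<Rightarrow> 'a amod" and d where P: "\<forall>i\<le>Suc n. projective_module A (P i)"
    "\<forall>i\<le>Suc n. d i \<in> lmod_hom A (P i) (case_nat L P i)" "d 0 ` carrier (P 0) = carrier L"
    "\<forall>i<Suc n. d (Suc i) ` carrier (P (Suc i)) = lmod_ker (P i) (case_nat L P i) (d i)"
    "inj_on (d (Suc n)) (carrier (P (Suc n)))"
    using Suc.prems(2) unfolding has_projective_resolution_def by (elim exE conjE)
  let ?K = "(P 0)\<lparr>carrier := lmod_ker (P 0) L (d 0)\<rparr>"
  have d0: "d 0 \<in> lmod_hom A (P 0) L" using P(2)[rule_format, of 0] by simp
  interpret P0: left_module A "P 0" using P(1)[rule_format, of 0] by (intro fg_moduleD projective_fg) simp
  have K: "left_module A ?K"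
    by (rule P0.sub_left_module[OF hom_ker_submods[OF P0.left_module_axioms Suc.prems(1) d0]])
  have d1: "d (Suc 0) ` carrier (P (Suc 0)) = lmod_ker (P 0) L (d 0)" using P(4)[rule_format, of 0] by simp
  have "has_projective_resolution A ?K n"
    unfolding has_projective_resolution_def
  proof (intro exI[of _ "\<lambda>i. P (Suc i)"] exI[of _ "\<lambda>i. d (Suc i)"] conjI allI impI)
    show "projective_module A (P (Suc i))" if "i \<le> n" for i using P(1) that by simp
    show "d (Suc i) \<in> lmod_hom A (P (Suc i)) (case_nat ?K (\<lambda>i. P (Suc i)) i)" if "i \<le> n" for i
    proof -
      have di: "d (Suc i) \<in> lmod_hom A (P (Suc i)) (P i)" using P(2)[rule_format, of "Suc i"] that by simp
      show ?thesis
      proof (cases i)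
        case 0 then show ?thesis using hom_corestrict[OF di, of "lmod_ker (P 0) L (d 0)"] d1 by simp
      qed (use di in simp)
    qed
    show "d (Suc 0) ` carrier (P (Suc 0)) = carrier ?K" using d1 by simp
    show "d (Suc (Suc i)) ` carrier (P (Suc (Suc i))) =
        lmod_ker (P (Suc i)) (case_nat ?K (\<lambda>i. P (Suc i)) i) (d (Suc i))" if "i < n" for i
      using P(4)[rule_format, of "Suc i"] that by (cases i) (simp_all add: lmod_ker_def)
    show "inj_on (d (Suc n)) (carrier (P (Suc n)))" by (rule P(5))
  qed
  from Suc.IH[OF K this] show ?case
    using P(1)[rule_format, of 0] d0 P(3) by (intro pd_le_SucI[of _ "P 0" "d 0"]) simp_all
qed

lemma Inf_enat_le_iff: "Inf (enat ` X) \<le> enat n \<longleftrightarrow> (\<exists>k\<in>X. k \<le> n)"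
proof
  assume *: "Inf (enat ` X) \<le> enat n"
  then have "X \<noteq> {}" by (auto simp: top_enat_def)
  then have "Inf (enat ` X) \<in> enat ` X" by (intro wellorder_InfI[of "enat (SOME x. x \<in> X)"]) (auto simp: some_in_eq)
  then show "\<exists>k\<in>X. k \<le> n" using * by auto
qed (auto intro: Inf_lower2)

lemma proj_dim_le_iff:
  assumes "left_module A L"
  shows "proj_dim A L \<le> enat n \<longleftrightarrow> pd_le A n L"
proof -
  have "has_projective_resolution A L k \<longleftrightarrow> pd_le A k L" for k
    using resolution_pd_le[OF assms] pd_le_resolution by (rule iffI)
  then have "proj_dim A L \<le> enat n \<longleftrightarrow> (\<exists>k\<in>{k. pd_le A k L}. k \<le> n)"
    by (simp only: proj_dim_def Inf_enat_le_iff)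
  then show ?thesis using pd_le_mono[of A _ L n] by auto
qed

section \<open>Injective modules\<close>

text \<open>\<open>\<iota>\<close> embeds \<open>X\<close> into \<open>E\<close> such that each nonzero submodule of \<open>E\<close> meets the image of \<open>X\<close> in a nonzero
  element.\<close>

definition essential_extension ::
    "('a, 'r) ring_scheme \<Rightarrow> ('a, 'b) module \<Rightarrow> ('a, 'c) module \<Rightarrow> ('b \<Rightarrow> 'c) \<Rightarrow> bool" where
  "essential_extension R X E \<iota> \<longleftrightarrow> left_module R X \<and> left_module R E \<and> \<iota> \<in> lmod_hom R X E \<and>
     inj_on \<iota> (carrier X) \<and>
     (\<forall>U\<in>submods R E. U \<noteq> {\<zero>\<^bsub>E\<^esub>} \<longrightarrow> (\<exists>u\<in>U. u \<noteq> \<zero>\<^bsub>E\<^esub> \<and> u \<in> \<iota> ` carrier X))"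

lemma essential_extension_meets:
  assumes "essential_extension R X E \<iota>" "U \<in> submods R E" "U \<noteq> {\<zero>\<^bsub>E\<^esub>}"
  shows "\<exists>u\<in>U. u \<noteq> \<zero>\<^bsub>E\<^esub> \<and> u \<in> \<iota> ` carrier X"
  using assms by (simp add: essential_extension_def)

text \<open>The length of the essential extensions \<open>E\<close> of \<open>X\<close> over a central subring \<open>K\<close> is bounded. Consider
  the \<open>K\<close>-submodules \<open>Y(I) = {y. I y = 0}\<close> of \<open>E\<close> for left ideals \<open>I\<close>. If the left ideal \<open>J\<close> covers \<open>I\<close>
  and \<open>a \<in> J - I\<close>, multiplication by \<open>a\<close> is \<open>K\<close>-linear on \<open>Y(I)\<close> with kernel \<open>Y(J)\<close>, and it maps into
  \<open>X\<close>, because \<open>A a y\<close> is zero or simple for \<open>y \<in> Y(I)\<close> and \<open>E\<close> is essential. Hence the length of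
  \<open>Y(0) = E\<close> is at most the length of \<open>A\<close> times the \<open>K\<close>-length of \<open>X\<close>.\<close>

lemma essential_extension_height:
  fixes X :: "('a, 'b) module" and A :: "('a, 'r) ring_scheme"
  assumes "ring A" and K: "K \<subseteq> carrier A" "\<ominus>\<^bsub>A\<^esub> \<one>\<^bsub>A\<^esub> \<in> K"
    and central: "\<And>c a. c \<in> K \<Longrightarrow> a \<in> carrier A \<Longrightarrow> c \<otimes>\<^bsub>A\<^esub> a = a \<otimes>\<^bsub>A\<^esub> c"
    and N: "height_le (submods A (regular_module A)) N" and l: "height_le (stable_subs K X) l"
  shows "\<exists>b. \<forall>(E :: ('a, 'c) module) \<iota>. essential_extension A X E \<iota> \<longrightarrow> height_le (stable_subs K E) b"
proof -
  interpret A: ring A by fact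
  let ?R = "regular_module A"
  interpret R: left_module A ?R by (rule A.regular_left_module)
  \<comment> \<open>The \<open>K\<close>-submodules of \<open>{y. I y = 0}\<close>.\<close>
  define Y where "Y I E = {V \<in> stable_subs K E. \<forall>a\<in>I. \<forall>y\<in>V. a \<odot>\<^bsub>E\<^esub> y = \<zero>\<^bsub>E\<^esub>}"
    for I and E :: "('a, 'c) module"
  obtain d :: "'a set \<Rightarrow> nat" where
    d: "\<And>V. V \<in> submods A ?R \<Longrightarrow> d V \<le> N"
       "\<And>V W. V \<in> submods A ?R \<Longrightarrow> W \<in> submods A ?R \<Longrightarrow> V \<subset> W \<Longrightarrow> d V < d W"
    by (rule height_leE[OF N]) blast
  have claim: "\<exists>b. \<forall>E \<iota>. essential_extension A X E \<iota> \<longrightarrow> height_le (Y I E) b" if "I \<in> submods A ?R" for I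
    using that
  proof (induction "N - d I" arbitrary: I rule: less_induct)
    case (less I)
    note DI = stable_subsD[OF less.prems, simplified]
    show ?case
    proof (cases "I = carrier A")
      case True
      have "height_le (Y I E) 0" if "essential_extension A X E \<iota>" for E \<iota>
      proof -
        interpret E: left_module A E using that by (simp add: essential_extension_def)
        have "Y I E \<subseteq> {{\<zero>\<^bsub>E\<^esub>}}"
        proof
          fix V assume V: "V \<in> Y I E"
          then have VK: "V \<in> stable_subs K E" by (simp add: Y_def)
          have "V \<subseteq> {\<zero>\<^bsub>E\<^esub>}"
          proof
            fix y assume "y \<in> V"
            have "\<one>\<^bsub>A\<^esub> \<odot>\<^bsub>E\<^esub> y = \<zero>\<^bsub>E\<^esub>" using V \<open>y \<in> V\<close> True by (simp add: Y_def)
            then show "y \<in> {\<zero>\<^bsub>E\<^esub>}" using stable_subsD(2)[OF VK \<open>y \<in> V\<close>] by simp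
          qed
          then show "V \<in> {{\<zero>\<^bsub>E\<^esub>}}" using stable_subsD(3)[OF VK] by auto
        qed
        then show ?thesis by (rule height_le_singleton)
      qed
      then show ?thesis by blast
    next
      case False
      have "I \<subset> carrier A" using False DI(1) by auto
      moreover have cA: "carrier A \<in> submods A ?R" using R.stable_subs_carrier[OF subset_refl] by simp
      ultimately obtain J where J: "J \<in> submods A ?R" "I \<subset> J"
        "\<forall>W\<in>submods A ?R. I \<subset> W \<longrightarrow> W \<subseteq> J \<longrightarrow> W = J"
        using height_le_min[OF N, of "carrier A" "\<lambda>J. I \<subset> J"] by auto
      note DJ = stable_subsD[OF J(1), simplified]
      have gen: "J = I <+>\<^bsub>?R\<^esub> cyc A ?R a" if a: "a \<in> J" "a \<notin> I" for a
      proof -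
        have ac: "a \<in> carrier ?R" using a DJ by simp
        note cy = R.cyc_submods[OF ac]
        have "I <+>\<^bsub>?R\<^esub> cyc A ?R a \<in> submods A ?R" by (rule R.stable_subs_plus[OF less.prems cy subset_refl])
        moreover have "I \<subset> I <+>\<^bsub>?R\<^esub> cyc A ?R a"
          using R.subset_plus[OF less.prems cy] R.cyc_self[OF ac] a(2) by auto
        moreover have "I <+>\<^bsub>?R\<^esub> cyc A ?R a \<subseteq> J"
          by (rule R.plus_least[OF J(1)]) (use J(2) R.cyc_least[OF J(1) a(1)] in auto)
        ultimately have "I <+>\<^bsub>?R\<^esub> cyc A ?R a = J" by (rule J(3)[rule_format])
        then show ?thesis ..
      qed
      obtain a where a: "a \<in> J" "a \<notin> I" using J(2) by auto
      have ac: "a \<in> carrier A" using a DJ by auto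
      have "d I < d J" by (rule d(2)[OF less.prems J(1,2)])
      moreover have "d J \<le> N" by (rule d(1)[OF J(1)])
      ultimately have "N - d J < N - d I" by simp
      from less.hyps[OF this J(1)] obtain b where
        b: "\<And>E \<iota>. essential_extension A X E \<iota> \<Longrightarrow> height_le (Y J E) b" by auto
      have "height_le (Y I E) (b + l)" if ess: "essential_extension A X E \<iota>" for E \<iota>
      proof -
        interpret X: left_module A X using ess by (simp add: essential_extension_def)
        interpret E: left_module A E using ess by (simp add: essential_extension_def)
        have io: "\<iota> \<in> lmod_hom A X E" using ess by (simp add: essential_extension_def)
        have imX: "\<iota> ` carrier X \<in> submods A E"
          by (rule stable_subs_image[OF X.left_module_axioms E.left_module_axioms io
                X.stable_subs_carrier[OF subset_refl] subset_refl])
        have aX: "a \<odot>\<^bsub>E\<^esub> y \<in> \<iota> ` carrier X" if y: "y \<in> carrier E" "\<forall>r\<in>I. r \<odot>\<^bsub>E\<^esub> y = \<zero>\<^bsub>E\<^esub>" for y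
        proof (cases "a \<odot>\<^bsub>E\<^esub> y = \<zero>\<^bsub>E\<^esub>")
          case True then show ?thesis using stable_subsD(3)[OF imX] by simp
        next
          case False
          have ay: "a \<odot>\<^bsub>E\<^esub> y \<in> carrier E" using ac y by simp
          have "cyc A E (a \<odot>\<^bsub>E\<^esub> y) \<noteq> {\<zero>\<^bsub>E\<^esub>}" using E.cyc_self[OF ay] False by auto
          then obtain u where u: "u \<in> cyc A E (a \<odot>\<^bsub>E\<^esub> y)" "u \<noteq> \<zero>\<^bsub>E\<^esub>" "u \<in> \<iota> ` carrier X"
            using ess E.cyc_submods[OF ay] unfolding essential_extension_def by auto
          then obtain c where c: "c \<in> carrier A" "u = c \<odot>\<^bsub>E\<^esub> (a \<odot>\<^bsub>E\<^esub> y)" by (auto simp: cyc_def)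
          then have u': "u = (c \<otimes>\<^bsub>A\<^esub> a) \<odot>\<^bsub>E\<^esub> y" using ac y by (simp add: E.smult_assoc1)
          have "c \<otimes>\<^bsub>A\<^esub> a \<in> J" using DJ(5) c a by simp
          moreover have "c \<otimes>\<^bsub>A\<^esub> a \<notin> I" using y(2) u(2) u' by auto
          ultimately have "a \<in> I <+>\<^bsub>?R\<^esub> cyc A ?R (c \<otimes>\<^bsub>A\<^esub> a)" using gen a(1) by blast
          then obtain i e where ie: "i \<in> I" "e \<in> carrier A" "a = i \<oplus>\<^bsub>A\<^esub> e \<otimes>\<^bsub>A\<^esub> (c \<otimes>\<^bsub>A\<^esub> a)"
            by (auto simp: set_add_def' cyc_def)
          have "a \<odot>\<^bsub>E\<^esub> y = i \<odot>\<^bsub>E\<^esub> y \<oplus>\<^bsub>E\<^esub> e \<odot>\<^bsub>E\<^esub> ((c \<otimes>\<^bsub>A\<^esub> a) \<odot>\<^bsub>E\<^esub> y)"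
            using ie(2) DI(2)[OF ie(1)] c(1) ac y(1)
            by (subst ie(3)) (simp add: E.smult_l_distr E.smult_assoc1)
          also have "\<dots> = e \<odot>\<^bsub>E\<^esub> u" using y ie c(1) ac unfolding u' by simp
          finally show ?thesis using stable_subsD(5)[OF imX ie(2) u(3)] by simp
        qed
        have comm: "r \<odot>\<^bsub>E\<^esub> (c \<odot>\<^bsub>E\<^esub> y) = c \<odot>\<^bsub>E\<^esub> (r \<odot>\<^bsub>E\<^esub> y)"
          if "c \<in> K" "r \<in> carrier A" "y \<in> carrier E" for r c y
          using that K(1) central[OF that(1,2)] by (simp add: subset_iff flip: E.smult_assoc1)
        let ?\<alpha> = "\<lambda>V. {y \<in> V. \<forall>r\<in>J. r \<odot>\<^bsub>E\<^esub> y = \<zero>\<^bsub>E\<^esub>}"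
          and ?\<beta> = "\<lambda>V. {x \<in> carrier X. \<exists>y\<in>V. \<iota> x = a \<odot>\<^bsub>E\<^esub> y}"
        show ?thesis
        proof (rule height_le_combine[OF b[OF ess] l, where \<alpha> = ?\<alpha> and \<beta> = ?\<beta>])
          fix V assume "V \<in> Y I E"
          then have V: "V \<in> stable_subs K E" by (simp add: Y_def)
          note DV = stable_subsD[OF V]
          have "?\<alpha> V \<in> stable_subs K E"
          proof (rule stable_subsI)
            show "c \<odot>\<^bsub>E\<^esub> y \<in> ?\<alpha> V"
              if "c \<in> K" "y \<in> ?\<alpha> V" for c y
            proof -
              have yV: "y \<in> V" and ry: "\<And>r. r \<in> J \<Longrightarrow> r \<odot>\<^bsub>E\<^esub> y = \<zero>\<^bsub>E\<^esub>" using that(2) by auto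
              have "r \<odot>\<^bsub>E\<^esub> (c \<odot>\<^bsub>E\<^esub> y) = \<zero>\<^bsub>E\<^esub>" if "r \<in> J" for r
                using comm[OF \<open>c \<in> K\<close> DJ(2)[OF that] DV(2)[OF yV]] ry[OF that] E.r_null[of c] \<open>c \<in> K\<close> K(1)
                by auto
              then show ?thesis using DV(5)[OF \<open>c \<in> K\<close> yV] by simp
            qed
          qed (use DV DJ(2) in \<open>auto simp: E.r_null E.smult_r_distr\<close>)
          then show "?\<alpha> V \<in> Y J E" by (auto simp: Y_def)
          show "?\<beta> V \<in> stable_subs K X"
          proof (rule stable_subsI)
            show "\<zero>\<^bsub>X\<^esub> \<in> ?\<beta> V"
              using DV(3) hom_zero[OF X.left_module_axioms E.left_module_axioms io] E.r_null[OF ac] by force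
          next
            fix x x' assume "x \<in> ?\<beta> V"
              "x' \<in> ?\<beta> V"
            then obtain y y' where h: "x \<in> carrier X" "x' \<in> carrier X" "y \<in> V" "y' \<in> V"
              "\<iota> x = a \<odot>\<^bsub>E\<^esub> y" "\<iota> x' = a \<odot>\<^bsub>E\<^esub> y'" by auto
            then have "\<iota> (x \<oplus>\<^bsub>X\<^esub> x') = a \<odot>\<^bsub>E\<^esub> (y \<oplus>\<^bsub>E\<^esub> y')"
              using DV(2) ac by (simp add: hom_add[OF io] E.smult_r_distr)
            then show "x \<oplus>\<^bsub>X\<^esub> x' \<in> ?\<beta> V" using h DV(4) by auto
          next
            fix c x assume c: "c \<in> K" and "x \<in> ?\<beta> V"
            then obtain y where h: "x \<in> carrier X" "y \<in> V" "\<iota> x = a \<odot>\<^bsub>E\<^esub> y" by auto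
            have cA: "c \<in> carrier A" using c K by auto
            then have "\<iota> (c \<odot>\<^bsub>X\<^esub> x) = a \<odot>\<^bsub>E\<^esub> (c \<odot>\<^bsub>E\<^esub> y)"
              using h comm[OF c ac DV(2)[OF h(2)]] by (simp add: hom_smult[OF io])
            then show "c \<odot>\<^bsub>X\<^esub> x \<in> ?\<beta> V" using h cA DV(5)[OF c] by auto
          qed auto
        next
          fix V W assume VY: "V \<in> Y I E" and WY: "W \<in> Y I E" and sub: "V \<subseteq> W"
            and eq: "?\<alpha> V = ?\<alpha> W"
              "?\<beta> V = ?\<beta> W"
          have V: "V \<in> stable_subs K E" and W: "W \<in> stable_subs K E"
            and WI: "\<And>r y. r \<in> I \<Longrightarrow> y \<in> W \<Longrightarrow> r \<odot>\<^bsub>E\<^esub> y = \<zero>\<^bsub>E\<^esub>"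
            using VY WY by (auto simp: Y_def)
          show "W \<subseteq> V"
          proof
            fix w assume w: "w \<in> W"
            have wc: "w \<in> carrier E" using stable_subsD(2)[OF W w] .
            have "a \<odot>\<^bsub>E\<^esub> w \<in> \<iota> ` carrier X" using aX[OF wc] WI w by auto
            then obtain x where x: "x \<in> carrier X" "\<iota> x = a \<odot>\<^bsub>E\<^esub> w" by auto
            then have "x \<in> ?\<beta> W" using w by auto
            then have "x \<in> ?\<beta> V" unfolding eq(2) .
            then obtain v where v: "v \<in> V" "\<iota> x = a \<odot>\<^bsub>E\<^esub> v" by auto
            have vc: "v \<in> carrier E" using stable_subsD(2)[OF V v(1)] .
            let ?z = "w \<ominus>\<^bsub>E\<^esub> v"
            have zW: "?z \<in> W" by (rule E.stable_subs_diff[OF W K(2) w]) (use v sub in auto)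
            have zc: "?z \<in> carrier E" using stable_subsD(2)[OF W zW] .
            have "a \<odot>\<^bsub>E\<^esub> w = a \<odot>\<^bsub>E\<^esub> (?z \<oplus>\<^bsub>E\<^esub> v)" using E.M.diff_add_cancel[OF wc vc] by simp
            also have "\<dots> = a \<odot>\<^bsub>E\<^esub> ?z \<oplus>\<^bsub>E\<^esub> a \<odot>\<^bsub>E\<^esub> v" using zc vc ac by (simp add: E.smult_r_distr)
            finally have "a \<odot>\<^bsub>E\<^esub> ?z \<oplus>\<^bsub>E\<^esub> a \<odot>\<^bsub>E\<^esub> v = a \<odot>\<^bsub>E\<^esub> v" using x(2) v(2) by simp
            then have az: "a \<odot>\<^bsub>E\<^esub> ?z = \<zero>\<^bsub>E\<^esub>"
              using zc vc ac E.M.add.r_cancel_one[of "a \<odot>\<^bsub>E\<^esub> v" "a \<odot>\<^bsub>E\<^esub> ?z"] by simp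
            have "r \<odot>\<^bsub>E\<^esub> ?z = \<zero>\<^bsub>E\<^esub>" if "r \<in> J" for r
            proof -
              have "r \<in> I <+>\<^bsub>?R\<^esub> cyc A ?R a" using that gen[OF a] by simp
              then obtain i c where ic: "i \<in> I" "c \<in> carrier A" "r = i \<oplus>\<^bsub>A\<^esub> c \<otimes>\<^bsub>A\<^esub> a"
                by (auto simp: set_add_def' cyc_def)
              have "r \<odot>\<^bsub>E\<^esub> ?z = i \<odot>\<^bsub>E\<^esub> ?z \<oplus>\<^bsub>E\<^esub> c \<odot>\<^bsub>E\<^esub> (a \<odot>\<^bsub>E\<^esub> ?z)"
                using ic(2) DI(2)[OF ic(1)] ac zc unfolding ic(3) by (simp add: E.smult_l_distr E.smult_assoc1)
              then show ?thesis using WI[OF ic(1) zW] az E.r_null[OF ic(2)] by simp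
            qed
            then have "?z \<in> V" using eq(1) zW by blast
            then have "?z \<oplus>\<^bsub>E\<^esub> v \<in> V" using v(1) by (rule stable_subsD(4)[OF V])
            then show "w \<in> V" using E.M.diff_add_cancel[OF wc vc] by simp
          qed
        qed auto
      qed
      then show ?thesis by blast
    qed
  qed
  have "{\<zero>\<^bsub>A\<^esub>} \<in> submods A ?R" using R.stable_subs_zero[OF subset_refl] by simp
  from claim[OF this] obtain b where
    b: "\<forall>E \<iota>. essential_extension A X E \<iota> \<longrightarrow> height_le (Y {\<zero>\<^bsub>A\<^esub>} E) b" ..
  have "height_le (stable_subs K E) b" if ess: "essential_extension A X E \<iota>"
    for E :: "('a, 'c) module" and \<iota>
  proof -
    interpret E: left_module A E using ess by (simp add: essential_extension_def)
    have "\<zero>\<^bsub>A\<^esub> \<odot>\<^bsub>E\<^esub> y = \<zero>\<^bsub>E\<^esub>" if "V \<in> stable_subs K E" "y \<in> V" for V y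
      using E.l_null stable_subsD(2)[OF that] by simp
    then have "Y {\<zero>\<^bsub>A\<^esub>} E = stable_subs K E" by (auto simp: Y_def)
    then show ?thesis using b[rule_format, OF ess] by simp
  qed
  then show ?thesis by blast
qed

lemma height_le_proper_embedding:
  assumes "left_module R E" "left_module R Q" and f: "f \<in> lmod_hom R E Q" "inj_on f (carrier E)"
    and proper: "f ` carrier E \<noteq> carrier Q" and n: "height_le (submods R Q) n"
  shows "\<exists>m<n. height_le (submods R E) m"
proof -
  interpret E: left_module R E by fact
  interpret Q: left_module R Q by fact
  obtain d where d: "\<And>V. V \<in> submods R Q \<Longrightarrow> d V \<le> n"
    "\<And>V W. V \<in> submods R Q \<Longrightarrow> W \<in> submods R Q \<Longrightarrow> V \<subset> W \<Longrightarrow> d V < d W"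
    by (rule height_leE[OF n]) blast
  have im: "f ` V \<in> submods R Q" if "V \<in> submods R E" for V
    by (rule stable_subs_image[OF assms(1,2) f(1) that subset_refl])
  have I: "f ` carrier E \<in> submods R Q" by (rule im[OF E.stable_subs_carrier[OF subset_refl]])
  have "d (f ` carrier E) < d (carrier Q)"
    by (rule d(2)[OF I Q.stable_subs_carrier[OF subset_refl]]) (use proper stable_subsD(1)[OF I] in auto)
  also have "\<dots> \<le> n" by (rule d(1)[OF Q.stable_subs_carrier[OF subset_refl]])
  finally have "d (f ` carrier E) < n" .
  moreover have "height_le (submods R E) (d (f ` carrier E))"
  proof (rule height_leI[of _ "\<lambda>V. d (f ` V)"])
    fix V assume V: "V \<in> submods R E"
    have "f ` V \<subseteq> f ` carrier E" using stable_subsD(1)[OF V] by auto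
    then show "d (f ` V) \<le> d (f ` carrier E)"
      using d(2)[OF im[OF V] I] by (cases "f ` V = f ` carrier E") (simp_all add: psubset_eq)
  next
    fix V W assume VW: "V \<in> submods R E" "W \<in> submods R E" "V \<subset> W"
    have "f ` V \<subset> f ` W"
      using inj_on_image_eq_iff[OF f(2) stable_subsD(1)[OF VW(1)] stable_subsD(1)[OF VW(2)]] VW(3) by auto
    then show "d (f ` V) < d (f ` W)" by (rule d(2)[OF im[OF VW(1)] im[OF VW(2)]])
  qed
  ultimately show ?thesis by blast
qed

text \<open>It suffices to split the inclusions of \<open>E\<close> itself, since a pushout reduces the extension of a
  homomorphism to this case.\<close>

lemma splitting_injective:
  fixes E :: "'a amod" and A :: "('a, 'r) ring_scheme"
  assumes E: "fg_module A E"
    and split: "\<And>(N :: 'a amod) g. fg_module A N \<Longrightarrow> g \<in> lmod_hom A E N \<Longrightarrow> inj_on g (carrier E) \<Longrightarrow>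
       \<exists>r\<in>lmod_hom A N E. \<forall>x\<in>carrier E. r (g x) = x"
  shows "injective_module A E"
  unfolding injective_module_def
proof (intro conjI allI impI; (elim conjE)?)
  show "fg_module A E" by fact
  fix M N :: "'a amod" and g f
  assume M: "fg_module A M" and N: "fg_module A N" and g: "g \<in> lmod_hom A M N" "inj_on g (carrier M)"
    and f: "f \<in> lmod_hom A M E"
  obtain S :: "'a amod" and i j p q where S: "fg_module A S" "biproduct A S E N i j p q"
    using biproduct_exists[OF E N] by auto
  note B = biproductD[OF S(2)]
  interpret E: left_module A E by (rule B(2))
  interpret N: left_module A N by (rule B(3))
  interpret S: left_module A S by (rule B(1))
  interpret M: left_module A M using M by (rule fg_moduleD)
  \<comment> \<open>The pushout of \<open>f\<close> and \<open>g\<close> is the quotient of the direct sum by the image of \<open>(f, -g)\<close>.\<close>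
  let ?t = "\<lambda>x. i (f x) \<oplus>\<^bsub>S\<^esub> \<ominus>\<^bsub>S\<^esub> j (g x)"
  have jg: "(\<lambda>x. j (g x)) \<in> lmod_hom A M S" by (rule hom_comp[OF g(1) B(5)])
  have t: "?t \<in> lmod_hom A M S"
    by (rule hom_plus[OF B(1) hom_comp[OF f B(4)] hom_neg[OF B(1) jg]])
  let ?U = "?t ` carrier M"
  have U: "?U \<in> submods A S"
    by (rule stable_subs_image[OF M.left_module_axioms B(1) t M.stable_subs_carrier[OF subset_refl] subset_refl])
  obtain Q :: "'a amod" and u where Q: "left_module A Q" "u \<in> lmod_hom A S Q" "u ` carrier S = carrier Q"
    "lmod_ker S Q u = ?U" using quotient_exists[OF B(1) U] by auto
  interpret Q: left_module A Q by (rule Q(1))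
  have e: "(\<lambda>x. u (i x)) \<in> lmod_hom A E Q" by (rule hom_comp[OF B(4) Q(2)])
  have einj: "inj_on (\<lambda>x. u (i x)) (carrier E)"
    unfolding hom_inj_iff[OF B(2) Q(1) e]
  proof (intro ballI impI)
    fix x assume x: "x \<in> carrier E" "u (i x) = \<zero>\<^bsub>Q\<^esub>"
    have "i x \<in> lmod_ker S Q u" using x hom_closed[OF B(4)] by (simp add: lmod_ker_def)
    then obtain m where m: "m \<in> carrier M" "i x = ?t m" unfolding Q(4) by auto
    note c = hom_closed[OF f m(1)] hom_closed[OF g(1) m(1)]
    note c' = hom_closed[OF B(4) c(1)] hom_closed[OF B(5) c(2)]
    have "q (i x) = \<ominus>\<^bsub>N\<^esub> g m"
      unfolding m(2) using c c' by (simp add: hom_add[OF B(7)] hom_minus[OF B(1,3,7)] B(9,10))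
    then have "\<ominus>\<^bsub>N\<^esub> g m = \<zero>\<^bsub>N\<^esub>" using B(9)[OF x(1)] by simp
    then have "g m = \<zero>\<^bsub>N\<^esub>" using N.M.r_neg[OF c(2)] c(2) by simp
    then have "m = \<zero>\<^bsub>M\<^esub>" using hom_inj_iff[OF M.left_module_axioms B(3) g(1)] g(2) m(1) by auto
    then have "i x = \<zero>\<^bsub>S\<^esub>" using m(2) hom_zero[OF M.left_module_axioms B(1) t] by simp
    then show "x = \<zero>\<^bsub>E\<^esub>" using B(8)[OF x(1)] hom_zero[OF B(1,2,6)] by simp
  qed
  obtain r where r: "r \<in> lmod_hom A Q E" "\<forall>x\<in>carrier E. r (u (i x)) = x"
    using split[OF fg_image[OF S(1) Q(1-3)] e einj] by auto
  show "\<exists>h\<in>lmod_hom A N E. \<forall>x\<in>carrier M. h (g x) = f x"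
  proof (rule bexI[OF _ hom_comp[OF hom_comp[OF B(5) Q(2)] r(1)]], rule ballI)
    fix m assume m: "m \<in> carrier M"
    note c = hom_closed[OF f m] hom_closed[OF g(1) m]
    note c' = hom_closed[OF B(4) c(1)] hom_closed[OF B(5) c(2)]
    note c'' = hom_closed[OF Q(2) c'(1)] hom_closed[OF Q(2) c'(2)]
    have "?t m \<in> lmod_ker S Q u" unfolding Q(4) using m by simp
    then have "u (?t m) = \<zero>\<^bsub>Q\<^esub>" by (simp add: lmod_ker_def)
    then have "u (i (f m)) \<ominus>\<^bsub>Q\<^esub> u (j (g m)) = \<zero>\<^bsub>Q\<^esub>"
      using c' by (simp add: hom_add[OF Q(2)] hom_minus[OF B(1) Q(1,2)] a_minus_def)
    then have "u (i (f m)) = u (j (g m))" using c'' by (simp add: Q.M.diff_eq_zero)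
    then show "r (u (j (g m))) = f m" using r(2) c(1) by metis
  qed
qed

text \<open>An essential extension of \<open>X\<close> of maximal length is a direct summand in each module that
  contains it: dividing by a submodule that is maximal with zero intersection gives another
  essential extension.\<close>

lemma injective_embedding:
  fixes X :: "'a amod" and A :: "('a, 'r) ring_scheme"
  assumes fin: "\<And>M :: 'a amod. fg_module A M \<Longrightarrow> \<exists>n. height_le (submods A M) n"
    and X: "fg_module A X"
    and b: "\<And>(E :: 'a amod) \<iota>. essential_extension A X E \<iota> \<Longrightarrow> height_le (submods A E) b"
  shows "\<exists>(E :: 'a amod) \<iota>. injective_module A E \<and> \<iota> \<in> lmod_hom A X E \<and> inj_on \<iota> (carrier X)"
proof -
  define len where "len E = (LEAST n. height_le (submods A E) n)" for E :: "'a amod"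
  define P where "P = (\<lambda>(E :: 'a amod, \<iota>). fg_module A E \<and> essential_extension A X E \<iota>)"
  interpret X: left_module A X using X by (rule fg_moduleD)
  have "P (X, \<lambda>x. x)"
  proof -
    have "\<exists>u\<in>U. u \<noteq> \<zero>\<^bsub>X\<^esub> \<and> u \<in> (\<lambda>x. x) ` carrier X" if U: "U \<in> submods A X" "U \<noteq> {\<zero>\<^bsub>X\<^esub>}" for U
      using U(2) stable_subsD(1,3)[OF U(1)] by auto
    then show ?thesis using X X.left_module_axioms by (simp add: P_def essential_extension_def hom_id)
  qed
  moreover have "\<forall>y. P y \<longrightarrow> len (fst y) < Suc b"
    using b by (auto simp: P_def len_def less_Suc_eq_le intro!: Least_le)
  ultimately obtain y where y: "P y" "\<forall>z. P z \<longrightarrow> len (fst z) \<le> len (fst y)"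
    using ex_has_greatest_nat[of P "(X, \<lambda>x. x)" "\<lambda>y. len (fst y)" "Suc b"] by auto
  obtain E \<iota> where Eio: "y = (E, \<iota>)" by (cases y)
  have E: "fg_module A E" and ess: "essential_extension A X E \<iota>"
    and max: "\<And>E' \<iota>'. fg_module A E' \<Longrightarrow> essential_extension A X E' \<iota>' \<Longrightarrow> len E' \<le> len E"
    using y by (auto simp: Eio P_def)
  interpret E: left_module A E using E by (rule fg_moduleD)
  have io: "\<iota> \<in> lmod_hom A X E" "inj_on \<iota> (carrier X)" using ess by (simp_all add: essential_extension_def)
  have "\<exists>r\<in>lmod_hom A N E. \<forall>x\<in>carrier E. r (g x) = x"
    if N: "fg_module A N" and g: "g \<in> lmod_hom A E N" "inj_on g (carrier E)" for N :: "'a amod" and g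
  proof -
    interpret N: left_module A N using N by (rule fg_moduleD)
    have gz: "g \<zero>\<^bsub>E\<^esub> = \<zero>\<^bsub>N\<^esub>" by (rule hom_zero[OF E.left_module_axioms N.left_module_axioms g(1)])
    have gz': "\<zero>\<^bsub>N\<^esub> \<in> g ` carrier E" using imageI[OF E.M.zero_closed, of g] gz by simp
    obtain n where n: "height_le (submods A N) n" using fin[OF N] by auto
    have "\<exists>U\<in>submods A N. U \<inter> g ` carrier E = {\<zero>\<^bsub>N\<^esub>} \<and>
      (\<forall>W\<in>submods A N. W \<inter> g ` carrier E = {\<zero>\<^bsub>N\<^esub>} \<longrightarrow> U \<subseteq> W \<longrightarrow> W = U)"
    proof (rule height_le_max[OF n N.stable_subs_zero[OF subset_refl]])
      show "{\<zero>\<^bsub>N\<^esub>} \<inter> g ` carrier E = {\<zero>\<^bsub>N\<^esub>}" using gz' by auto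
    qed
    then obtain U where U: "U \<in> submods A N" "U \<inter> g ` carrier E = {\<zero>\<^bsub>N\<^esub>}"
      "\<forall>W\<in>submods A N. W \<inter> g ` carrier E = {\<zero>\<^bsub>N\<^esub>} \<longrightarrow> U \<subseteq> W \<longrightarrow> W = U" by (elim bexE conjE)
    obtain Q :: "'a amod" and p where Q: "left_module A Q" "p \<in> lmod_hom A N Q" "p ` carrier N = carrier Q"
      "lmod_ker N Q p = U" using quotient_exists[OF N.left_module_axioms U(1)] by auto
    interpret Q: left_module A Q by (rule Q(1))
    have fgQ: "fg_module A Q" by (rule fg_image[OF N Q(1-3)])
    have pg: "(\<lambda>x. p (g x)) \<in> lmod_hom A E Q" by (rule hom_comp[OF g(1) Q(2)])
    have p0: "g x = \<zero>\<^bsub>N\<^esub>" if "x \<in> carrier E" "p (g x) = \<zero>\<^bsub>Q\<^esub>" for x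
    proof -
      have "g x \<in> U" using that hom_closed[OF g(1)] unfolding Q(4)[symmetric] by (simp add: lmod_ker_def)
      then show ?thesis using U(2) that(1) by blast
    qed
    have pginj: "inj_on (\<lambda>x. p (g x)) (carrier E)"
      unfolding hom_inj_iff[OF E.left_module_axioms Q(1) pg]
      using p0 hom_inj_iff[OF E.left_module_axioms N.left_module_axioms g(1)] g(2) by auto
    have essQ: "\<exists>w\<in>W. w \<noteq> \<zero>\<^bsub>Q\<^esub> \<and> w \<in> (\<lambda>x. p (g (\<iota> x))) ` carrier X"
      if W: "W \<in> submods A Q" "W \<noteq> {\<zero>\<^bsub>Q\<^esub>}" for W
    proof -
      let ?W' = "{x \<in> carrier N. p x \<in> W}"
      have W': "?W' \<in> submods A N" by (rule stable_subs_vimage[OF N.left_module_axioms Q(1,2) W(1) subset_refl])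
      have "U \<subseteq> ?W'" using stable_subsD(3)[OF W(1)] unfolding Q(4)[symmetric] by (auto simp: lmod_ker_def)
      moreover have "?W' \<noteq> U"
      proof
        assume eq: "?W' = U"
        have "W \<subseteq> {\<zero>\<^bsub>Q\<^esub>}"
        proof
          fix w assume w: "w \<in> W"
          then have "w \<in> p ` carrier N" using stable_subsD(2)[OF W(1)] Q(3) by simp
          then obtain x where x: "x \<in> carrier N" "w = p x" by auto
          then have "x \<in> lmod_ker N Q p" using w eq Q(4) by auto
          then show "w \<in> {\<zero>\<^bsub>Q\<^esub>}" using x by (simp add: lmod_ker_def)
        qed
        then show False using W(2) stable_subsD(3)[OF W(1)] by auto
      qed
      ultimately have "?W' \<inter> g ` carrier E \<noteq> {\<zero>\<^bsub>N\<^esub>}" using U(3) W' by auto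
      moreover have "\<zero>\<^bsub>N\<^esub> \<in> ?W' \<inter> g ` carrier E"
        by (rule IntI[OF stable_subsD(3)[OF W'] gz'])
      ultimately obtain z where z: "z \<in> ?W'" "z \<in> g ` carrier E" "z \<noteq> \<zero>\<^bsub>N\<^esub>" by auto
      then obtain x where x: "x \<in> carrier E" "z = g x" by auto
      let ?V = "{x \<in> carrier E. p (g x) \<in> W}"
      have V: "?V \<in> submods A E" by (rule stable_subs_vimage[OF E.left_module_axioms Q(1) pg W(1) subset_refl])
      have "x \<in> ?V" "x \<noteq> \<zero>\<^bsub>E\<^esub>" using z x gz by auto
      then have "?V \<noteq> {\<zero>\<^bsub>E\<^esub>}" by blast
      from essential_extension_meets[OF ess V this]
      obtain v where v: "v \<in> ?V" "v \<noteq> \<zero>\<^bsub>E\<^esub>" "v \<in> \<iota> ` carrier X" by (elim bexE conjE)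
      have "p (g v) \<noteq> \<zero>\<^bsub>Q\<^esub>" using hom_inj_iff[OF E.left_module_axioms Q(1) pg] pginj v by auto
      then show ?thesis using v by auto
    qed
    have "inj_on (\<lambda>x. p (g (\<iota> x))) (carrier X)"
    proof (rule inj_onI)
      fix x x' assume h: "x \<in> carrier X" "x' \<in> carrier X" "p (g (\<iota> x)) = p (g (\<iota> x'))"
      then have "\<iota> x = \<iota> x'" using inj_onD[OF pginj] hom_closed[OF io(1)] by simp
      then show "x = x'" using inj_onD[OF io(2)] h by simp
    qed
    then have "essential_extension A X Q (\<lambda>x. p (g (\<iota> x)))"
      unfolding essential_extension_def
      using essQ X.left_module_axioms Q(1) hom_comp[OF io(1) pg] by simp
    then have le: "len Q \<le> len E" by (rule max[OF fgQ])
    have onto: "(\<lambda>x. p (g x)) ` carrier E = carrier Q"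
    proof (rule ccontr)
      assume ne: "(\<lambda>x. p (g x)) ` carrier E \<noteq> carrier Q"
      obtain n where "height_le (submods A Q) n" using fin[OF fgQ] by auto
      then have "height_le (submods A Q) (len Q)" unfolding len_def by (rule LeastI)
      from height_le_proper_embedding[OF E.left_module_axioms Q(1) pg pginj ne this]
      obtain m where "m < len Q" "height_le (submods A E) m" by auto
      then have "len E < len Q" unfolding len_def[of E] by (meson Least_le le_less_trans)
      then show False using le by simp
    qed
    have "\<exists>r\<in>lmod_hom A N E. \<forall>x\<in>carrier N. p (g (r x)) = p x"
      by (rule hom_factor_mono[OF E.left_module_axioms Q(1) N.left_module_axioms pg pginj Q(2)])
         (simp only: onto Q(3) subset_refl)
    then obtain r where r: "r \<in> lmod_hom A N E" "\<forall>x\<in>carrier N. p (g (r x)) = p x" by auto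
    have "r (g x) = x" if "x \<in> carrier E" for x
      by (rule inj_onD[OF pginj]) (use that r hom_closed[OF g(1)] hom_closed[OF r(1)] in auto)
    then show ?thesis using r(1) by auto
  qed
  then have "injective_module A E" by (rule splitting_injective[OF E])
  then show ?thesis using io by auto
qed

lemma injective_extend:
  fixes E M N :: "'a amod"
  assumes "injective_module A E" "fg_module A M" "fg_module A N"
    "g \<in> lmod_hom A M N" "inj_on g (carrier M)" "f \<in> lmod_hom A M E"
  shows "\<exists>h\<in>lmod_hom A N E. \<forall>x\<in>carrier M. h (g x) = f x"
  using assms(1)[unfolded injective_module_def, THEN conjunct2, rule_format, of M N g f] assms(2-) by simp

lemma artin_algebra_finite_length:
  assumes "artin_algebra k A \<phi>" "fg_module A M"
  shows "\<exists>n. height_le (submods A M) n"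
proof -
  interpret artin_algebra k A \<phi> by fact
  obtain n where "height_le (stable_subs (\<phi> ` carrier k) M) n" using artin_algebra_height[OF assms] by auto
  moreover have "submods A M \<subseteq> stable_subs (\<phi> ` carrier k) M"
    using ring_hom_closed[OF structure_hom] by (auto simp: stable_subs_def)
  ultimately show ?thesis using height_le_mono[OF _ _ order_refl] by blast
qed

lemma artin_algebra_injective_embedding:
  fixes X :: "'a amod" and A :: "('a, 'r) ring_scheme"
  assumes art: "artin_algebra k A \<phi>" and X: "fg_module A X"
  shows "\<exists>(E :: 'a amod) \<iota>. injective_module A E \<and> \<iota> \<in> lmod_hom A X E \<and> inj_on \<iota> (carrier X)"
proof -
  interpret artin_algebra k A \<phi> by fact
  let ?K = "\<phi> ` carrier k"
  note fin = artin_algebra_finite_length[OF art]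
  have K: "?K \<subseteq> carrier A" using ring_hom_closed[OF structure_hom] by auto
  obtain l where l: "height_le (stable_subs ?K X) l" using artin_algebra_height[OF art X] by auto
  obtain N where N: "height_le (submods A (regular_module A)) N" using fin[OF A.regular_fg] by auto
  have "\<exists>b. \<forall>(E :: 'a amod) \<iota>. essential_extension A X E \<iota> \<longrightarrow> height_le (stable_subs ?K E) b"
    by (rule essential_extension_height[OF A.ring_axioms K artin_algebra_minus_one[OF art] _ N l])
       (use central in auto)
  then obtain b where
    b: "\<forall>(E :: 'a amod) \<iota>. essential_extension A X E \<iota> \<longrightarrow> height_le (stable_subs ?K E) b" ..
  have "submods A E \<subseteq> stable_subs ?K E" for E :: "'a amod" using K by (auto simp: stable_subs_def)
  then have bound: "height_le (submods A E) b" if "essential_extension A X E \<iota>" for E :: "'a amod" and \<iota>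
    by (rule height_le_mono[OF b[rule_format, OF that] _ order_refl])
  show ?thesis by (rule injective_embedding[OF fin X bound])
qed

section \<open>Splitting of extensions and injective dimension at most one\<close>

text \<open>No path \<open>L \<rightarrow> Y \<rightarrow> F\<close> of nonzero homomorphisms with \<open>Y\<close> indecomposable leads to \<open>C\<close>.\<close>

definition no_path :: "('a, 'r) ring_scheme \<Rightarrow> 'a amod \<Rightarrow> 'a amod set \<Rightarrow> bool" where
  "no_path A L C \<longleftrightarrow> (\<forall>Y :: 'a amod. \<forall>F\<in>C. fg_module A Y \<longrightarrow> indecomposable A Y \<longrightarrow>
     nonzero_hom_exists A L Y \<longrightarrow> \<not> nonzero_hom_exists A Y F)"

text \<open>The key step. Let \<open>P\<close> be cogenerated by \<open>C\<close>, and suppose that there is no path from \<open>L\<close> to \<open>C\<close>.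
  If \<open>E\<close> is the direct sum of indecomposable modules \<open>Y\<^sub>i\<close>, then for each \<open>i\<close> there is no nonzero homomorphism \<open>L \<rightarrow> Y\<^sub>i\<close> or none
  \<open>Y\<^sub>i \<rightarrow> P\<close>. The projection \<open>e\<close> to those \<open>Y\<^sub>i\<close> that admit a nonzero homomorphism from \<open>L\<close> satisfies
  \<open>e u = u\<close> and \<open>g e = 0\<close>.\<close>

lemma separating_endomorphism:
  fixes E L P :: "'a amod" and A :: "('a, 'r) ring_scheme"
  assumes E: "fg_module A E" and h: "height_le (submods A E) n"
    and L: "left_module A L" and P: "left_module A P" "cogenerated A C P"
    and C: "\<And>F. F \<in> C \<Longrightarrow> left_module A F"
    and sep: "no_path A L C"
    and u: "u \<in> lmod_hom A L E" and g: "g \<in> lmod_hom A E P"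
  shows "\<exists>e\<in>lmod_hom A E E. (\<forall>x\<in>carrier L. e (u x) = u x) \<and> (\<forall>z\<in>carrier E. g (e z) = \<zero>\<^bsub>P\<^esub>)"
proof -
  interpret L: left_module A L by fact
  interpret P: left_module A P by fact
  let ?Q = "\<lambda>E :: 'a amod. \<forall>u\<in>lmod_hom A L E. \<forall>g\<in>lmod_hom A E P. \<exists>e\<in>lmod_hom A E E.
    (\<forall>x\<in>carrier L. e (u x) = u x) \<and> (\<forall>z\<in>carrier E. g (e z) = \<zero>\<^bsub>P\<^esub>)"
  have "?Q E"
  proof (rule decomposition_induct[OF E h, where Q = ?Q])
    fix N :: "'a amod"
    assume N: "fg_module A N" "carrier N = {\<zero>\<^bsub>N\<^esub>}"
    show "?Q N"
    proof (intro ballI)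
      fix u g assume g: "g \<in> lmod_hom A N P"
      have "g \<zero>\<^bsub>N\<^esub> = \<zero>\<^bsub>P\<^esub>" by (rule hom_zero[OF fg_moduleD[OF N(1)] P(1) g])
      then show "\<exists>e\<in>lmod_hom A N N. (\<forall>x\<in>carrier L. e (u x) = u x) \<and> (\<forall>z\<in>carrier N. g (e z) = \<zero>\<^bsub>P\<^esub>)"
        using N(2) by (intro bexI[OF _ hom_id]) simp
    qed
  next
    fix N :: "'a amod"
    assume N: "fg_module A N" "indecomposable A N"
    interpret N: left_module A N using N(1) by (rule fg_moduleD)
    show "?Q N"
    proof (intro ballI)
      fix u g assume u: "u \<in> lmod_hom A L N" and g: "g \<in> lmod_hom A N P"
      show "\<exists>e\<in>lmod_hom A N N. (\<forall>x\<in>carrier L. e (u x) = u x) \<and> (\<forall>z\<in>carrier N. g (e z) = \<zero>\<^bsub>P\<^esub>)"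
      proof (cases "nonzero_hom_exists A L N")
        case False
        then have "\<forall>x\<in>carrier L. u x = \<zero>\<^bsub>N\<^esub>" using u unfolding nonzero_hom_exists_def by auto
        then show ?thesis
          using hom_zero[OF N.left_module_axioms P(1) g] by (intro bexI[OF _ hom_null[OF N.left_module_axioms]]) simp
      next
        case True
        have "g z = \<zero>\<^bsub>P\<^esub>" if z: "z \<in> carrier N" for z
        proof (rule ccontr)
          assume "g z \<noteq> \<zero>\<^bsub>P\<^esub>"
          from cogeneratedD[OF P(2) hom_closed[OF g z] this] obtain F f where F: "F \<in> C" "f \<in> lmod_hom A P F" "f (g z) \<noteq> \<zero>\<^bsub>F\<^esub>"
            by (elim bexE)
          have "nonzero_hom_exists A N F"
            unfolding nonzero_hom_exists_def
            using hom_comp[OF g F(2)] F(3) z by (intro bexI[of _ "\<lambda>x. f (g x)"] bexI[of _ z])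
          then show False using sep[unfolded no_path_def, rule_format, OF F(1) N True] by simp
        qed
        then show ?thesis by (intro bexI[OF _ hom_id]) simp
      qed
    qed
  next
    fix N :: "'a amod" and U V p q
    assume N: "fg_module A N"
      and b: "biproduct A N (N\<lparr>carrier := U\<rparr>) (N\<lparr>carrier := V\<rparr>) (\<lambda>x. x) (\<lambda>x. x) p q"
      and IH: "?Q (N\<lparr>carrier := U\<rparr>)" "?Q (N\<lparr>carrier := V\<rparr>)"
    note B = biproductD[OF b]
    let ?U = "N\<lparr>carrier := U\<rparr>" and ?V = "N\<lparr>carrier := V\<rparr>"
    show "?Q N"
    proof (intro ballI)
      fix u g assume u: "u \<in> lmod_hom A L N" and g: "g \<in> lmod_hom A N P"
      obtain e where e: "e \<in> lmod_hom A ?U ?U" "\<forall>x\<in>carrier L. e (p (u x)) = p (u x)"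
        "\<forall>z\<in>carrier ?U. g (e z) = \<zero>\<^bsub>P\<^esub>"
        using IH(1)[rule_format, OF hom_comp[OF u B(6)] hom_comp[OF B(4) g]] by auto
      obtain e' where e': "e' \<in> lmod_hom A ?V ?V" "\<forall>x\<in>carrier L. e' (q (u x)) = q (u x)"
        "\<forall>z\<in>carrier ?V. g (e' z) = \<zero>\<^bsub>P\<^esub>"
        using IH(2)[rule_format, OF hom_comp[OF u B(7)] hom_comp[OF B(5) g]] by auto
      let ?e = "\<lambda>z. e (p z) \<oplus>\<^bsub>N\<^esub> e' (q z)"
      have eh: "?e \<in> lmod_hom A N N"
        by (rule hom_copair[OF b B(1) hom_comp[OF e(1) B(4)] hom_comp[OF e'(1) B(5)]])
      have "?e (u x) = u x" if "x \<in> carrier L" for x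
        using e(2) e'(2) that B(12)[OF hom_closed[OF u that]] by simp
      moreover have "g (?e z) = \<zero>\<^bsub>P\<^esub>" if z: "z \<in> carrier N" for z
      proof -
        note c = hom_closed[OF B(6) z] hom_closed[OF B(7) z]
        have c': "e (p z) \<in> carrier N" "e' (q z) \<in> carrier N"
          using hom_closed[OF B(4) hom_closed[OF e(1) c(1)]] hom_closed[OF B(5) hom_closed[OF e'(1) c(2)]] .
        have "g (?e z) = g (e (p z)) \<oplus>\<^bsub>P\<^esub> g (e' (q z))" by (rule hom_add[OF g c'])
        then show ?thesis using e(3) e'(3) c by simp
      qed
      ultimately show "\<exists>e\<in>lmod_hom A N N. (\<forall>x\<in>carrier L. e (u x) = u x) \<and> (\<forall>z\<in>carrier N. g (e z) = \<zero>\<^bsub>P\<^esub>)"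
        using eh by (intro bexI[of _ ?e]) simp_all
    qed
  qed
  then show ?thesis using u g by simp
qed

text \<open>If \<open>0 \<rightarrow> L \<rightarrow> E \<rightarrow> P\<close> is exact, the endomorphism \<open>e\<close> from above maps \<open>E\<close> into the image of \<open>L\<close>
  and fixes that image pointwise; so it is a retraction onto it.\<close>

lemma extension_splits:
  fixes E L P :: "'a amod" and A :: "('a, 'r) ring_scheme"
  assumes E: "fg_module A E" "height_le (submods A E) n"
    and L: "left_module A L" and P: "left_module A P" "cogenerated A C P"
    and C: "\<And>F. F \<in> C \<Longrightarrow> left_module A F"
    and sep: "no_path A L C"
    and u: "u \<in> lmod_hom A L E" "inj_on u (carrier L)" and g: "g \<in> lmod_hom A E P"
    and exact: "lmod_ker E P g \<subseteq> u ` carrier L"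
  shows "\<exists>r\<in>lmod_hom A E L. \<forall>x\<in>carrier L. r (u x) = x"
proof -
  note EL = fg_moduleD[OF E(1)]
  obtain e where e: "e \<in> lmod_hom A E E" "\<forall>x\<in>carrier L. e (u x) = u x" "\<forall>z\<in>carrier E. g (e z) = \<zero>\<^bsub>P\<^esub>"
    using separating_endomorphism[OF E L P C sep u(1) g] by auto
  have "e ` carrier E \<subseteq> lmod_ker E P g" using e(3) hom_closed[OF e(1)] by (auto simp: lmod_ker_def)
  with exact have "e ` carrier E \<subseteq> u ` carrier L" by simp
  from hom_factor_mono[OF L EL EL u e(1) this]
  obtain r where r: "r \<in> lmod_hom A E L" "\<forall>x\<in>carrier E. u (r x) = e x" by auto
  have "r (u x) = x" if "x \<in> carrier L" for x
    by (rule inj_onD[OF u(2)]) (use that r e(2) hom_closed[OF u(1)] hom_closed[OF r(1)] in auto)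
  then show ?thesis using r(1) by auto
qed

text \<open>Extensions by \<open>L\<close> of submodules of cogenerated modules split by the previous lemma. Hence the
  cokernel \<open>Q\<close> of an embedding of \<open>L\<close> into an injective module is injective: a
  homomorphism \<open>f : M \<rightarrow> Q\<close> on a submodule \<open>M\<close> of \<open>N\<close> is pulled back to the preimage \<open>M'\<close> of \<open>M\<close> in a projective module that maps onto \<open>N\<close>. There it lifts
  to the injective module, because the pullback extension of \<open>M'\<close> by \<open>L\<close> splits; the lift extends to
  the projective module, and the extension descends to \<open>N\<close>.\<close>

lemma injective_cokernel:
  fixes L E Q :: "'a amod" and A :: "('a, 'r) ring_scheme"
  assumes fin: "\<And>M :: 'a amod. fg_module A M \<Longrightarrow> \<exists>n. height_le (submods A M) n"
    and reg: "cogenerated A C (regular_module A)"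
    and C: "\<And>F. F \<in> C \<Longrightarrow> left_module A F"
    and L: "fg_module A L" and E: "injective_module A E" and \<iota>: "\<iota> \<in> lmod_hom A L E" "inj_on \<iota> (carrier L)"
    and Q: "left_module A Q" and p: "p \<in> lmod_hom A E Q" "p ` carrier E = carrier Q"
      "lmod_ker E Q p = \<iota> ` carrier L"
    and sep: "no_path A L C"
  shows "injective_module A Q"
  unfolding injective_module_def
proof (intro conjI allI impI; (elim conjE)?)
  have fgE: "fg_module A E" using E by (simp add: injective_module_def)
  show "fg_module A Q" by (rule fg_image[OF fgE Q p(1,2)])
  fix M N :: "'a amod" and g f
  assume M: "fg_module A M" and N: "fg_module A N" and g: "g \<in> lmod_hom A M N" "inj_on g (carrier M)"
    and f: "f \<in> lmod_hom A M Q"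
  note LM = fg_moduleD[OF M] and LN = fg_moduleD[OF N] and LL = fg_moduleD[OF L] and LE = fg_moduleD[OF fgE]
  interpret L: left_module A L by (rule LL)
  interpret E: left_module A E by (rule LE)
  interpret Q: left_module A Q by (rule Q)
  interpret M: left_module A M by (rule LM)
  interpret N: left_module A N by (rule LN)
  obtain P :: "'a amod" and c where P: "projective_module A P" "cogenerated A C P" "c \<in> lmod_hom A P N"
    "c ` carrier P = carrier N" using enough_projectives[OF reg N] by auto
  have fgP: "fg_module A P" by (rule projective_fg[OF P(1)])
  note LP = fg_moduleD[OF fgP]
  interpret P: left_module A P by (rule LP)
  obtain n where n: "height_le (submods A P) n" using fin[OF fgP] by auto
  define M' where "M' = {x \<in> carrier P. c x \<in> g ` carrier M}"
  have gM: "g ` carrier M \<in> submods A N"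
    by (rule stable_subs_image[OF LM LN g(1) M.stable_subs_carrier[OF subset_refl] subset_refl])
  have M': "M' \<in> submods A P"
    unfolding M'_def by (rule stable_subs_vimage[OF LP LN P(3) gM subset_refl])
  have M'P: "M' \<subseteq> carrier P" by (rule stable_subsD(1)[OF M'])
  let ?M' = "P\<lparr>carrier := M'\<rparr>"
  have LM': "left_module A ?M'" by (rule P.sub_left_module[OF M'])
  have fgM': "fg_module A ?M'" by (rule fg_submodule[OF fgP n M'])
  interpret M': left_module A ?M' by (rule LM')
  have "c ` carrier ?M' \<subseteq> g ` carrier M" by (auto simp: M'_def)
  from hom_factor_mono[OF LM LN LM' g hom_restrict[OF P(3) M'P] this]
  obtain w where w: "w \<in> lmod_hom A ?M' M" "\<forall>x\<in>carrier ?M'. g (w x) = c x" by auto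
  have fw: "(\<lambda>x. f (w x)) \<in> lmod_hom A ?M' Q" by (rule hom_comp[OF w(1) f])
  \<comment> \<open>The pullback of \<open>p\<close> and \<open>f w\<close>.\<close>
  obtain S :: "'a amod" and i j s t where S: "fg_module A S" "biproduct A S E ?M' i j s t"
    using biproduct_exists[OF fgE fgM'] by auto
  note B = biproductD[OF S(2)]
  interpret S: left_module A S by (rule B(1))
  have ps: "(\<lambda>z. p (s z)) \<in> lmod_hom A S Q" by (rule hom_comp[OF B(6) p(1)])
  have ft: "(\<lambda>z. f (w (t z))) \<in> lmod_hom A S Q" by (rule hom_comp[OF B(7) fw])
  have diff: "(\<lambda>z. p (s z) \<oplus>\<^bsub>Q\<^esub> \<ominus>\<^bsub>Q\<^esub> f (w (t z))) \<in> lmod_hom A S Q"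
    by (rule hom_plus[OF Q ps hom_neg[OF Q ft]])
  define T where "T = {z \<in> carrier S. p (s z) = f (w (t z))}"
  have "lmod_ker S Q (\<lambda>z. p (s z) \<oplus>\<^bsub>Q\<^esub> \<ominus>\<^bsub>Q\<^esub> f (w (t z))) = T"
    using Q.M.diff_eq_zero[OF hom_closed[OF ps] hom_closed[OF ft]]
    by (auto simp: lmod_ker_def T_def a_minus_def)
  then have T: "T \<in> submods A S" using hom_ker_submods[OF B(1) Q diff] by simp
  have TS: "T \<subseteq> carrier S" by (rule stable_subsD(1)[OF T])
  let ?T = "S\<lparr>carrier := T\<rparr>"
  have LT: "left_module A ?T" by (rule S.sub_left_module[OF T])
  obtain n' where n': "height_le (submods A S) n'" using fin[OF S(1)] by auto
  have fgT: "fg_module A ?T" by (rule fg_submodule[OF S(1) n' T])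
  obtain n'' where n'': "height_le (submods A ?T) n''" using fin[OF fgT] by auto
  have tT: "t \<in> lmod_hom A ?T ?M'" and sT: "s \<in> lmod_hom A ?T E"
    using hom_restrict[OF B(7) TS] hom_restrict[OF B(6) TS] .
  have g': "t \<in> lmod_hom A ?T P" using hom_comp[OF tT hom_incl[OF M'P]] .
  have p\<iota>: "p (\<iota> x) = \<zero>\<^bsub>Q\<^esub>" if "x \<in> carrier L" for x
  proof -
    have "\<iota> x \<in> lmod_ker E Q p" unfolding p(3) using that by simp
    then show ?thesis by (simp add: lmod_ker_def)
  qed
  have f0: "f (w \<zero>\<^bsub>P\<^esub>) = \<zero>\<^bsub>Q\<^esub>" using hom_zero[OF LM' Q fw] by simp
  have i\<iota>: "(\<lambda>x. i (\<iota> x)) \<in> lmod_hom A L S" by (rule hom_comp[OF \<iota>(1) B(4)])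
  have "i (\<iota> x) \<in> T" if "x \<in> carrier L" for x
    using hom_closed[OF i\<iota> that] B(8,9)[OF hom_closed[OF \<iota>(1) that]] p\<iota>[OF that] f0 by (simp add: T_def)
  then have u: "(\<lambda>x. i (\<iota> x)) \<in> lmod_hom A L ?T" by (intro hom_corestrict[OF i\<iota>]) auto
  have uinj: "inj_on (\<lambda>x. i (\<iota> x)) (carrier L)"
  proof (rule inj_onI)
    fix x y assume xy: "x \<in> carrier L" "y \<in> carrier L" "i (\<iota> x) = i (\<iota> y)"
    then have "s (i (\<iota> x)) = s (i (\<iota> y))" by simp
    then have "\<iota> x = \<iota> y" 
      by (simp only: B(8)[OF hom_closed[OF \<iota>(1) xy(1)]] B(8)[OF hom_closed[OF \<iota>(1) xy(2)]])
    then show "x = y" using inj_onD[OF \<iota>(2)] xy by simp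
  qed
  have exact: "lmod_ker ?T P t \<subseteq> (\<lambda>x. i (\<iota> x)) ` carrier L"
  proof
    fix z assume "z \<in> lmod_ker ?T P t"
    then have z: "z \<in> carrier S" "p (s z) = f (w (t z))" "t z = \<zero>\<^bsub>P\<^esub>" by (auto simp: lmod_ker_def T_def)
    have sz: "s z \<in> carrier E" by (rule hom_closed[OF B(6) z(1)])
    have "s z \<in> lmod_ker E Q p" using z(2,3) f0 sz by (simp add: lmod_ker_def)
    then obtain x where x: "x \<in> carrier L" "s z = \<iota> x" unfolding p(3) by auto
    have "j (t z) = \<zero>\<^bsub>S\<^esub>" using z(3) hom_zero[OF LM' B(1,5)] by simp
    then have "z = i (\<iota> x)" using B(12)[OF z(1)] x hom_closed[OF i\<iota> x(1)] by simp
    then show "z \<in> (\<lambda>x. i (\<iota> x)) ` carrier L" using x(1) by simp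
  qed
  obtain r where r: "r \<in> lmod_hom A ?T L" "\<forall>x\<in>carrier L. r (i (\<iota> x)) = x"
    using extension_splits[OF fgT n'' LL LP P(2) C sep u uinj g' exact] by auto
  \<comment> \<open>\<open>s - \<iota> r\<close> vanishes on \<open>L\<close> and hence factors through \<open>M'\<close>.\<close>
  have \<iota>r: "(\<lambda>z. \<iota> (r z)) \<in> lmod_hom A ?T E" by (rule hom_comp[OF r(1) \<iota>(1)])
  let ?k = "\<lambda>z. s z \<oplus>\<^bsub>E\<^esub> \<ominus>\<^bsub>E\<^esub> \<iota> (r z)"
  have k: "?k \<in> lmod_hom A ?T E" by (rule hom_plus[OF LE sT hom_neg[OF LE \<iota>r]])
  have onto: "t ` carrier ?T = carrier ?M'"
  proof (intro equalityI subsetI)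
    fix x assume x: "x \<in> carrier ?M'"
    have "f (w x) \<in> p ` carrier E" unfolding p(2) by (rule hom_closed[OF fw x])
    then obtain y where y: "y \<in> carrier E" "p y = f (w x)" by auto
    note c = hom_closed[OF B(4) y(1)] hom_closed[OF B(5) x]
    have "s (i y \<oplus>\<^bsub>S\<^esub> j x) = y" using c y(1) B(8)[OF y(1)] B(11)[OF x] by (simp add: hom_add[OF B(6)])
    moreover have t: "t (i y \<oplus>\<^bsub>S\<^esub> j x) = x"
      using c hom_add[OF B(7) c] B(9)[OF y(1)] B(10)[OF x] x M'P by (simp add: subset_iff)
    ultimately have "i y \<oplus>\<^bsub>S\<^esub> j x \<in> T" using c y(2) by (simp add: T_def)
    then show "x \<in> t ` carrier ?T" using t by (intro image_eqI[of _ _ "i y \<oplus>\<^bsub>S\<^esub> j x"]) simp_all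
  qed (use hom_closed[OF tT] in auto)
  have "?k z = \<zero>\<^bsub>E\<^esub>" if z: "z \<in> carrier ?T" "t z = \<zero>\<^bsub>?M'\<^esub>" for z
  proof -
    have "z \<in> lmod_ker ?T P t" using z by (simp add: lmod_ker_def)
    then have "z \<in> (\<lambda>x. i (\<iota> x)) ` carrier L" using exact by (rule rev_subsetD)
    then obtain x where x: "x \<in> carrier L" "z = i (\<iota> x)" by auto
    note c = hom_closed[OF \<iota>(1) x(1)]
    show ?thesis unfolding x(2) using r(2) x(1) B(8)[OF c] c by (simp add: E.M.r_neg)
  qed
  from hom_factor_epi[OF LT LM' LE tT onto k this]
  obtain l where l: "l \<in> lmod_hom A ?M' E" "\<forall>z\<in>carrier ?T. l (t z) = ?k z" by auto
  have pl: "p (l x) = f (w x)" if x: "x \<in> carrier ?M'" for x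
  proof -
    have "x \<in> t ` carrier ?T" unfolding onto by (rule x)
    then obtain z where z: "z \<in> carrier ?T" "x = t z" by auto
    have zc: "s z \<in> carrier E" "\<iota> (r z) \<in> carrier E" using hom_closed[OF sT z(1)] hom_closed[OF \<iota>r z(1)] .
    have "p (l x) = p (s z) \<oplus>\<^bsub>Q\<^esub> \<ominus>\<^bsub>Q\<^esub> p (\<iota> (r z))"
      using l(2) z zc by (simp add: hom_add[OF p(1)] hom_minus[OF LE Q p(1)])
    also have "\<dots> = p (s z)"
      using p\<iota>[OF hom_closed[OF r(1) z(1)]] hom_closed[OF p(1) zc(1)] Q.M.r_neg[OF Q.M.zero_closed]
        Q.M.diff_zero[OF hom_closed[OF p(1) zc(1)]] by (simp add: a_minus_def)
    also have "\<dots> = f (w x)" using z by (auto simp: T_def)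
    finally show ?thesis .
  qed
  have inclinj: "inj_on (\<lambda>x. x) (carrier ?M')" by (simp add: inj_on_def)
  obtain h where h: "h \<in> lmod_hom A P E" "\<forall>x\<in>carrier ?M'. h x = l x"
    using injective_extend[OF E fgM' fgP hom_incl[OF M'P] inclinj l(1)] by auto
  have ph: "(\<lambda>x. p (h x)) \<in> lmod_hom A P Q" by (rule hom_comp[OF h(1) p(1)])
  have "p (h x) = \<zero>\<^bsub>Q\<^esub>" if x: "x \<in> carrier P" "c x = \<zero>\<^bsub>N\<^esub>" for x
  proof -
    have xM': "x \<in> carrier ?M'" using x stable_subsD(3)[OF gM] by (simp add: M'_def)
    have "g (w x) = \<zero>\<^bsub>N\<^esub>" using w(2) xM' x by simp
    then have "w x = \<zero>\<^bsub>M\<^esub>" using hom_inj_iff[OF LM LN g(1)] g(2) hom_closed[OF w(1) xM'] by auto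
    then have "f (w x) = \<zero>\<^bsub>Q\<^esub>" using hom_zero[OF LM Q f] by simp
    then show ?thesis using h(2) pl[OF xM'] xM' by simp
  qed
  from hom_factor_epi[OF LP LN Q P(3,4) ph this]
  obtain v where v: "v \<in> lmod_hom A N Q" "\<forall>x\<in>carrier P. v (c x) = p (h x)" by auto
  have "v (g m) = f m" if m: "m \<in> carrier M" for m
  proof -
    have "g m \<in> c ` carrier P" unfolding P(4) by (rule hom_closed[OF g(1) m])
    then obtain x where x: "x \<in> carrier P" "g m = c x" by auto
    have xM': "x \<in> carrier ?M'" using x m by (auto simp: M'_def)
    have "g (w x) = g m" using w(2) xM' x by simp
    then have "w x = m" using inj_onD[OF g(2)] hom_closed[OF w(1) xM'] m by auto
    then show ?thesis using v(2) x h(2) pl[OF xM'] xM' by simp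
  qed
  then show "\<exists>h\<in>lmod_hom A N Q. \<forall>x\<in>carrier M. h (g x) = f x" using v(1) by auto
qed

lemma inj_dim_le_one:
  fixes L :: "'a amod" and A :: "('a, 'r) ring_scheme"
  assumes art: "artin_algebra k A \<phi>" and reg: "cogenerated A C (regular_module A)"
    and C: "\<And>F. F \<in> C \<Longrightarrow> left_module A F" and L: "fg_module A L"
    and sep: "no_path A L C"
  shows "inj_dim A L \<le> 1"
proof -
  obtain E :: "'a amod" and \<iota> where E: "injective_module A E" "\<iota> \<in> lmod_hom A L E" "inj_on \<iota> (carrier L)"
    using artin_algebra_injective_embedding[OF art L] by auto
  have LE: "left_module A E" using E(1) by (auto simp: injective_module_def intro: fg_moduleD)
  interpret L: left_module A L using L by (rule fg_moduleD)
  have I: "\<iota> ` carrier L \<in> submods A E"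
    by (rule stable_subs_image[OF L.left_module_axioms LE E(2) L.stable_subs_carrier[OF subset_refl] subset_refl])
  obtain Q :: "'a amod" and p where Q: "left_module A Q" "p \<in> lmod_hom A E Q" "p ` carrier E = carrier Q"
    "lmod_ker E Q p = \<iota> ` carrier L" using quotient_exists[OF LE I] by auto
  have Qinj: "injective_module A Q"
    by (rule injective_cokernel[OF artin_algebra_finite_length[OF art] reg C L E Q sep])
  have "has_injective_resolution A L 1"
    unfolding has_injective_resolution_def
  proof (intro exI[of _ "\<lambda>i. if i = 0 then E else Q"] exI[of _ "\<lambda>i. if i = 0 then \<iota> else p"] conjI allI impI)
    fix i :: nat
    assume "i \<le> 1"
    then consider "i = 0" | "i = 1" by linarith
    then show "(if i = 0 then \<iota> else p) \<in>
        lmod_hom A (case_nat L (\<lambda>i. if i = 0 then E else Q) i) (if i = 0 then E else Q)"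
      using E Q by cases simp_all
  qed (use E Q Qinj in simp_all)
  then show ?thesis unfolding inj_dim_def by (intro Inf_lower) (auto simp: one_enat_def)
qed

section \<open>Modules with a nonzero homomorphism to the left part\<close>

lemma nonzero_hom_iso:
  assumes "left_module R Y" "left_module R Y'" and f: "inverse_homs R Y Y' f g"
  shows "nonzero_hom_exists R L Y \<Longrightarrow> nonzero_hom_exists R L Y'"
    and "nonzero_hom_exists R Y N \<Longrightarrow> nonzero_hom_exists R Y' N"
proof -
  note F = inverse_homsD[OF f]
  assume "nonzero_hom_exists R L Y"
  then obtain h x where h: "h \<in> lmod_hom R L Y" "x \<in> carrier L" "h x \<noteq> \<zero>\<^bsub>Y\<^esub>"
    unfolding nonzero_hom_exists_def by (elim bexE)
  have "f (h x) \<noteq> \<zero>\<^bsub>Y'\<^esub>"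
    using hom_inj_iff[OF assms(1,2) F(1)] inverse_homs_inj[OF f] hom_closed[OF h(1,2)] h(3) by auto
  then show "nonzero_hom_exists R L Y'"
    unfolding nonzero_hom_exists_def using hom_comp[OF h(1) F(1)] h(2)
    by (intro bexI[of _ "\<lambda>x. f (h x)"] bexI[of _ x])
next
  note F = inverse_homsD[OF f]
  assume "nonzero_hom_exists R Y N"
  then obtain h x where h: "h \<in> lmod_hom R Y N" "x \<in> carrier Y" "h x \<noteq> \<zero>\<^bsub>N\<^esub>"
    unfolding nonzero_hom_exists_def by (elim bexE)
  have "h (g (f x)) \<noteq> \<zero>\<^bsub>N\<^esub>" using F(3)[OF h(2)] h(3) by simp
  then show "nonzero_hom_exists R Y' N"
    unfolding nonzero_hom_exists_def using hom_comp[OF F(2) h(1)] hom_closed[OF F(1) h(2)]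
    by (intro bexI[of _ "\<lambda>y. h (g y)"] bexI[of _ "f x"])
qed

lemma is_ind_representative:
  fixes A :: "('a, 'r) ring_scheme" and Y :: "'a amod"
  assumes ind: "is_ind A indA" and Y: "fg_module A Y" "indecomposable A Y"
  obtains Y' f g where "Y' \<in> indA" "fg_module A Y'" "inverse_homs A Y Y' f g"
proof -
  have "\<exists>!Z. Z \<in> indA \<and> lmod_iso A Y Z" using ind Y unfolding is_ind_def by simp
  then obtain Y' where Y': "Y' \<in> indA" "lmod_iso A Y Y'" by (elim ex1E conjE)
  have fg: "fg_module A Y'" using ind Y'(1) unfolding is_ind_def by simp
  obtain f g where "inverse_homs A Y Y' f g"
    using lmod_iso_inverse[OF fg_moduleD[OF Y(1)] fg_moduleD[OF fg] Y'(2)] by auto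
  then show thesis by (rule that[OF Y'(1) fg])
qed

lemma left_part_fg:
  assumes "is_ind A indA" "F \<in> left_part m A indA"
  shows "F \<in> indA" "fg_module A F"
  using assms by (auto simp: left_part_def is_ind_def)

text \<open>The indecomposable modules \<open>L\<close> and \<open>Y\<close> need not be the chosen representatives of their isomorphism
  classes; the path runs through the representatives.\<close>

lemma pd_le_path:
  fixes A :: "('a, 'r) ring_scheme" and L Y F :: "'a amod"
  assumes ind: "is_ind A indA" and L: "fg_module A L" "indecomposable A L"
    and Y: "fg_module A Y" "indecomposable A Y" and F: "F \<in> left_part m A indA"
    and LY: "nonzero_hom_exists A L Y" and YF: "nonzero_hom_exists A Y F"
  shows "pd_le A m L"
proof -
  obtain L' f g where L': "L' \<in> indA" "fg_module A L'" "inverse_homs A L L' f g"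
    by (rule is_ind_representative[OF ind L])
  obtain Y' u v where Y': "Y' \<in> indA" "fg_module A Y'" "inverse_homs A Y Y' u v"
    by (rule is_ind_representative[OF ind Y])
  have "nonzero_hom_exists A L' Y'"
    by (rule nonzero_hom_iso(2)[OF fg_moduleD[OF L(1)] fg_moduleD[OF L'(2)] L'(3)])
       (rule nonzero_hom_iso(1)[OF fg_moduleD[OF Y(1)] fg_moduleD[OF Y'(2)] Y'(3) LY])
  moreover have "nonzero_hom_exists A Y' F"
    by (rule nonzero_hom_iso(2)[OF fg_moduleD[OF Y(1)] fg_moduleD[OF Y'(2)] Y'(3) YF])
  ultimately have "predecessor A indA L' F"
    unfolding predecessor_def using L'(1) Y'(1) left_part_fg(1)[OF ind F]
    by (intro conjI converse_rtranclp_into_rtranclp[of _ L' Y'] r_into_rtranclp) simp_all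
  then have "proj_dim A L' \<le> enat m" using F by (simp add: left_part_def)
  then have "pd_le A m L'" by (simp add: proj_dim_le_iff[OF fg_moduleD[OF L'(2)]])
  then show ?thesis
    by (rule pd_le_iso[OF _ fg_moduleD[OF L'(2)] fg_moduleD[OF L(1)] inverse_homs_sym[OF L'(3)]])
qed

lemma pd_le_zero_module:
  fixes Z :: "'a amod"
  assumes "fg_module A Z" "carrier Z = {\<zero>\<^bsub>Z\<^esub>}"
  shows "pd_le A n Z"
proof -
  have "projective_module A Z"
  proof (rule projectiveI[OF assms(1)])
    fix M N :: "'a amod" and g f
    assume h: "fg_module A M" "fg_module A N" "g \<in> lmod_hom A M N" "f \<in> lmod_hom A Z N"
    have "g \<zero>\<^bsub>M\<^esub> = f \<zero>\<^bsub>Z\<^esub>"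
      using hom_zero[OF h(1,2)[THEN fg_moduleD] h(3)] hom_zero[OF assms(1)[THEN fg_moduleD] h(2)[THEN fg_moduleD] h(4)]
      by simp
    then show "\<exists>h\<in>lmod_hom A Z M. \<forall>x\<in>carrier Z. g (h x) = f x"
      using assms(2) by (intro bexI[OF _ hom_null[OF fg_moduleD[OF h(1)]]]) simp
  qed
  then have "pd_le A 0 Z" by simp
  then show ?thesis by (rule pd_le_mono) simp
qed

text \<open>This applies to submodules of free modules if the ring lies in the additive closure of the left
  part: each indecomposable summand has a nonzero homomorphism to a member of the left part.\<close>

lemma pd_le_cogenerated:
  fixes A :: "('a, 'r) ring_scheme" and M :: "'a amod"
  assumes ind: "is_ind A indA" and M: "fg_module A M" "height_le (submods A M) n"
    and cog: "cogenerated A (left_part m A indA) M"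
  shows "pd_le A m M"
proof -
  let ?C = "left_part m A indA"
  let ?Q = "\<lambda>M :: 'a amod. cogenerated A ?C M \<longrightarrow> pd_le A m M"
  have "?Q M"
  proof (rule decomposition_induct[OF M, where Q = ?Q])
    fix N :: "'a amod"
    assume "fg_module A N" "carrier N = {\<zero>\<^bsub>N\<^esub>}"
    then have "pd_le A m N" by (rule pd_le_zero_module)
    then show "?Q N" by (rule impI)
  next
    fix N :: "'a amod"
    assume N: "fg_module A N" "indecomposable A N"
    interpret N: left_module A N using N(1) by (rule fg_moduleD)
    show "?Q N"
    proof
      assume cN: "cogenerated A ?C N"
      have "carrier N \<noteq> {\<zero>\<^bsub>N\<^esub>}" using N(2) by (simp add: indecomposable_def)
      then obtain x where x: "x \<in> carrier N" "x \<noteq> \<zero>\<^bsub>N\<^esub>" using N.M.zero_closed by blast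
      then obtain F h where F: "F \<in> ?C" "h \<in> lmod_hom A N F" "h x \<noteq> \<zero>\<^bsub>F\<^esub>"
        using cogeneratedD[OF cN x] by (elim bexE)
      have "nonzero_hom_exists A N F"
        unfolding nonzero_hom_exists_def by (intro bexI[OF _ F(2)] bexI[OF _ x(1)] F(3))
      moreover have "nonzero_hom_exists A N N"
        unfolding nonzero_hom_exists_def by (intro bexI[OF _ hom_id] bexI[OF _ x(1)] x(2))
      ultimately show "pd_le A m N" using pd_le_path[OF ind N N F(1)] by simp
    qed
  next
    fix N :: "'a amod" and U V p q
    assume N: "fg_module A N"
      and b: "biproduct A N (N\<lparr>carrier := U\<rparr>) (N\<lparr>carrier := V\<rparr>) (\<lambda>x. x) (\<lambda>x. x) p q"
      and IH: "?Q (N\<lparr>carrier := U\<rparr>)" "?Q (N\<lparr>carrier := V\<rparr>)"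
    note B = biproductD[OF b]
    show "?Q N"
    proof
      assume cN: "cogenerated A ?C N"
      have "cogenerated A ?C (N\<lparr>carrier := U\<rparr>)" "cogenerated A ?C (N\<lparr>carrier := V\<rparr>)"
        by (rule cogenerated_inj[OF B(2,1,4) _ cN], simp add: inj_on_def,
            rule cogenerated_inj[OF B(3,1,5) _ cN], simp add: inj_on_def)
      then show "pd_le A m N" using pd_le_biproduct[OF b] IH by simp
    qed
  qed
  then show ?thesis using cog by simp
qed

theorem proposition3p9:
  fixes k :: "('k, 's) ring_scheme" and A :: "('a, 'r) ring_scheme" and \<phi> :: "'k \<Rightarrow> 'a"
    and indA :: "'a amod set" and m :: nat
  assumes "artin_algebra k A \<phi>"
    and "is_ind A indA"
    and "m > 0"
    and "in_add A (left_part m A indA) (regular_module A)"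
  shows "(gl_dim A \<le> enat (m + 1) \<and> (\<forall>L\<in>indA. proj_dim A L \<le> enat m \<or> inj_dim A L \<le> 1)) \<and>
         (gl_dim A = enat (m + 1) \<longrightarrow> m1_almost_hereditary m A)"
proof -
  interpret artin_algebra k A \<phi> by fact
  let ?C = "left_part m A indA"
  note fin = artin_algebra_finite_length[OF assms(1)]
  have C: "left_module A F" if "F \<in> ?C" for F using left_part_fg(2)[OF assms(2) that] by (rule fg_moduleD)
  have reg: "cogenerated A ?C (regular_module A)"
    by (rule in_add_cogenerated[OF A.ring_axioms C assms(4)])
  have "proj_dim A L \<le> enat (m + 1)" if L: "fg_module A L" for L :: "'a amod"
  proof -
    obtain P :: "'a amod" and f where P: "projective_module A P" "cogenerated A ?C P"
      "f \<in> lmod_hom A P L" "f ` carrier P = carrier L" using enough_projectives[OF reg L] by auto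
    note fgP = projective_fg[OF P(1)]
    interpret P: left_module A P using fgP by (rule fg_moduleD)
    have K: "lmod_ker P L f \<in> submods A P"
      by (rule hom_ker_submods[OF P.left_module_axioms fg_moduleD[OF L] P(3)])
    let ?K = "P\<lparr>carrier := lmod_ker P L f\<rparr>"
    obtain n where n: "height_le (submods A P) n" using fin[OF fgP] by auto
    have fgK: "fg_module A ?K" by (rule fg_submodule[OF fgP n K])
    obtain n' where n': "height_le (submods A ?K) n'" using fin[OF fgK] by auto
    have "cogenerated A ?C ?K"
      by (rule cogenerated_inj[OF fg_moduleD[OF fgK] P.left_module_axioms hom_incl[OF stable_subsD(1)[OF K]] _ P(2)])
         (simp add: inj_on_def)
    then have "pd_le A m ?K" by (rule pd_le_cogenerated[OF assms(2) fgK n'])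
    then have "pd_le A (Suc m) L" by (rule pd_le_SucI[OF P(1,3,4)])
    then show ?thesis by (simp add: proj_dim_le_iff[OF fg_moduleD[OF L]] del: pd_le.simps)
  qed
  then have gl: "gl_dim A \<le> enat (m + 1)" unfolding gl_dim_def by (auto intro!: SUP_least)
  have dich: "proj_dim A L \<le> enat m \<or> inj_dim A L \<le> 1"
    if L: "fg_module A L" "indecomposable A L" for L :: "'a amod"
  proof (rule disjCI)
    assume id: "\<not> inj_dim A L \<le> 1"
    have "\<not> no_path A L ?C" using inj_dim_le_one[OF assms(1) reg C L(1)] id by auto
    then obtain Y F :: "'a amod" where "fg_module A Y" "indecomposable A Y" "F \<in> ?C"
      "nonzero_hom_exists A L Y" "nonzero_hom_exists A Y F" unfolding no_path_def by auto
    then have "pd_le A m L" by (rule pd_le_path[OF assms(2) L])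
    then show "proj_dim A L \<le> enat m" by (simp add: proj_dim_le_iff[OF fg_moduleD[OF L(1)]])
  qed
  have "\<forall>L\<in>indA. proj_dim A L \<le> enat m \<or> inj_dim A L \<le> 1"
    using dich assms(2) unfolding is_ind_def by simp
  moreover have "m1_almost_hereditary m A" if "gl_dim A = enat (m + 1)"
    using that dich unfolding m1_almost_hereditary_def by simp
  ultimately show ?thesis using gl by simp
qed

end
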